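(* Let $T\colon \mathbb{R}^d\times \mathcal{X}\to \mathcal{X}$ be a continuous action of $\mathbb{R}^d$ on a compact metric space $(\mathcal{X}, \mathbf{d})$. Suppose the upper metric mean dimension $\overline{\mathrm{mdim}}_{\mathrm{M}}(\mathcal{X}, T, \mathbf{d})$ is finite. Let $\lambda$ be a Borel probability measure on $\mathscr{M}^T(\mathcal{X})$ and define $\mu \in \mathscr{M}^T(\mathcal{X})$ by $\mu = \int_{\mathscr{M}^T(\mathcal{X})} \nu \, d\lambda(\nu)$. Then \[ \overline{\mathrm{rdim}}(\mathcal{X}, T, \mathbf{d}, \mu) \leq \int_{\mathscr{M}^T(\mathcal{X})} \overline{\mathrm{rdim}}(\mathcal{X}, T, \mathbf{d}, \nu) \, d\lambda(\nu). \]
   Context: Conventions: $d$ is a positive integer, $\log=\log_2$, and $\mathbf{m}$ is Lebesgue measure on $\mathbb{R}^d$. $\mathscr{M}^T(\mathcal{X})$ is the set of $T$-invariant Borel probability measures on $\mathcal{X}$ with the weak$^*$ topology and its Borel $\sigma$-algebra; $\mu=\int\nu\,d\lambda(\nu)$ means $\mu(A)=\int \nu(A)\,d\lambda(\nu)$ for all Borel $A\subset\mathcal{X}$. Mutual information: for random variables $X,Y$ with values in finite sets, $I(X;Y)=H(X)+H(Y)-H(X,Y)$ where $H$ is Shannon entropy (base 2). For $X,Y$ with values in measurable spaces, $I(X;Y)$ is the supremum of $I(\alpha\circ X;\beta\circ Y)$ over all finite measurable partitions $\alpha,\beta$ of the two target spaces, where $\alpha\circ X$ is the index of the element of $\alpha$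 containing $X$ (similarly $\beta\circ Y$). Rate distortion function: for $L>0$, $L^1([0,L)^d,\mathcal{X})$ is the space of measurable maps $[0,L)^d\to\mathcal{X}$ modulo $\mathbf{m}$-a.e. equality, with metric $D(f,g)=\int_{[0,L)^d}\mathbf{d}(f(u),g(u))\,d\mathbf{m}(u)$ and its Borel $\sigma$-algebra. For $\mu\in\mathscr{M}^T(\mathcal{X})$ and $\varepsilon>0$, $R_L(\mathbf{d},\mu,\varepsilon)$ is the infimum of $I(X;Y)$ over pairs of random variables $X,Y$ defined on a common probability space such that $X$ takes values in $\mathcal{X}$ with law $\mu$, and $Y=(Y_u)_{u\in[0,L)^d}$ takes values in $L^1([0,L)^d,\mathcal{X})$ with $\mathbb{E}\big(\frac{1}{L^d}\int_{[0,L)^d}\mathbf{d}(T^uX,Y_u)\,d\mathbf{m}(u)\big)<\varepsilon$. Set $R(\mathbf{d},\mu,\varepsilon)=\lim_{L\to\infty}R_L(\mathbf{d},\mu,\varepsilon)/L^d$; this limit exists, is finite, and equals $\inf_{L>0}R_L(\mathbf{d},\mu,\varepsilon)/L^d$. Upper rate distortion dimension: $\overline{\mathrm{rdim}}(\mathcal{X},T,\mathbf{d},\mu)=\limsup_{\varepsilon\to0}\frac{R(\mathbf{d},\mu,\varepsilon)}{\log(1/\varepsilon)}$. Upper metric mean dimension: $\#(\mathcal{X},\mathbf{d},\varepsilon)$ is the minimum $n$ such that $\mathcal{X}$ has an open cover by $n$ sets each of $\mathbf{d}$-diameter $<\varepsilon$; $\mathbf{d}_L(x,y)=\sup_{u\in[0,L)^d}\mathbf{d}(T^ux,T^uy)$;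 $S(\mathcal{X},T,\mathbf{d},\varepsilon)=\lim_{L\to\infty}\frac{\log\#(\mathcal{X},\mathbf{d}_L,\varepsilon)}{L^d}$ (the limit exists and is finite); $\overline{\mathrm{mdim}}_{\mathrm{M}}(\mathcal{X},T,\mathbf{d})=\limsup_{\varepsilon\to0}\frac{S(\mathcal{X},T,\mathbf{d},\varepsilon)}{\log(1/\varepsilon)}$. *)

theory Defs
  imports "HOL-Probability.Probability"
begin

text \<open>
  The compact metric space is a type \<open>'a\<close> with \<open>compact UNIV\<close> and metric \<^const>\<open>dist\<close>;
  \<open>\<real>\<^sup>d\<close> is \<open>real ^ 'n\<close>, with \<open>d = CARD('n)\<close>.
\<close>

definition continuous_action :: "(real ^ 'n::finite \<Rightarrow> 'a::metric_space \<Rightarrow> 'a) \<Rightarrow> bool" where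
  "continuous_action T \<longleftrightarrow>
     continuous_on UNIV (\<lambda>(u, x). T u x) \<and>
     (\<forall>x. T 0 x = x) \<and>
     (\<forall>u v x. T (u + v) x = T u (T v x))"

definition cube :: "real \<Rightarrow> (real ^ 'n::finite) set" where
  "cube L = {u. \<forall>i. 0 \<le> u $ i \<and> u $ i < L}"

definition borel_of :: "'b topology \<Rightarrow> 'b measure" where
  "borel_of X = sigma (topspace X) {U. openin X U}"


section \<open>Invariant measures\<close>

definition invariant_measures ::
    "(real ^ 'n::finite \<Rightarrow> 'a::metric_space \<Rightarrow> 'a) \<Rightarrow> 'a measure set" where
  "invariant_measures T =
     {\<nu>. prob_space \<nu> \<and> sets \<nu> = sets borel \<and> (\<forall>u. distr \<nu> borel (T u) = \<nu>)}"

definition weak_star_topology ::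
    "(real ^ 'n::finite \<Rightarrow> 'a::metric_space \<Rightarrow> 'a) \<Rightarrow> 'a measure topology" where
  "weak_star_topology T = topology_generated_by
     {{\<nu> \<in> invariant_measures T. (\<integral>x. f x \<partial>\<nu>) \<in> U} |
        (f :: 'a \<Rightarrow> real) U. continuous_on UNIV f \<and> open U}"


section \<open>Mutual information\<close>

definition cell :: "'b set set \<Rightarrow> 'b \<Rightarrow> 'b set" where
  "cell \<alpha> x = (THE A. A \<in> \<alpha> \<and> x \<in> A)"

definition finite_measurable_partition :: "'b measure \<Rightarrow> 'b set set \<Rightarrow> bool" where
  "finite_measurable_partition S \<alpha> \<longleftrightarrow>
     finite \<alpha> \<and> \<alpha> \<subseteq> sets S \<and> partition_on (space S) \<alpha>"

text \<open>
  For variables with values in finite sets \<open>I\<close>, \<open>J\<close>. Entropy relative to a counting measure is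
  Shannon entropy. The library's \<^const>\<open>prob_space.mutual_information\<close> is not used: it is
  real-valued, so it does not cover the case of infinite mutual information.
\<close>

definition finite_mutual_info ::
    "'w measure \<Rightarrow> 'i set \<Rightarrow> ('w \<Rightarrow> 'i) \<Rightarrow> 'j set \<Rightarrow> ('w \<Rightarrow> 'j) \<Rightarrow> real" where
  "finite_mutual_info M I X J Y =
     prob_space.entropy M 2 (count_space I) X
     + prob_space.entropy M 2 (count_space J) Y
     - prob_space.entropy M 2 (count_space (I \<times> J)) (\<lambda>\<omega>. (X \<omega>, Y \<omega>))"

definition mutual_info ::
    "'w measure \<Rightarrow> 'b measure \<Rightarrow> ('w \<Rightarrow> 'b) \<Rightarrow> 'c measure \<Rightarrow> ('w \<Rightarrow> 'c) \<Rightarrow> ennreal" where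
  "mutual_info M S X S' Y =
     (SUP (\<alpha>, \<beta>) \<in> {(\<alpha>, \<beta>). finite_measurable_partition S \<alpha> \<and> finite_measurable_partition S' \<beta>}.
        ennreal (finite_mutual_info M \<alpha> (cell \<alpha> \<circ> X) \<beta> (cell \<beta> \<circ> Y)))"


section \<open>The space of integrable maps on a cube\<close>

text \<open>
  Points are equivalence classes of maps modulo equality a.e. on the cube. The underlying HOL
  functions are total; their values outside the cube are irrelevant and disappear in the quotient.
\<close>

definition cube_lborel :: "real \<Rightarrow> (real ^ 'n::finite) measure" where
  "cube_lborel L = restrict_space lborel (cube L)"

definition ae_eq_rel ::
    "real \<Rightarrow> ((real ^ 'n::finite \<Rightarrow> 'a::metric_space) \<times> (real ^ 'n \<Rightarrow> 'a)) set" where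
  "ae_eq_rel L = {(f, g). f \<in> borel_measurable (cube_lborel L) \<and>
     g \<in> borel_measurable (cube_lborel L) \<and> (AE u in cube_lborel L. f u = g u)}"

definition L1_space :: "real \<Rightarrow> (real ^ 'n::finite \<Rightarrow> 'a::metric_space) set set" where
  "L1_space L = borel_measurable (cube_lborel L) // ae_eq_rel L"

definition rep :: "('b \<Rightarrow> 'a) set \<Rightarrow> 'b \<Rightarrow> 'a" where
  "rep F = (SOME f. f \<in> F)"

definition L1_dist ::
    "real \<Rightarrow> (real ^ 'n::finite \<Rightarrow> 'a::metric_space) set \<Rightarrow> (real ^ 'n \<Rightarrow> 'a) set \<Rightarrow> real" where
  "L1_dist L F G = (\<integral>u. dist (rep F u) (rep G u) \<partial>cube_lborel L)"

definition L1_borel :: "real \<Rightarrow> (real ^ 'n::finite \<Rightarrow> 'a::metric_space) set measure" where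
  "L1_borel L = borel_of (Metric_space.mtopology (L1_space L) (L1_dist L))"


section \<open>Rate distortion dimension\<close>

definition distortion ::
    "(real ^ 'n::finite \<Rightarrow> 'a::metric_space \<Rightarrow> 'a) \<Rightarrow> real \<Rightarrow>
     'w measure \<Rightarrow> ('w \<Rightarrow> 'a) \<Rightarrow> ('w \<Rightarrow> (real ^ 'n \<Rightarrow> 'a) set) \<Rightarrow> ennreal" where
  "distortion T L M X Y =
     (\<integral>\<^sup>+\<omega>. (\<integral>\<^sup>+u. ennreal (dist (T u (X \<omega>)) (rep (Y \<omega>) u)) \<partial>cube_lborel L)
              / ennreal (L ^ CARD('n)) \<partial>M)"

text \<open>
  HOL cannot quantify over all types of sample points. The infimum ranges over all probability
  spaces whose points are pairs of a point of \<open>'a\<close> and an element of \<^const>\<open>L1_space\<close>. This loses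
  nothing: mutual information and distortion depend only on the joint law of \<open>X\<close> and \<open>Y\<close>, which
  lives on this type.
\<close>

definition rate_distortion_L ::
    "(real ^ 'n::finite \<Rightarrow> 'a::metric_space \<Rightarrow> 'a) \<Rightarrow> 'a measure \<Rightarrow> real \<Rightarrow> real \<Rightarrow> ennreal" where
  "rate_distortion_L T \<mu> L \<epsilon> =
     Inf {mutual_info M borel X (L1_borel L) Y |
            (M :: ('a \<times> (real ^ 'n \<Rightarrow> 'a) set) measure) X Y.
          prob_space M \<and>
          X \<in> measurable M borel \<and> distr M borel X = \<mu> \<and>
          Y \<in> measurable M (L1_borel L) \<and>
          distortion T L M X Y < ennreal \<epsilon>}"

definition rate_distortion ::
    "(real ^ 'n::finite \<Rightarrow> 'a::metric_space \<Rightarrow> 'a) \<Rightarrow> 'a measure \<Rightarrow> real \<Rightarrow> ennreal" where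
  "rate_distortion T \<mu> \<epsilon> =
     Lim at_top (\<lambda>L. rate_distortion_L T \<mu> L \<epsilon> / ennreal (L ^ CARD('n)))"

definition upper_rdim ::
    "(real ^ 'n::finite \<Rightarrow> 'a::metric_space \<Rightarrow> 'a) \<Rightarrow> 'a measure \<Rightarrow> ennreal" where
  "upper_rdim T \<mu> =
     Limsup (at_right 0) (\<lambda>\<epsilon>. rate_distortion T \<mu> \<epsilon> / ennreal (log 2 (1 / \<epsilon>)))"


section \<open>Metric mean dimension\<close>

definition bowen_dist ::
    "(real ^ 'n::finite \<Rightarrow> 'a::metric_space \<Rightarrow> 'a) \<Rightarrow> real \<Rightarrow> 'a \<Rightarrow> 'a \<Rightarrow> real" where
  "bowen_dist T L x y = (SUP u \<in> cube L. dist (T u x) (T u y))"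

definition diam_wrt :: "('a \<Rightarrow> 'a \<Rightarrow> real) \<Rightarrow> 'a set \<Rightarrow> real" where
  "diam_wrt \<rho> U = (if U = {} then 0 else (SUP (x, y) \<in> U \<times> U. \<rho> x y))"

definition covering_number :: "('a::metric_space \<Rightarrow> 'a \<Rightarrow> real) \<Rightarrow> real \<Rightarrow> nat" where
  "covering_number \<rho> \<epsilon> =
     (LEAST n. \<exists>\<U>. finite \<U> \<and> card \<U> = n \<and> \<Union>\<U> = UNIV \<and>
        (\<forall>U\<in>\<U>. open U \<and> diam_wrt \<rho> U < \<epsilon>))"

definition metric_entropy_rate ::
    "(real ^ 'n::finite \<Rightarrow> 'a::metric_space \<Rightarrow> 'a) \<Rightarrow> real \<Rightarrow> ennreal" where
  "metric_entropy_rate T \<epsilon> =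
     Lim at_top (\<lambda>L. ennreal (log 2 (real (covering_number (bowen_dist T L) \<epsilon>)))
                     / ennreal (L ^ CARD('n)))"

definition upper_mdim :: "(real ^ 'n::finite \<Rightarrow> 'a::metric_space \<Rightarrow> 'a) \<Rightarrow> ennreal" where
  "upper_mdim T =
     Limsup (at_right 0) (\<lambda>\<epsilon>. metric_entropy_rate T \<epsilon> / ennreal (log 2 (1 / \<epsilon>)))"

end

theory Submission
  imports Defs
begin

text \<open>
  Couplings are replaced by finite codes: a Markov kernel \<open>W\<close> from \<open>'a\<close> to finitely many code words,
  together with a reference weight \<open>r\<close> on the code words. Bounding the information by
  \<open>\<integral> \<Sum>b W\<^sub>b log (W\<^sub>b / r\<^sub>b) d\<nu>\<close> instead of using the actual law of the code word makes both this
  bound and the distortion affine in \<open>\<nu>\<close>, and product codes over the tiles of a large cube are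
  additive by invariance. Quantising a coupling shows that a countable family of codes, independent
  of \<open>\<nu>\<close>, computes the rate distortion function of every invariant measure. Hence one can choose,
  measurably in \<open>\<nu>\<close>, one of \<open>N + 1\<close> codes; used for \<open>\<mu>\<close> on a large cube, the choice itself costs only
  \<open>log (N + 1)\<close> bits, which vanishes after division by the volume. This gives
  \<open>R(\<mu>, \<epsilon>) \<le> \<integral> R(\<nu>, \<epsilon>) d\<Lambda>(\<nu>)\<close>, and finite metric mean dimension provides the dominating constant
  for the reverse Fatou lemma as \<open>\<epsilon>\<close> tends to zero.
\<close>

section \<open>Finite mutual information\<close>

text \<open>Mutual information is not affine in the source law, because its reference, the law of
  the output, moves with it. The true output law is the best reference for a given kernel, so a
  reference fixed once per code can only overestimate the information, and the bound stays valid for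
  all invariant measures at once. The obstacle is the order of the choices. A near-optimal code
  depends on \<open>\<nu>\<close>, and the index of the selected code becomes part of the label, so
  an unbounded index could cost infinitely many bits. Therefore the side of the cube tends to
  infinity while the number of candidates is fixed, and the candidates are exhausted only
  afterwards, by monotone convergence. The candidates live on cubes of different sides and have to
  be tiled to one common side before they can be mixed. One candidate comes from an open cover and
  has distortion below \<open>\<epsilon>\<close> at every point; it keeps each truncated minimum
  finite. All errors in the distortion, from quantising and from tiles that stick out of the large
  cube, are paid for by the strict inequality in the distortion constraint.\<close>

lemma mult_log_ge:
  fixes w s :: real
  assumes "0 \<le> w" "0 \<le> s" "s = 0 \<Longrightarrow> w = 0"
  shows "(w - s) / ln 2 \<le> w * log 2 (w / s)"
proof (cases "w = 0")
  case False
  then have pos: "0 < w" "0 < s" using assms by (auto simp: less_le)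
  \<comment> \<open>The tangent line bound \<open>ln t \<le> t - 1\<close> at
    \<open>t = s / w\<close>. Summed over labels, the resulting inequality is Gibbs'
    inequality.\<close>
  have "ln (s / w) \<le> s / w - 1" using pos by (intro ln_le_minus_one) auto
  moreover have "ln (s / w) = - ln (w / s)" using pos by (simp add: ln_div)
  ultimately have "1 - s / w \<le> ln (w / s)" by simp
  then have "w * (1 - s / w) \<le> w * ln (w / s)" using pos by (intro mult_left_mono) auto
  then have "w - s \<le> w * ln (w / s)" using pos by (simp add: algebra_simps)
  then show ?thesis by (simp add: log_def divide_right_mono)
qed (use assms in auto)

lemma entropy_finite:
  assumes "prob_space M" "finite I" and X: "X \<in> measurable M (count_space I)"
  shows "prob_space.entropy M 2 (count_space I) X =
    - (\<Sum>i\<in>I. measure M {\<omega> \<in> space M. X \<omega> = i} * log 2 (measure M {\<omega> \<in> space M. X \<omega> = i}))"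
proof -
  interpret prob_space M by fact
  interpret information_space M 2 by standard auto
  define p where "p i = measure M {\<omega> \<in> space M. X \<omega> = i}" for i
  have "distr M (count_space I) X = density (count_space I) (\<lambda>i. ennreal (p i))"
  proof (rule measure_eqI_finite[where A = I])
    fix i assume i: "i \<in> I"
    have "emeasure (distr M (count_space I) X) {i} = emeasure M (X -` {i} \<inter> space M)"
      using X i by (intro emeasure_distr) auto
    also have "X -` {i} \<inter> space M = {\<omega> \<in> space M. X \<omega> = i}" by auto
    also have "emeasure M \<dots> = ennreal (p i)" by (simp add: p_def emeasure_eq_measure)
    also have "\<dots> = emeasure (density (count_space I) (\<lambda>i. ennreal (p i))) {i}"
      using i \<open>finite I\<close>
      by (subst emeasure_density)
        (auto simp: nn_integral_count_space_finite sum.If_cases indicator_def mult.commute if_distrib)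
    finally show "emeasure (distr M (count_space I) X) {i} =
      emeasure (density (count_space I) (\<lambda>i. ennreal (p i))) {i}" .
  qed (use \<open>finite I\<close> in auto)
  then have "distributed M (count_space I) X (\<lambda>i. ennreal (p i))"
    using X unfolding distributed_def by auto
  then have "entropy 2 (count_space I) X = - (\<integral>i. p i * log 2 (p i) \<partial>count_space I)"
    by (rule entropy_distr) (simp add: p_def)
  then show ?thesis
    using \<open>finite I\<close> by (simp add: lebesgue_integral_count_space_finite p_def)
qed

lemma fibre_measurable:
  assumes "X \<in> measurable M (count_space I)"
  shows "{\<omega> \<in> space M. X \<omega> = i} \<in> sets M"
proof -
  have "{\<omega> \<in> space M. X \<omega> = i} = X -` ({i} \<inter> I) \<inter> space M"
    using measurable_space[OF assms] by auto
  then show ?thesis using measurable_sets[OF assms, of "{i} \<inter> I"] by auto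
qed

lemma fibre_pair_measurable:
  assumes "X \<in> measurable M (count_space I)" "Y \<in> measurable M (count_space J)"
  shows "{\<omega> \<in> space M. X \<omega> = i \<and> Y \<omega> = j} \<in> sets M"
proof -
  have "{\<omega> \<in> space M. X \<omega> = i \<and> Y \<omega> = j} = {\<omega> \<in> space M. X \<omega> = i} \<inter> {\<omega> \<in> space M. Y \<omega> = j}"
    by blast
  then show ?thesis using fibre_measurable[OF assms(1)] fibre_measurable[OF assms(2)] by simp
qed

lemma sum_fibre_prob:
  assumes "prob_space M" "finite I" and X: "X \<in> measurable M (count_space I)"
  shows "(\<Sum>i\<in>I. measure M {\<omega> \<in> space M. X \<omega> = i}) = 1"
proof -
  interpret prob_space M by fact
  have "(\<Sum>i\<in>I. prob {\<omega> \<in> space M. X \<omega> = i}) = prob (\<Union>i\<in>I. {\<omega> \<in> space M. X \<omega> = i})"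
    using fibre_measurable[OF X]
    by (intro finite_measure_finite_Union[symmetric] assms(2)) (auto simp: disjoint_family_on_def)
  also have "(\<Union>i\<in>I. {\<omega> \<in> space M. X \<omega> = i}) = space M" using measurable_space[OF X] by auto
  finally show ?thesis by (simp add: prob_space)
qed

text \<open>All three entropies are brought to one double sum by writing the marginals as row and
  column sums of \<open>p\<close>. A term with \<open>p i j = 0\<close> vanishes; otherwise both
  marginals are positive and the logarithm splits.\<close>

lemma finite_mutual_info_eq:
  fixes M :: "'w measure" and X :: "'w \<Rightarrow> 'i" and Y :: "'w \<Rightarrow> 'j"
  assumes "prob_space M" "finite I" "finite J"
    and X: "X \<in> measurable M (count_space I)" and Y: "Y \<in> measurable M (count_space J)"
  defines "p i j \<equiv> measure M {\<omega> \<in> space M. X \<omega> = i \<and> Y \<omega> = j}"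
  shows "finite_mutual_info M I X J Y =
    (\<Sum>i\<in>I. \<Sum>j\<in>J. p i j * log 2 (p i j / ((\<Sum>j\<in>J. p i j) * (\<Sum>i\<in>I. p i j))))"
    and "i \<in> I \<Longrightarrow> measure M {\<omega> \<in> space M. X \<omega> = i} = (\<Sum>j\<in>J. p i j)"
    and "j \<in> J \<Longrightarrow> measure M {\<omega> \<in> space M. Y \<omega> = j} = (\<Sum>i\<in>I. p i j)"
proof -
  interpret prob_space M by fact
  note XY = fibre_pair_measurable[OF X Y]
  show pX: "measure M {\<omega> \<in> space M. X \<omega> = i} = (\<Sum>j\<in>J. p i j)" for i
  proof -
    have "{\<omega> \<in> space M. X \<omega> = i} = (\<Union>j\<in>J. {\<omega> \<in> space M. X \<omega> = i \<and> Y \<omega> = j})"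
      using measurable_space[OF Y] by auto
    then show ?thesis unfolding p_def
      using \<open>finite J\<close> XY by (simp, intro finite_measure_finite_Union) (auto simp: disjoint_family_on_def)
  qed
  show pY: "measure M {\<omega> \<in> space M. Y \<omega> = j} = (\<Sum>i\<in>I. p i j)" for j
  proof -
    have "{\<omega> \<in> space M. Y \<omega> = j} = (\<Union>i\<in>I. {\<omega> \<in> space M. X \<omega> = i \<and> Y \<omega> = j})"
      using measurable_space[OF X] by auto
    then show ?thesis unfolding p_def
      using \<open>finite I\<close> XY by (simp, intro finite_measure_finite_Union) (auto simp: disjoint_family_on_def)
  qed
  define a where "a i = (\<Sum>j\<in>J. p i j)" for i
  define b where "b j = (\<Sum>i\<in>I. p i j)" for j
  have p0: "0 \<le> p i j" for i j by (simp add: p_def)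
  have le: "p i j \<le> a i" "p i j \<le> b j" if "i \<in> I" "j \<in> J" for i j
    using that p0 assms(2,3) unfolding a_def b_def by (auto intro: member_le_sum[of _ _ "\<lambda>j. p i j"] member_le_sum[of _ _ "\<lambda>i. p i j"])
  have XY_meas: "(\<lambda>\<omega>. (X \<omega>, Y \<omega>)) \<in> measurable M (count_space (I \<times> J))"
  proof (subst measurable_count_space_eq2, goal_cases)
    case 2
    have "(\<lambda>\<omega>. (X \<omega>, Y \<omega>)) -` {(i, j)} \<inter> space M = {\<omega> \<in> space M. X \<omega> = i \<and> Y \<omega> = j}" for i j
      by auto
    then show ?case using XY measurable_space[OF X] measurable_space[OF Y] by auto
  qed (use assms in auto)
  have "finite_mutual_info M I X J Y =
     (\<Sum>i\<in>I. \<Sum>j\<in>J. p i j * log 2 (p i j)) - (\<Sum>i\<in>I. a i * log 2 (a i)) - (\<Sum>j\<in>J. b j * log 2 (b j))"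
    unfolding finite_mutual_info_def
    by (simp add: entropy_finite[OF assms(1) _ X] entropy_finite[OF assms(1) _ Y] assms(2,3)
        entropy_finite[OF assms(1) _ XY_meas] pX pY a_def b_def sum.cartesian_product split_beta p_def prod_eq_iff)
  also have "(\<Sum>i\<in>I. a i * log 2 (a i)) = (\<Sum>i\<in>I. \<Sum>j\<in>J. p i j * log 2 (a i))"
    by (simp add: a_def sum_distrib_right)
  also have "(\<Sum>j\<in>J. b j * log 2 (b j)) = (\<Sum>i\<in>I. \<Sum>j\<in>J. p i j * log 2 (b j))"
    by (subst sum.swap) (simp add: b_def sum_distrib_right)
  also have "(\<Sum>i\<in>I. \<Sum>j\<in>J. p i j * log 2 (p i j)) - (\<Sum>i\<in>I. \<Sum>j\<in>J. p i j * log 2 (a i))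
      - (\<Sum>i\<in>I. \<Sum>j\<in>J. p i j * log 2 (b j)) = (\<Sum>i\<in>I. \<Sum>j\<in>J. p i j * log 2 (p i j / (a i * b j)))"
    unfolding sum_subtractf[symmetric]
  proof (intro sum.cong refl)
    fix i j assume ij: "i \<in> I" "j \<in> J"
    show "p i j * log 2 (p i j) - p i j * log 2 (a i) - p i j * log 2 (b j) =
      p i j * log 2 (p i j / (a i * b j))"
    proof (cases "p i j = 0")
      case False
      then have "0 < p i j" "0 < a i" "0 < b j" using p0[of i j] le[OF ij] by auto
      then show ?thesis by (simp add: log_divide log_mult algebra_simps)
    qed simp
  qed
  finally show "finite_mutual_info M I X J Y =
    (\<Sum>i\<in>I. \<Sum>j\<in>J. p i j * log 2 (p i j / ((\<Sum>j\<in>J. p i j) * (\<Sum>i\<in>I. p i j))))"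
    by (simp add: a_def b_def)
qed

lemma cell_eq:
  assumes "partition_on S \<alpha>" "A \<in> \<alpha>" "x \<in> A"
  shows "cell \<alpha> x = A"
  unfolding cell_def
proof (rule the_equality)
  show "\<And>B. B \<in> \<alpha> \<and> x \<in> B \<Longrightarrow> B = A"
    using partition_onD2[OF assms(1)] assms(2,3) by (auto dest: disjointD)
qed (use assms in auto)

lemma cell_in:
  assumes "partition_on S \<alpha>" "x \<in> S"
  shows "cell \<alpha> x \<in> \<alpha>" "x \<in> cell \<alpha> x"
proof -
  obtain A where "A \<in> \<alpha>" "x \<in> A" using partition_onD1[OF assms(1)] assms(2) by auto
  then show "cell \<alpha> x \<in> \<alpha>" "x \<in> cell \<alpha> x" using cell_eq[OF assms(1)] by auto
qed

lemma measurable_cell: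
  assumes "finite_measurable_partition S \<alpha>"
  shows "cell \<alpha> \<in> measurable S (count_space \<alpha>)"
proof -
  have p: "partition_on (space S) \<alpha>" "finite \<alpha>" "\<alpha> \<subseteq> sets S"
    using assms by (auto simp: finite_measurable_partition_def)
  show ?thesis
  proof (subst measurable_count_space_eq2[OF p(2)], safe)
    fix A assume A: "A \<in> \<alpha>"
    have "cell \<alpha> -` {A} \<inter> space S = A"
    proof (intro equalityI subsetI)
      fix x assume "x \<in> cell \<alpha> -` {A} \<inter> space S"
      then show "x \<in> A" using cell_in(2)[OF p(1), of x] by auto
    next
      fix x assume x: "x \<in> A"
      have "A \<in> sets S" using p(3) A by (rule subsetD)
      then have "x \<in> space S" using x sets.sets_into_space[of A S] by (meson subsetD)
      then show "x \<in> cell \<alpha> -` {A} \<inter> space S" using cell_eq[OF p(1) A x] by simp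
    qed
    then show "cell \<alpha> -` {A} \<inter> space S \<in> sets S" using p A by auto
  qed (use cell_in[OF p(1)] in auto)
qed

text \<open>By \<open>finite_mutual_info_eq\<close> only the joint probabilities enter, and an image
  measure preserves these.\<close>

lemma finite_mutual_info_distr:
  assumes "Z \<in> measurable N M" "X \<in> measurable M (count_space I)" "Y \<in> measurable M (count_space J)"
    "finite I" "finite J" "prob_space N"
  shows "finite_mutual_info (distr N M Z) I X J Y = finite_mutual_info N I (X \<circ> Z) J (Y \<circ> Z)"
proof -
  have m: "X \<circ> Z \<in> measurable N (count_space I)" "Y \<circ> Z \<in> measurable N (count_space J)"
    using assms by (auto intro: measurable_comp)
  have *: "measure (distr N M Z) {\<omega> \<in> space M. X \<omega> = i \<and> Y \<omega> = j} =
    measure N {\<omega> \<in> space N. X (Z \<omega>) = i \<and> Y (Z \<omega>) = j}" if "i \<in> I" "j \<in> J" for i j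
  proof -
    note fibre_pair_measurable[OF assms(2,3), of i j]
    then show ?thesis using assms(1) measurable_space[OF assms(1)]
      by (subst measure_distr) (auto intro: arg_cong[where f = "measure N"])
  qed
  have "prob_space (distr N M Z)" using assms by (intro prob_space.prob_space_distr)
  moreover have "X \<in> measurable (distr N M Z) (count_space I)" "Y \<in> measurable (distr N M Z) (count_space J)"
    using assms(2,3) by (simp_all only: measurable_distr_eq1)
  ultimately have e: "finite_mutual_info (distr N M Z) I X J Y =
      (\<Sum>i\<in>I. \<Sum>j\<in>J. measure N {\<omega> \<in> space N. X (Z \<omega>) = i \<and> Y (Z \<omega>) = j} * log 2
        (measure N {\<omega> \<in> space N. X (Z \<omega>) = i \<and> Y (Z \<omega>) = j} /
          ((\<Sum>j\<in>J. measure N {\<omega> \<in> space N. X (Z \<omega>) = i \<and> Y (Z \<omega>) = j}) *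
           (\<Sum>i\<in>I. measure N {\<omega> \<in> space N. X (Z \<omega>) = i \<and> Y (Z \<omega>) = j}))))"
    by (subst finite_mutual_info_eq(1)[OF _ assms(4,5)]) (simp_all add: * cong: sum.cong)
  show ?thesis
    using finite_mutual_info_eq(1)[OF assms(6,4,5) m] unfolding e comp_def by simp
qed

text \<open>The joint law of a point drawn from \<open>\<Omega>\<close> and a label drawn from it by
  the Markov kernel \<open>W\<close>. As a density over a finite counting factor it reduces every
  integral to a finite sum of integrals over \<open>\<Omega>\<close>.\<close>

definition kernel_coupling :: "'w measure \<Rightarrow> 'b set \<Rightarrow> ('b \<Rightarrow> 'w \<Rightarrow> real) \<Rightarrow> ('w \<times> 'b) measure" where
  "kernel_coupling \<Omega> B W = density (\<Omega> \<Otimes>\<^sub>M count_space B) (\<lambda>(\<omega>, b). ennreal (W b \<omega>))"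

lemma space_kernel_coupling: "space (kernel_coupling \<Omega> B W) = space \<Omega> \<times> B"
  by (simp add: kernel_coupling_def space_pair_measure)

lemma sets_kernel_coupling [measurable_cong]:
  "sets (kernel_coupling \<Omega> B W) = sets (\<Omega> \<Otimes>\<^sub>M count_space B)"
  by (simp add: kernel_coupling_def)

lemma measurable_pair_count_space_finite:
  assumes "finite B" "\<And>b. b \<in> B \<Longrightarrow> (\<lambda>\<omega>. g (\<omega>, b)) \<in> measurable \<Omega> N"
  shows "g \<in> measurable (\<Omega> \<Otimes>\<^sub>M count_space B) N"
proof -
  have "(\<lambda>p. (\<lambda>b \<omega>. g (\<omega>, b)) (snd p) (fst p)) \<in> measurable (\<Omega> \<Otimes>\<^sub>M count_space B) N"
  proof (rule measurable_compose_countable'[where I = B])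
    fix b assume "b \<in> B"
    show "(\<lambda>p. g (fst p, b)) \<in> measurable (\<Omega> \<Otimes>\<^sub>M count_space B) N"
      by (rule measurable_compose[OF measurable_fst assms(2)[OF \<open>b \<in> B\<close>]])
  qed (use assms(1) in \<open>auto intro: countable_finite\<close>)
  then show ?thesis by simp
qed

lemma nn_integral_kernel_coupling:
  assumes "finite B" "\<And>b. b \<in> B \<Longrightarrow> W b \<in> borel_measurable \<Omega>"
    and "\<And>b. b \<in> B \<Longrightarrow> (\<lambda>\<omega>. g (\<omega>, b)) \<in> borel_measurable \<Omega>"
  shows "(\<integral>\<^sup>+p. g p \<partial>kernel_coupling \<Omega> B W) = (\<Sum>b\<in>B. \<integral>\<^sup>+\<omega>. ennreal (W b \<omega>) * g (\<omega>, b) \<partial>\<Omega>)"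
proof -
  have [measurable]: "(\<lambda>(\<omega>, b). ennreal (W b \<omega>)) \<in> borel_measurable (\<Omega> \<Otimes>\<^sub>M count_space B)"
    "g \<in> borel_measurable (\<Omega> \<Otimes>\<^sub>M count_space B)"
    using assms by (auto intro!: measurable_pair_count_space_finite)
  interpret sigma_finite_measure "count_space B" using assms by (intro sigma_finite_measure_count_space_finite)
  have "(\<integral>\<^sup>+p. g p \<partial>kernel_coupling \<Omega> B W) =
      (\<integral>\<^sup>+p. (case p of (\<omega>, b) \<Rightarrow> ennreal (W b \<omega>)) * g p \<partial>(\<Omega> \<Otimes>\<^sub>M count_space B))"
    unfolding kernel_coupling_def by (rule nn_integral_density) measurable
  also have "\<dots> = (\<integral>\<^sup>+\<omega>. \<integral>\<^sup>+b. (case (\<omega>, b) of (\<omega>, b) \<Rightarrow> ennreal (W b \<omega>)) * g (\<omega>, b) \<partial>count_space B \<partial>\<Omega>)"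
    by (rule nn_integral_fst[symmetric]) measurable
  also have "\<dots> = (\<integral>\<^sup>+\<omega>. (\<Sum>b\<in>B. ennreal (W b \<omega>) * g (\<omega>, b)) \<partial>\<Omega>)"
    by (simp add: nn_integral_count_space_finite[OF assms(1)])
  also have "\<dots> = (\<Sum>b\<in>B. \<integral>\<^sup>+\<omega>. ennreal (W b \<omega>) * g (\<omega>, b) \<partial>\<Omega>)"
    using assms by (intro nn_integral_sum) auto
  finally show ?thesis .
qed

lemma prob_space_kernel_coupling:
  assumes "prob_space \<Omega>" "finite B" "\<And>b. b \<in> B \<Longrightarrow> W b \<in> borel_measurable \<Omega>"
    and "\<And>b \<omega>. b \<in> B \<Longrightarrow> \<omega> \<in> space \<Omega> \<Longrightarrow> 0 \<le> W b \<omega>" and "\<And>\<omega>. \<omega> \<in> space \<Omega> \<Longrightarrow> (\<Sum>b\<in>B. W b \<omega>) = 1"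
  shows "prob_space (kernel_coupling \<Omega> B W)"
proof
  interpret prob_space \<Omega> by fact
  have "emeasure (kernel_coupling \<Omega> B W) (space (kernel_coupling \<Omega> B W)) =
    (\<integral>\<^sup>+p. 1 \<partial>kernel_coupling \<Omega> B W)" by simp
  also have "\<dots> = (\<Sum>b\<in>B. \<integral>\<^sup>+\<omega>. ennreal (W b \<omega>) \<partial>\<Omega>)"
    using assms by (subst nn_integral_kernel_coupling) auto
  also have "\<dots> = (\<integral>\<^sup>+\<omega>. (\<Sum>b\<in>B. ennreal (W b \<omega>)) \<partial>\<Omega>)"
    using assms by (intro nn_integral_sum[symmetric]) auto
  also have "\<dots> = (\<integral>\<^sup>+\<omega>. 1 \<partial>\<Omega>)"
    using assms by (intro nn_integral_cong) (simp add: sum_ennreal)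
  finally show "emeasure (kernel_coupling \<Omega> B W) (space (kernel_coupling \<Omega> B W)) = 1"
    by (simp add: emeasure_space_1)
qed

lemma kernel_le_one:
  assumes "finite B" "\<And>b. b \<in> B \<Longrightarrow> 0 \<le> W b" "(\<Sum>b\<in>B. W b) = (1::real)" "b \<in> B"
  shows "W b \<le> 1"
  using member_le_sum[of b B W] assms by auto

text \<open>The part \<open>- (w * ln w)\<close> is at most 1 because \<open>ln t \<le> t\<close> at
  \<open>t = 1 / w\<close>, and the reference contributes at most \<open>\<bar>ln r\<bar>\<close>. A
  bound independent of \<open>w\<close> makes the information of a code integrable for every
  probability measure.\<close>

lemma kernel_log_bounded:
  fixes w r :: real
  assumes "0 \<le> w" "w \<le> 1" "0 < r"
  shows "\<bar>w * log 2 (w / r)\<bar> \<le> (1 + \<bar>ln r\<bar>) / ln 2"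
proof (cases "w = 0")
  case False
  then have w: "0 < w" using assms by auto
  have "ln (1 / w) \<le> 1 / w" using ln_le_minus_one[of "1 / w"] w by auto
  then have "w * - ln w \<le> w * (1 / w)" using w by (intro mult_left_mono) (auto simp: ln_div)
  then have 1: "- (w * ln w) \<le> 1" using w by simp
  have 2: "w * ln w \<le> 0" using w assms by (simp add: mult_nonneg_nonpos)
  have 3: "\<bar>w * ln r\<bar> \<le> \<bar>ln r\<bar>" using w assms by (simp add: abs_mult mult_left_le_one_le)
  have "w * ln (w / r) = w * ln w - w * ln r" using w assms by (simp add: ln_div algebra_simps)
  then have "\<bar>w * ln (w / r)\<bar> \<le> 1 + \<bar>ln r\<bar>" using 1 2 3 by linarith
  moreover have "\<bar>w * log 2 (w / r)\<bar> = \<bar>w * ln (w / r)\<bar> / ln 2" by (simp add: log_def abs_mult)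
  ultimately show ?thesis by (simp add: divide_right_mono)
qed (use assms in auto)

lemma kernel_log_integrable:
  fixes W :: "'w \<Rightarrow> real"
  assumes "prob_space \<Omega>" "W \<in> borel_measurable \<Omega>" "0 < r"
    "\<And>\<omega>. \<omega> \<in> space \<Omega> \<Longrightarrow> 0 \<le> W \<omega>" "\<And>\<omega>. \<omega> \<in> space \<Omega> \<Longrightarrow> W \<omega> \<le> 1"
  shows "integrable \<Omega> (\<lambda>\<omega>. W \<omega> * log 2 (W \<omega> / r))"
proof -
  interpret prob_space \<Omega> by fact
  show ?thesis
    using assms by (intro integrable_const_bound[where B = "(1 + \<bar>ln r\<bar>) / ln 2"] AE_I2)
      (auto intro!: kernel_log_bounded)
qed

text \<open>
  Every summand \<open>W\<^sub>b log (W\<^sub>b / r\<^sub>b)\<close> is compared by \<open>mult_log_ge\<close> with the reference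
  \<open>r\<^sub>b p(i, j) / (p(i) p(j))\<close> on the cell \<open>(i, j)\<close>, whose total mass is at most one.
\<close>

lemma finite_mutual_info_kernel_le:
  fixes \<Omega> :: "'w measure" and B :: "'b set" and W :: "'b \<Rightarrow> 'w \<Rightarrow> real"
  assumes "prob_space \<Omega>" and B: "finite B" and W[measurable]: "\<And>b. b \<in> B \<Longrightarrow> W b \<in> borel_measurable \<Omega>"
    and W0: "\<And>b \<omega>. b \<in> B \<Longrightarrow> \<omega> \<in> space \<Omega> \<Longrightarrow> 0 \<le> W b \<omega>"
    and W1: "\<And>\<omega>. \<omega> \<in> space \<Omega> \<Longrightarrow> (\<Sum>b\<in>B. W b \<omega>) = 1"
    and r: "\<And>b. b \<in> B \<Longrightarrow> 0 < r b" "(\<Sum>b\<in>B. r b) \<le> 1"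
    and I: "finite I" and J: "finite J"
    and X[measurable]: "X \<in> measurable \<Omega> (count_space I)" and Y: "Y \<in> B \<rightarrow> J"
  shows "finite_mutual_info (kernel_coupling \<Omega> B W) I (X \<circ> fst) J (Y \<circ> snd)
    \<le> (\<integral>\<omega>. (\<Sum>b\<in>B. W b \<omega> * log 2 (W b \<omega> / r b)) \<partial>\<Omega>)"
proof -
  interpret prob_space \<Omega> by fact
  let ?N = "kernel_coupling \<Omega> B W"
  interpret N: prob_space ?N by (intro prob_space_kernel_coupling assms)
  have W_le: "W b \<omega> \<le> 1" if "b \<in> B" "\<omega> \<in> space \<Omega>" for b \<omega>
    using kernel_le_one[of B "\<lambda>b. W b \<omega>"] that W0 W1 B by auto
  note Xs[measurable] = fibre_measurable[OF X]
  define p where "p i j = measure ?N {\<omega> \<in> space ?N. (X \<circ> fst) \<omega> = i \<and> (Y \<circ> snd) \<omega> = j}" for i j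
  define a where "a i = (\<Sum>j\<in>J. p i j)" for i
  define q where "q j = (\<Sum>i\<in>I. p i j)" for j
  have mX: "X \<circ> fst \<in> measurable ?N (count_space I)"
    unfolding measurable_cong_sets[OF sets_kernel_coupling refl]
    by (rule measurable_comp[OF measurable_fst X])
  have mY: "Y \<circ> snd \<in> measurable ?N (count_space J)"
    unfolding measurable_cong_sets[OF sets_kernel_coupling refl]
    by (rule measurable_comp[OF measurable_snd]) (use Y in auto)
  note MI = finite_mutual_info_eq[OF N.prob_space_axioms I J mX mY, folded p_def, folded a_def q_def]
  have int_W: "integrable \<Omega> (\<lambda>\<omega>. W b \<omega> * h \<omega>)" if "b \<in> B" "h \<in> borel_measurable \<Omega>"
    "\<And>\<omega>. 0 \<le> h \<omega>" "\<And>\<omega>. h \<omega> \<le> 1" for b h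
    using that W_le W0 by (intro integrable_const_bound[where B = 1] AE_I2)
      (auto intro!: mult_le_one)
  have p_eq: "p i j = (\<Sum>b\<in>{b\<in>B. Y b = j}. \<integral>\<omega>. W b \<omega> * indicator {\<omega> \<in> space \<Omega>. X \<omega> = i} \<omega> \<partial>\<Omega>)" for i j
  proof -
    let ?A = "{\<omega> \<in> space \<Omega>. X \<omega> = i} \<times> {b\<in>B. Y b = j}"
    have "{\<omega> \<in> space ?N. (X \<circ> fst) \<omega> = i \<and> (Y \<circ> snd) \<omega> = j} = ?A"
      by (auto simp: space_kernel_coupling)
    then have "ennreal (p i j) = emeasure ?N ?A" by (simp add: p_def N.emeasure_eq_measure)
    also have "\<dots> = (\<integral>\<^sup>+p. indicator ?A p \<partial>?N)"
      by (intro nn_integral_indicator[symmetric]) (auto simp: sets_kernel_coupling)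
    also have "\<dots> = (\<Sum>b\<in>B. \<integral>\<^sup>+\<omega>. ennreal (W b \<omega>) * indicator ?A (\<omega>, b) \<partial>\<Omega>)"
      using B by (intro nn_integral_kernel_coupling) (auto simp: indicator_times)
    also have "\<dots> = (\<Sum>b\<in>{b\<in>B. Y b = j}. \<integral>\<^sup>+\<omega>. ennreal (W b \<omega> * indicator {\<omega> \<in> space \<Omega>. X \<omega> = i} \<omega>) \<partial>\<Omega>)"
      using B by (intro sum.mono_neutral_cong_right) (auto simp: indicator_times ennreal_mult'' ennreal_indicator intro!: nn_integral_cong)
    also have "\<dots> = (\<Sum>b\<in>{b\<in>B. Y b = j}. ennreal (\<integral>\<omega>. W b \<omega> * indicator {\<omega> \<in> space \<Omega>. X \<omega> = i} \<omega> \<partial>\<Omega>))"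
      using W0 by (intro sum.cong refl nn_integral_eq_integral int_W AE_I2) auto
    also have "\<dots> = ennreal (\<Sum>b\<in>{b\<in>B. Y b = j}. \<integral>\<omega>. W b \<omega> * indicator {\<omega> \<in> space \<Omega>. X \<omega> = i} \<omega> \<partial>\<Omega>)"
      using W0 by (intro sum_ennreal integral_nonneg_AE AE_I2) auto
    finally show ?thesis using W0
      by (subst (asm) ennreal_inj) (auto simp: p_def intro!: sum_nonneg integral_nonneg_AE AE_I2)
  qed
  have a_eq: "a i = prob {\<omega> \<in> space \<Omega>. X \<omega> = i}" if "i \<in> I" for i
  proof -
    have "a i = (\<Sum>b\<in>B. \<integral>\<omega>. W b \<omega> * indicator {\<omega> \<in> space \<Omega>. X \<omega> = i} \<omega> \<partial>\<Omega>)"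
      unfolding a_def p_eq using B J Y by (intro sum.group) auto
    also have "\<dots> = (\<integral>\<omega>. (\<Sum>b\<in>B. W b \<omega> * indicator {\<omega> \<in> space \<Omega>. X \<omega> = i} \<omega>) \<partial>\<Omega>)"
      by (intro Bochner_Integration.integral_sum[symmetric] int_W) auto
    also have "\<dots> = (\<integral>\<omega>. indicator {\<omega> \<in> space \<Omega>. X \<omega> = i} \<omega> \<partial>\<Omega>)"
      using W1 by (intro Bochner_Integration.integral_cong) (auto simp: sum_distrib_right[symmetric])
    finally show ?thesis by simp
  qed
  have p0: "0 \<le> p i j" for i j by (simp add: p_def)
  have a0: "0 \<le> a i" and q0: "0 \<le> q j" for i j using p0 by (auto simp: a_def q_def intro: sum_nonneg)
  \<comment> \<open>The density of the joint law with respect to the product of its marginals, equal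
    to 0 where a marginal vanishes.\<close>
  define \<kappa> where "\<kappa> i j = p i j / (a i * q j)" for i j
  have \<kappa>0: "0 \<le> \<kappa> i j" for i j using p0 a0 q0 by (simp add: \<kappa>_def)
  define R where "R j = (\<Sum>b\<in>{b\<in>B. Y b = j}. r b)" for j
  have sum_R: "(\<Sum>j\<in>J. R j) \<le> 1" unfolding R_def using B J Y r(2) by (subst sum.group) auto
  have R0: "0 \<le> R j" for j unfolding R_def using r by (intro sum_nonneg) (auto intro: less_imp_le)
  let ?ind = "\<lambda>i \<omega>. indicator {\<omega> \<in> space \<Omega>. X \<omega> = i} \<omega> :: real"
  have int_log: "integrable \<Omega> (\<lambda>\<omega>. W b \<omega> * log 2 (W b \<omega> / r b))" if "b \<in> B" for b
    using that by (intro kernel_log_integrable) (auto simp: W0 W_le r prob_space_axioms)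
  have iW: "integrable \<Omega> (\<lambda>\<omega>. W b \<omega> * ?ind i \<omega>)" if "b \<in> B" for b i
    using that by (intro int_W) auto
  have iL: "integrable \<Omega> (\<lambda>\<omega>. W b \<omega> * log 2 (W b \<omega> / r b) * ?ind i \<omega>)" if "b \<in> B" for b i
    using that by (intro integrable_real_mult_indicator int_log) auto
  have lin: "(\<integral>\<omega>. f \<omega> * c + (f \<omega> - d * g \<omega>) / e \<partial>\<Omega>) =
      (\<integral>\<omega>. f \<omega> \<partial>\<Omega>) * c + ((\<integral>\<omega>. f \<omega> \<partial>\<Omega>) - d * (\<integral>\<omega>. g \<omega> \<partial>\<Omega>)) / e"
    if "integrable \<Omega> f" "integrable \<Omega> g" for f g and c d e :: real
    using that by simp
  \<comment> \<open>The pointwise inequality, integrated over the fibre \<open>X = i\<close>. The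
    ratio \<open>\<kappa> i (Y b)\<close> is constant there, so the reference integrates to
    \<open>r b * \<kappa> i (Y b) * a i\<close>.\<close>
  have cell: "(p_b * log 2 (\<kappa> i (Y b)) + (p_b - r b * \<kappa> i (Y b) * a i) / ln 2
      \<le> (\<integral>\<omega>. W b \<omega> * log 2 (W b \<omega> / r b) * ?ind i \<omega> \<partial>\<Omega>))"
    if i: "i \<in> I" and b: "b \<in> B" and p_b: "p_b = (\<integral>\<omega>. W b \<omega> * ?ind i \<omega> \<partial>\<Omega>)" for i b p_b
  proof -
    let ?k = "\<kappa> i (Y b)"
    \<comment> \<open>If the ratio vanishes, then \<open>p i (Y b) = 0\<close>, and label
      \<open>b\<close> almost surely has no weight on the fibre. This absolute continuity is what
      allows the comparison with a reference that may be zero.\<close>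
    have "AE \<omega> in \<Omega>. (?k = 0 \<longrightarrow> W b \<omega> * ?ind i \<omega> = 0)"
    proof (cases "?k = 0")
      case True
      have "p_b \<le> p i (Y b)" unfolding p_b p_eq using b B W0
        by (intro member_le_sum[of b _ "\<lambda>b. \<integral>\<omega>. W b \<omega> * ?ind i \<omega> \<partial>\<Omega>"])
           (auto intro!: integral_nonneg_AE AE_I2)
      moreover have "p i (Y b) = 0"
      proof (rule ccontr)
        assume "p i (Y b) \<noteq> 0"
        then have "0 < p i (Y b)" using p0[of i "Y b"] by auto
        moreover have "p i (Y b) \<le> a i" unfolding a_def using J Y b p0 by (intro member_le_sum) auto
        moreover have "p i (Y b) \<le> q (Y b)" unfolding q_def using I i p0 by (intro member_le_sum[of i I "\<lambda>i. p i (Y b)"]) auto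
        ultimately show False using True by (simp add: \<kappa>_def)
      qed
      moreover have "0 \<le> p_b" unfolding p_b using b W0 by (intro integral_nonneg_AE AE_I2) auto
      ultimately have "(\<integral>\<omega>. W b \<omega> * ?ind i \<omega> \<partial>\<Omega>) = 0" using p_b by simp
      then have "AE \<omega> in \<Omega>. W b \<omega> * ?ind i \<omega> = 0"
        by (subst (asm) integral_nonneg_eq_0_iff_AE) (use b W0 iW[OF b] in \<open>auto intro!: AE_I2\<close>)
      then show ?thesis by auto
    qed auto
    then have "AE \<omega> in \<Omega>. W b \<omega> * ?ind i \<omega> * log 2 ?k + (W b \<omega> * ?ind i \<omega> - r b * ?k * ?ind i \<omega>) / ln 2
      \<le> W b \<omega> * log 2 (W b \<omega> / r b) * ?ind i \<omega>"
      using AE_space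
    proof eventually_elim
      case (elim \<omega>)
      show ?case
      proof (cases "X \<omega> = i")
        case True
        then have ind: "?ind i \<omega> = 1" using elim by auto
        show ?thesis
        proof (cases "W b \<omega> = 0")
          case True
          have "0 \<le> r b * ?k / ln 2" using r(1)[OF b] \<kappa>0 by simp
          then show ?thesis using True ind by simp
        next
          case False
          then have w: "0 < W b \<omega>" using W0[OF b] elim by fastforce
          then have k: "0 < ?k" using elim ind \<kappa>0[of i "Y b"] by (auto simp: less_le)
          have "(W b \<omega> - r b * ?k) / ln 2 \<le> W b \<omega> * log 2 (W b \<omega> / (r b * ?k))"
            using r(1)[OF b] w k by (intro mult_log_ge) auto
          also have "\<dots> = W b \<omega> * log 2 (W b \<omega> / r b) - W b \<omega> * log 2 ?k"
            using r(1)[OF b] w k by (simp add: log_divide log_mult algebra_simps)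
          finally show ?thesis using ind by simp
        qed
      qed simp
    qed
    then have "(\<integral>\<omega>. W b \<omega> * ?ind i \<omega> * log 2 ?k + (W b \<omega> * ?ind i \<omega> - r b * ?k * ?ind i \<omega>) / ln 2 \<partial>\<Omega>)
      \<le> (\<integral>\<omega>. W b \<omega> * log 2 (W b \<omega> / r b) * ?ind i \<omega> \<partial>\<Omega>)"
      by (intro integral_mono_AE Bochner_Integration.integrable_add integrable_mult_left integrable_divide
          Bochner_Integration.integrable_diff integrable_mult_right iW iL b integrable_real_indicator)
        (auto simp: emeasure_eq_measure)
    also have "(\<integral>\<omega>. W b \<omega> * ?ind i \<omega> * log 2 ?k + (W b \<omega> * ?ind i \<omega> - r b * ?k * ?ind i \<omega>) / ln 2 \<partial>\<Omega>)
      = p_b * log 2 ?k + (p_b - r b * ?k * a i) / ln 2"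
      by (subst lin[OF iW[OF b]]) (simp_all add: p_b a_eq[OF i] emeasure_eq_measure)
    finally show ?thesis .
  qed
  have "(\<integral>\<omega>. (\<Sum>b\<in>B. W b \<omega> * log 2 (W b \<omega> / r b)) \<partial>\<Omega>) =
    (\<integral>\<omega>. (\<Sum>b\<in>B. \<Sum>i\<in>I. W b \<omega> * log 2 (W b \<omega> / r b) * ?ind i \<omega>) \<partial>\<Omega>)"
  proof (intro Bochner_Integration.integral_cong refl sum.cong)
    fix \<omega> b assume \<omega>: "\<omega> \<in> space \<Omega>"
    have "(\<Sum>i\<in>I. ?ind i \<omega>) = (\<Sum>i\<in>I. if X \<omega> = i then 1 else 0)"
      using \<omega> by (intro sum.cong) auto
    then have "(\<Sum>i\<in>I. ?ind i \<omega>) = 1" using I measurable_space[OF X \<omega>] by simp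
    then show "W b \<omega> * log 2 (W b \<omega> / r b) = (\<Sum>i\<in>I. W b \<omega> * log 2 (W b \<omega> / r b) * ?ind i \<omega>)"
      by (simp add: sum_distrib_left[symmetric])
  qed
  also have "\<dots> = (\<Sum>b\<in>B. \<Sum>i\<in>I. \<integral>\<omega>. W b \<omega> * log 2 (W b \<omega> / r b) * ?ind i \<omega> \<partial>\<Omega>)"
    using iL by (subst Bochner_Integration.integral_sum)
      (auto intro!: sum.cong Bochner_Integration.integral_sum Bochner_Integration.integrable_sum)
  also have "\<dots> \<ge> (\<Sum>b\<in>B. \<Sum>i\<in>I. (\<integral>\<omega>. W b \<omega> * ?ind i \<omega> \<partial>\<Omega>) * log 2 (\<kappa> i (Y b))
     + ((\<integral>\<omega>. W b \<omega> * ?ind i \<omega> \<partial>\<Omega>) - r b * \<kappa> i (Y b) * a i) / ln 2)" (is "_ \<ge> ?S")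
    by (intro sum_mono cell refl)
  \<comment> \<open>Grouping the labels by their value under \<open>Y\<close> collects label masses
    into \<open>p i j\<close> and reference weights into \<open>R j\<close>.\<close>
  also have "?S = (\<Sum>j\<in>J. \<Sum>b\<in>{b\<in>B. Y b = j}. \<Sum>i\<in>I. (\<integral>\<omega>. W b \<omega> * ?ind i \<omega> \<partial>\<Omega>) * log 2 (\<kappa> i j)
     + ((\<integral>\<omega>. W b \<omega> * ?ind i \<omega> \<partial>\<Omega>) - r b * \<kappa> i j * a i) / ln 2)"
    using B J Y by (subst sum.group[symmetric, where g = Y and T = J]) (auto intro!: sum.cong)
  also have "\<dots> = (\<Sum>j\<in>J. \<Sum>i\<in>I. p i j * log 2 (\<kappa> i j) + (p i j - R j * \<kappa> i j * a i) / ln 2)"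
    by (subst sum.swap[of _ I], intro sum.cong refl)
      (simp add: p_eq R_def sum.distrib sum_distrib_right sum_subtractf sum_divide_distrib[symmetric])
  also have "\<dots> = (\<Sum>j\<in>J. \<Sum>i\<in>I. p i j * log 2 (\<kappa> i j)) + (\<Sum>j\<in>J. \<Sum>i\<in>I. p i j - R j * \<kappa> i j * a i) / ln 2"
    by (simp add: sum.distrib sum_divide_distrib)
  also have "(\<Sum>j\<in>J. \<Sum>i\<in>I. p i j * log 2 (\<kappa> i j)) =
     finite_mutual_info ?N I (X \<circ> fst) J (Y \<circ> snd)"
    by (subst sum.swap) (simp add: MI(1) \<kappa>_def)
  finally have main: "finite_mutual_info ?N I (X \<circ> fst) J (Y \<circ> snd)
      + (\<Sum>j\<in>J. \<Sum>i\<in>I. p i j - R j * \<kappa> i j * a i) / ln 2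
    \<le> (\<integral>\<omega>. (\<Sum>b\<in>B. W b \<omega> * log 2 (W b \<omega> / r b)) \<partial>\<Omega>)" .
  \<comment> \<open>The linear correction has a sign: the \<open>p i j\<close> sum to one, whereas
    the references sum to at most the total of the \<open>R j\<close>, which is at most one. The
    quotient \<open>q j / q j\<close> that appears below is 0 or 1.\<close>
  have "(\<Sum>j\<in>J. \<Sum>i\<in>I. p i j - R j * \<kappa> i j * a i) \<ge> 0"
  proof -
    have "(\<Sum>j\<in>J. \<Sum>i\<in>I. p i j) = (\<Sum>i\<in>I. a i)" unfolding a_def by (rule sum.swap)
    also have "\<dots> = (\<Sum>i\<in>I. measure ?N {\<omega> \<in> space ?N. (X \<circ> fst) \<omega> = i})" using MI(2) by simp
    also have "\<dots> = 1" by (rule sum_fibre_prob[OF N.prob_space_axioms I mX])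
    finally have 1: "(\<Sum>j\<in>J. \<Sum>i\<in>I. p i j) = 1" .
    have "(\<Sum>i\<in>I. R j * \<kappa> i j * a i) \<le> R j" if j: "j \<in> J" for j
    proof -
      have "(\<Sum>i\<in>I. R j * \<kappa> i j * a i) \<le> (\<Sum>i\<in>I. R j * (p i j / q j))"
        unfolding \<kappa>_def using R0 p0 q0 by (intro sum_mono) (auto simp: mult.assoc intro!: mult_left_mono)
      also have "\<dots> = R j * (q j / q j)"
        by (simp only: sum_distrib_left[symmetric] sum_divide_distrib[symmetric] q_def[symmetric])
      also have "\<dots> \<le> R j" using R0 by simp
      finally show ?thesis .
    qed
    then have "(\<Sum>j\<in>J. \<Sum>i\<in>I. R j * \<kappa> i j * a i) \<le> (\<Sum>j\<in>J. R j)" by (intro sum_mono)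
    with 1 sum_R show ?thesis by (simp add: sum_subtractf)
  qed
  then have "0 \<le> (\<Sum>j\<in>J. \<Sum>i\<in>I. p i j - R j * \<kappa> i j * a i) / ln 2" by simp
  with main show ?thesis by linarith
qed

section \<open>Cubes and averaged distances\<close>

lemma cube_measurable: "cube L \<in> sets (borel :: (real ^ 'n::finite) measure)"
proof -
  have "cube L = {u \<in> space borel. \<forall>i\<in>UNIV. 0 \<le> u $ i \<and> u $ i < L}" by (auto simp: cube_def)
  also have "\<dots> \<in> sets (borel :: (real ^ 'n) measure)" by measurable
  finally show ?thesis .
qed

lemma cube_subset_cbox: "cube L \<subseteq> cbox 0 (\<chi> i. L)"
  by (auto simp: cube_def mem_box_cart less_imp_le)

lemma emeasure_cube_le:
  assumes "0 \<le> L"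
  shows "emeasure lborel (cube L :: (real ^ 'n::finite) set) \<le> ennreal (L ^ CARD('n))"
proof -
  have ne: "cbox 0 (\<chi> i. L) \<noteq> ({} :: (real ^ 'n) set)"
    using assms by (simp add: interval_ne_empty_cart)
  have "emeasure lborel (cube L :: (real ^ 'n) set) \<le> emeasure lborel (cbox 0 (\<chi> i. L) :: (real ^ 'n) set)"
    using cube_subset_cbox by (intro emeasure_mono) auto
  also have "\<dots> = ennreal (measure lborel (cbox 0 (\<chi> i. L) :: (real ^ 'n) set))"
    by (intro emeasure_eq_ennreal_measure) (simp add: emeasure_lborel_cbox_eq)
  also have "measure lborel (cbox 0 (\<chi> i. L) :: (real ^ 'n) set) = L ^ CARD('n)"
    using content_cbox_cart[OF ne] by simp
  finally show ?thesis .
qed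

lemma space_cube_lborel [simp]: "space (cube_lborel L) = cube L"
  by (simp add: cube_lborel_def space_restrict_space)

lemma borel_measurable_cube_lborel:
  "f \<in> borel_measurable borel \<Longrightarrow> f \<in> borel_measurable (cube_lborel L)"
  unfolding cube_lborel_def by (intro measurable_restrict_space1) simp

lemma emeasure_cube_lborel_le:
  "0 \<le> L \<Longrightarrow> emeasure (cube_lborel L :: (real ^ 'n::finite) measure) (cube L) \<le> ennreal (L ^ CARD('n))"
  using emeasure_cube_le[where 'n = 'n] by (simp add: cube_lborel_def emeasure_restrict_space cube_measurable)

lemma finite_measure_cube_lborel: "finite_measure (cube_lborel L :: (real ^ 'n::finite) measure)"
proof (cases "0 \<le> L")
  case True
  show ?thesis by (rule finite_measureI) (use emeasure_cube_lborel_le[OF True, where 'n = 'n] in \<open>auto simp: top_unique\<close>)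
next
  case False
  then have "cube L = ({} :: (real ^ 'n) set)" by (force simp: cube_def)
  then show ?thesis by (intro finite_measureI) simp
qed

lemma measure_cube_lborel_le:
  "0 \<le> L \<Longrightarrow> measure (cube_lborel L :: (real ^ 'n::finite) measure) (cube L) \<le> L ^ CARD('n)"
  unfolding measure_def using enn2real_mono[OF emeasure_cube_lborel_le[where 'n = 'n]] by fastforce

text \<open>Real-valued form of the inner average in \<open>distortion\<close>, taken for a map
  instead of a class of maps; \<open>ennreal_mean_dist\<close> connects the two.\<close>

definition mean_dist :: "(real ^ 'n::finite \<Rightarrow> 'a::metric_space \<Rightarrow> 'a) \<Rightarrow> real \<Rightarrow> 'a \<Rightarrow> (real ^ 'n \<Rightarrow> 'a) \<Rightarrow> real" where
  "mean_dist T L x g = (\<integral>u. dist (T u x) (g u) \<partial>cube_lborel L) / L ^ CARD('n)"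

locale compact_action =
  fixes T :: "real ^ 'n::finite \<Rightarrow> 'a::polish_space \<Rightarrow> 'a"
  assumes compact_UNIV: "compact (UNIV :: 'a set)" and action: "continuous_action T"
begin

lemma dist_le_diameter: "dist (x :: 'a) y \<le> diameter (UNIV :: 'a set)"
  using compact_imp_bounded[OF compact_UNIV] by (intro diameter_bounded_bound) auto

lemma diameter_UNIV_nonneg: "0 \<le> diameter (UNIV :: 'a set)"
  using dist_le_diameter[of undefined undefined] by simp

lemma T_add: "T (u + v) x = T u (T v x)"
  using action by (auto simp: continuous_action_def)

lemma continuous_T: "continuous_on UNIV (\<lambda>(u, x). T u x)"
  using action by (auto simp: continuous_action_def)

lemma measurable_T_pair: "(\<lambda>(u, x). T u x) \<in> borel_measurable (borel \<Otimes>\<^sub>M borel)"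
  using borel_measurable_continuous_onI[OF continuous_T] by (simp add: borel_prod)

lemma measurable_T:
  assumes "f \<in> borel_measurable M" "g \<in> borel_measurable M"
  shows "(\<lambda>x. T (f x) (g x)) \<in> borel_measurable M"
  using measurable_compose[OF measurable_Pair[OF assms] measurable_T_pair] by simp

text \<open>The half-open cube is not compact, so uniform continuity is taken on the closed box
  times the whole space.\<close>

lemma T_equicontinuous:
  assumes "0 < e"
  obtains \<delta> where "0 < \<delta>" "\<And>x y u. dist x y < \<delta> \<Longrightarrow> u \<in> cube L \<Longrightarrow> dist (T u x) (T u y) < e"
proof -
  let ?S = "cbox (0 :: real ^ 'n) (\<chi> i. L) \<times> (UNIV :: 'a set)"
  have "uniformly_continuous_on ?S (\<lambda>(u, x). T u x)"
    using compact_UNIV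
    by (intro compact_uniformly_continuous compact_Times continuous_on_subset[OF continuous_T]) auto
  then obtain \<delta> where \<delta>: "0 < \<delta>"
    "\<And>p q. p \<in> ?S \<Longrightarrow> q \<in> ?S \<Longrightarrow> dist q p < \<delta> \<Longrightarrow> dist (case q of (u, x) \<Rightarrow> T u x) (case p of (u, x) \<Rightarrow> T u x) < e"
    using assms unfolding uniformly_continuous_on_def by metis
  show thesis
  proof (rule that[OF \<delta>(1)])
    fix x y :: 'a and u :: "real ^ 'n"
    assume "dist x y < \<delta>" "u \<in> cube L"
    then show "dist (T u x) (T u y) < e"
      using \<delta>(2)[of "(u, y)" "(u, x)"] cube_subset_cbox by (auto simp: dist_Pair_Pair)
  qed
qed

lemma integrable_dist:
  assumes "f \<in> borel_measurable (cube_lborel L)" "g \<in> borel_measurable (cube_lborel L)"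
  shows "integrable (cube_lborel L :: (real ^ 'n) measure) (\<lambda>u. dist (f u :: 'a) (g u))"
proof -
  interpret finite_measure "cube_lborel L :: (real ^ 'n) measure" by (rule finite_measure_cube_lborel)
  show ?thesis using assms dist_le_diameter
    by (intro integrable_const_bound[where B = "diameter (UNIV :: 'a set)"] borel_measurable_dist AE_I2) auto
qed

lemma measurable_orbit: "(\<lambda>u. T u x) \<in> borel_measurable (cube_lborel L)"
  by (intro borel_measurable_cube_lborel measurable_T) auto

lemma mean_dist_nonneg: "0 < L \<Longrightarrow> 0 \<le> mean_dist T L x g"
  by (simp add: mean_dist_def)

lemma mean_le_const:
  assumes "0 < L" "integrable (cube_lborel L :: (real ^ 'n) measure) h" "\<And>u. u \<in> cube L \<Longrightarrow> h u \<le> c" "0 \<le> c"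
  shows "(\<integral>u. h u \<partial>(cube_lborel L :: (real ^ 'n) measure)) / L ^ CARD('n) \<le> c"
proof -
  interpret finite_measure "cube_lborel L :: (real ^ 'n) measure" by (rule finite_measure_cube_lborel)
  have "(\<integral>u. h u \<partial>cube_lborel L) \<le> (\<integral>u. c \<partial>(cube_lborel L :: (real ^ 'n) measure))"
    using assms by (intro integral_mono) auto
  also have "\<dots> = c * measure (cube_lborel L :: (real ^ 'n) measure) (cube L)" by simp
  also have "\<dots> \<le> c * L ^ CARD('n)" using assms by (intro mult_left_mono measure_cube_lborel_le) auto
  finally show ?thesis using assms by (simp add: field_simps)
qed

lemma mean_dist_le_diameter:
  assumes "0 < L" "g \<in> borel_measurable (cube_lborel L)"
  shows "mean_dist T L x g \<le> diameter (UNIV :: 'a set)"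
  unfolding mean_dist_def using assms dist_le_diameter
  by (intro mean_le_const integrable_dist measurable_orbit diameter_UNIV_nonneg) auto

lemma mean_dist_lipschitz:
  assumes "0 < L" "g \<in> borel_measurable (cube_lborel L)" "0 \<le> e"
    and "\<And>u. u \<in> cube L \<Longrightarrow> dist (T u x) (T u y) \<le> e"
  shows "mean_dist T L x g \<le> mean_dist T L y g + e"
proof -
  let ?M = "cube_lborel L :: (real ^ 'n) measure"
  have "(\<integral>u. dist (T u x) (g u) \<partial>?M) \<le> (\<integral>u. dist (T u x) (T u y) + dist (T u y) (g u) \<partial>?M)"
    using assms(2) by (intro integral_mono Bochner_Integration.integrable_add integrable_dist measurable_orbit dist_triangle)
  also have "\<dots> = (\<integral>u. dist (T u x) (T u y) \<partial>?M) + (\<integral>u. dist (T u y) (g u) \<partial>?M)"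
    using assms(2) by (intro Bochner_Integration.integral_add integrable_dist measurable_orbit)
  finally have "mean_dist T L x g \<le> (\<integral>u. dist (T u x) (T u y) \<partial>?M) / L ^ CARD('n) + mean_dist T L y g"
    using assms(1) by (simp add: mean_dist_def add_divide_distrib[symmetric] divide_right_mono)
  also have "(\<integral>u. dist (T u x) (T u y) \<partial>?M) / L ^ CARD('n) \<le> e"
    using assms by (intro mean_le_const integrable_dist measurable_orbit)
  finally show ?thesis by simp
qed

lemma mean_dist_measurable [measurable]:
  assumes "g \<in> borel_measurable (cube_lborel L)"
  shows "(\<lambda>x. mean_dist T L x g) \<in> borel_measurable borel"
proof -
  interpret finite_measure "cube_lborel L :: (real ^ 'n) measure" by (rule finite_measure_cube_lborel)
  have "(\<lambda>u. u) \<in> borel_measurable (cube_lborel L :: (real ^ 'n) measure)"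
    by (intro borel_measurable_cube_lborel) auto
  then have [measurable]: "(\<lambda>p. snd p) \<in> borel_measurable (borel \<Otimes>\<^sub>M (cube_lborel L :: (real ^ 'n) measure))"
    by (rule measurable_compose[OF measurable_snd])
  have [measurable]: "(\<lambda>p. T (snd p) (fst p)) \<in> borel_measurable (borel \<Otimes>\<^sub>M (cube_lborel L :: (real ^ 'n) measure))"
    by (rule measurable_T) measurable
  have [measurable]: "(\<lambda>p. g (snd p)) \<in> borel_measurable (borel \<Otimes>\<^sub>M (cube_lborel L :: (real ^ 'n) measure))"
    by (rule measurable_compose[OF measurable_snd assms])
  show ?thesis unfolding mean_dist_def by measurable
qed

lemma ennreal_mean_dist:
  assumes "0 < L" "g \<in> borel_measurable (cube_lborel L)"
  shows "(\<integral>\<^sup>+u. ennreal (dist (T u x) (g u)) \<partial>cube_lborel L) / ennreal (L ^ CARD('n))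
    = ennreal (mean_dist T L x g)"
  unfolding mean_dist_def using assms
  by (subst nn_integral_eq_integral)
    (auto intro!: integrable_dist measurable_orbit simp: divide_ennreal)

end

section \<open>The space of maps on a cube\<close>

lemma ae_eq_rel_equiv: "equiv (borel_measurable (cube_lborel L)) (ae_eq_rel L)"
  by (rule equivI) (auto simp: ae_eq_rel_def refl_on_def sym_def trans_def elim: eventually_elim2)

lemma rep_L1:
  assumes "F \<in> L1_space L"
  shows "rep F \<in> F" "rep F \<in> borel_measurable (cube_lborel L)"
proof -
  have "\<exists>f. f \<in> F" using assms equiv_Eps_in[OF ae_eq_rel_equiv] by (auto simp: L1_space_def)
  then show 1: "rep F \<in> F" unfolding rep_def by (rule someI_ex)
  show "rep F \<in> borel_measurable (cube_lborel L)"
    using 1 assms in_quotient_imp_subset[OF ae_eq_rel_equiv, of F L] by (auto simp: L1_space_def)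
qed

lemma class_in_L1:
  assumes "f \<in> borel_measurable (cube_lborel L)"
  shows "ae_eq_rel L `` {f} \<in> L1_space L"
    and "AE u in cube_lborel L. rep (ae_eq_rel L `` {f}) u = f u"
proof -
  show *: "ae_eq_rel L `` {f} \<in> L1_space L" unfolding L1_space_def by (rule quotientI[OF assms])
  have "AE u in cube_lborel L. f u = rep (ae_eq_rel L `` {f}) u"
    using rep_L1(1)[OF *] by (auto simp: ae_eq_rel_def)
  then show "AE u in cube_lborel L. rep (ae_eq_rel L `` {f}) u = f u" by eventually_elim simp
qed

context compact_action
begin

lemma mean_dist_cong_AE:
  assumes "AE u in cube_lborel L. f u = g u"
    and "f \<in> borel_measurable (cube_lborel L)" "g \<in> borel_measurable (cube_lborel L)"
  shows "mean_dist T L x f = mean_dist T L x g"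
proof -
  have "(\<integral>u. dist (T u x) (f u) \<partial>cube_lborel L) = (\<integral>u. dist (T u x) (g u) \<partial>cube_lborel L)"
    using assms by (intro integral_cong_AE borel_measurable_dist measurable_orbit) auto
  then show ?thesis by (simp add: mean_dist_def)
qed

lemma L1_metric_space:
  "Metric_space (L1_space L :: (real ^ 'n \<Rightarrow> 'a) set set) (L1_dist L)"
proof
  let ?M = "cube_lborel L :: (real ^ 'n) measure"
  fix F G H :: "(real ^ 'n \<Rightarrow> 'a) set"
  show "0 \<le> L1_dist L F G" by (simp add: L1_dist_def)
  show "L1_dist L F G = L1_dist L G F" by (simp add: L1_dist_def dist_commute)
  assume F: "F \<in> L1_space L" and G: "G \<in> L1_space L"
  have int: "integrable ?M (\<lambda>u. dist (rep F u) (rep G u))"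
    by (intro integrable_dist rep_L1 F G)
  show "L1_dist L F G = 0 \<longleftrightarrow> F = G"
  proof
    assume "L1_dist L F G = 0"
    then have "AE u in ?M. dist (rep F u) (rep G u) = 0"
      unfolding L1_dist_def using int by (subst (asm) integral_nonneg_eq_0_iff_AE) auto
    then have "(rep F, rep G) \<in> ae_eq_rel L"
      using rep_L1(2)[OF F] rep_L1(2)[OF G] by (auto simp: ae_eq_rel_def)
    then show "F = G"
      using F G rep_L1(1)[OF F] rep_L1(1)[OF G] quotient_eq_iff[OF ae_eq_rel_equiv, of F L G]
      by (auto simp: L1_space_def)
  qed (simp add: L1_dist_def)
  assume H: "H \<in> L1_space L"
  have "L1_dist L F H \<le> (\<integral>u. dist (rep F u) (rep G u) + dist (rep G u) (rep H u) \<partial>?M)"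
    unfolding L1_dist_def
    by (intro integral_mono Bochner_Integration.integrable_add integrable_dist rep_L1 F G H dist_triangle)
  also have "\<dots> = L1_dist L F G + L1_dist L G H"
    unfolding L1_dist_def by (intro Bochner_Integration.integral_add integrable_dist rep_L1 F G H)
  finally show "L1_dist L F H \<le> L1_dist L F G + L1_dist L G H" .
qed

lemma space_L1_borel: "space (L1_borel L :: (real ^ 'n \<Rightarrow> 'a) set measure) = L1_space L"
  and openin_L1_borel: "openin (Metric_space.mtopology (L1_space L) (L1_dist L)) U \<Longrightarrow>
    U \<in> sets (L1_borel L :: (real ^ 'n \<Rightarrow> 'a) set measure)"
proof -
  interpret Metric_space "L1_space L :: (real ^ 'n \<Rightarrow> 'a) set set" "L1_dist L" by (rule L1_metric_space)
  show "space (L1_borel L :: (real ^ 'n \<Rightarrow> 'a) set measure) = L1_space L"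
    by (simp add: L1_borel_def borel_of_def space_measure_of_conv)
  have *: "{U. openin mtopology U} \<subseteq> Pow (topspace mtopology)"
    using openin_subset by blast
  show "openin mtopology U \<Longrightarrow> U \<in> sets (L1_borel L)"
    unfolding L1_borel_def borel_of_def sets_measure_of[OF *] by (intro sigma_sets.Basic) simp
qed

text \<open>The \<sigma>-algebra of \<open>L1_borel\<close> is known only through its open sets. A
  one-sided Lipschitz bound makes the strict sublevel sets open, and these generate measurability of
  real functions.\<close>

lemma lipschitz_L1_borel_measurable:
  assumes "\<And>F G. F \<in> L1_space L \<Longrightarrow> G \<in> L1_space L \<Longrightarrow> h F \<le> h G + c * L1_dist L F G" "0 \<le> c"
  shows "h \<in> borel_measurable (L1_borel L :: (real ^ 'n \<Rightarrow> 'a) set measure)"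
proof (rule borel_measurableI_less)
  fix y :: real
  interpret Metric_space "L1_space L :: (real ^ 'n \<Rightarrow> 'a) set set" "L1_dist L" by (rule L1_metric_space)
  have "openin mtopology {F \<in> L1_space L. h F < y}"
    unfolding openin_mtopology
  proof (intro conjI allI impI)
    fix F assume F: "F \<in> {F \<in> L1_space L. h F < y}"
    \<comment> \<open>Dividing by \<open>c + 1\<close> instead of \<open>c\<close> keeps the radius
      meaningful for \<open>c = 0\<close>.\<close>
    let ?r = "(y - h F) / (c + 1)"
    have "mball F ?r \<subseteq> {F \<in> L1_space L. h F < y}"
    proof
      fix G assume G: "G \<in> mball F ?r"
      then have G': "G \<in> L1_space L" "L1_dist L G F < ?r" by (auto simp: commute)
      have "h G \<le> h F + c * L1_dist L G F" using assms(1)[of G F] F G' by auto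
      also have "c * L1_dist L G F \<le> (c + 1) * L1_dist L G F" by (intro mult_right_mono) auto
      also have "(c + 1) * L1_dist L G F < y - h F" using G'(2) assms(2) by (simp add: field_simps)
      finally show "G \<in> {F \<in> L1_space L. h F < y}" using G' by simp
    qed
    moreover have "0 < ?r" using F assms(2) by simp
    ultimately show "\<exists>r>0. mball F r \<subseteq> {F \<in> L1_space L. h F < y}" by blast
  qed auto
  then show "{x \<in> space (L1_borel L). h x < y} \<in> sets (L1_borel L)"
    using openin_L1_borel by (simp add: space_L1_borel)
qed

text \<open>For a fixed source point the averaged distance is Lipschitz in the second argument by
  the triangle inequality. These functionals are the ones that later quantise the second variable of
  a coupling.\<close>

lemma mean_dist_rep_measurable:
  assumes "0 < L"
  shows "(\<lambda>F. mean_dist T L x (rep F)) \<in> borel_measurable (L1_borel L)"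
proof (rule lipschitz_L1_borel_measurable[where c = "1 / L ^ CARD('n)"])
  fix F G :: "(real ^ 'n \<Rightarrow> 'a) set" assume F: "F \<in> L1_space L" and G: "G \<in> L1_space L"
  let ?M = "cube_lborel L :: (real ^ 'n) measure"
  have "(\<integral>u. dist (T u x) (rep F u) \<partial>?M) \<le> (\<integral>u. dist (T u x) (rep G u) + dist (rep F u) (rep G u) \<partial>?M)"
    using dist_triangle2
    by (intro integral_mono Bochner_Integration.integrable_add integrable_dist measurable_orbit rep_L1 F G)
  also have "\<dots> = (\<integral>u. dist (T u x) (rep G u) \<partial>?M) + L1_dist L F G"
    unfolding L1_dist_def by (intro Bochner_Integration.integral_add integrable_dist measurable_orbit rep_L1 F G)
  finally show "mean_dist T L x (rep F) \<le> mean_dist T L x (rep G) + 1 / L ^ CARD('n) * L1_dist L F G"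
    using assms by (simp add: mean_dist_def add_divide_distrib[symmetric] divide_right_mono)
qed (use assms in auto)

end

text \<open>The fibres are indexed by the attained values of \<open>h\<close> rather than by all of
  \<open>I\<close>, because \<open>partition_on\<close> excludes empty cells.\<close>

lemma finite_measurable_partition_fibres:
  assumes "h \<in> measurable S (count_space I)" "finite I"
  shows "finite_measurable_partition S ((\<lambda>i. h -` {i} \<inter> space S) ` (h ` space S))"
proof -
  have sub: "h ` space S \<subseteq> I" using measurable_space[OF assms(1)] by auto
  have "(\<lambda>i. h -` {i} \<inter> space S) ` (h ` space S) \<subseteq> sets S"
  proof safe
    fix x assume "x \<in> space S"
    then have "h x \<in> I" using sub by auto
    then show "h -` {h x} \<inter> space S \<in> sets S" using measurable_sets[OF assms(1), of "{h x}"] by simp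
  qed
  moreover have "partition_on (space S) ((\<lambda>i. h -` {i} \<inter> space S) ` (h ` space S))"
  proof (rule partition_onI)
    fix p q assume pq: "p \<in> (\<lambda>i. h -` {i} \<inter> space S) ` (h ` space S)"
      "q \<in> (\<lambda>i. h -` {i} \<inter> space S) ` (h ` space S)" "p \<noteq> q"
    then obtain i j where ij: "p = h -` {i} \<inter> space S" "q = h -` {j} \<inter> space S" by blast
    with pq(3) have "i \<noteq> j" by blast
    then show "disjnt p q" unfolding ij disjnt_def by blast
  next
    show "\<Union> ((\<lambda>i. h -` {i} \<inter> space S) ` (h ` space S)) = space S" by blast
  next
    show "{} \<notin> (\<lambda>i. h -` {i} \<inter> space S) ` (h ` space S)" by blast
  qed
  moreover have "finite ((\<lambda>i. h -` {i} \<inter> space S) ` (h ` space S))"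
    by (intro finite_imageI finite_subset[OF sub assms(2)])
  ultimately show ?thesis
    unfolding finite_measurable_partition_def by (intro conjI)
qed

lemma open_cover_index:
  fixes V :: "nat \<Rightarrow> 'b::topological_space set"
  assumes op: "\<And>i. i < n \<Longrightarrow> open (V i)" and cov: "(\<Union>i<n. V i) = UNIV"
  obtains h where "\<And>x. h x < n" "\<And>x. x \<in> V (h x)" "h \<in> measurable borel (count_space UNIV)"
proof -
  \<comment> \<open>The first index whose set contains \<open>x\<close>. The disjunct
    \<open>n \<le> i\<close> makes the predicate hold everywhere, hence measurable, for indices at
    which nothing is known about \<open>V i\<close>.\<close>
  define h where "h x = (LEAST i. x \<in> V i \<or> n \<le> i)" for x
  show thesis
  proof (rule that)
    show "h x < n" "x \<in> V (h x)" for x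
    proof -
      have "x \<in> (\<Union>i<n. V i)" using cov by simp
      then obtain i where i: "i < n" "x \<in> V i" by blast
      have "h x \<le> i" unfolding h_def using i by (intro Least_le) auto
      moreover have "x \<in> V (h x) \<or> n \<le> h x"
        unfolding h_def by (rule LeastI[of _ i]) (use i in auto)
      ultimately show "h x < n" "x \<in> V (h x)" using i by auto
    qed
    show "h \<in> measurable borel (count_space UNIV)"
      unfolding h_def
    proof (rule measurable_Least)
      fix i
      have "open {x. x \<in> V i \<or> n \<le> i}" using op[of i] by (cases "n \<le> i") simp_all
      then have "{x. x \<in> V i \<or> n \<le> i} \<in> sets borel" by (rule borel_open)
      then show "Measurable.pred borel (\<lambda>x. x \<in> V i \<or> n \<le> i)" by (simp add: pred_def)
    qed
  qed
qed

context compact_action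
begin

lemma fine_partition:
  assumes "0 < \<delta>"
  obtains \<alpha> :: "'a set set" where "finite_measurable_partition borel \<alpha>"
    "\<And>A x y. A \<in> \<alpha> \<Longrightarrow> x \<in> A \<Longrightarrow> y \<in> A \<Longrightarrow> dist x y < \<delta>"
proof -
  obtain k where k: "finite k" "(UNIV :: 'a set) \<subseteq> (\<Union>x\<in>k. ball x (\<delta> / 2))"
    using compact_UNIV[unfolded compact_eq_totally_bounded] assms by (meson half_gt_zero)
  obtain xs where xs: "set xs = k" using finite_list[OF k(1)] by auto
  have "(\<Union>i<length xs. ball (xs ! i) (\<delta> / 2)) = UNIV"
    using k(2) xs by (force simp: in_set_conv_nth)
  then obtain h where h: "\<And>x. h x < length xs" "\<And>x. x \<in> ball (xs ! h x) (\<delta> / 2)"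
    and "h \<in> measurable borel (count_space UNIV)"
    by (rule open_cover_index[rotated]) auto
  then have m: "h \<in> measurable borel (count_space {..<length xs})"
    using h(1) by (simp add: measurable_count_space_eq2_countable)
  show thesis
  proof (rule that[OF finite_measurable_partition_fibres[OF m]])
    fix A x y assume "A \<in> (\<lambda>i. h -` {i} \<inter> space borel) ` (h ` space borel)" "x \<in> A" "y \<in> A"
    then have "h x = h y" by auto
    then have "dist (xs ! h x) x < \<delta> / 2" "dist (xs ! h x) y < \<delta> / 2" using h(2)[of x] h(2)[of y] by auto
    then show "dist x y < \<delta>" using dist_triangle_half_r by blast
  qed auto
qed

end

section \<open>Codes\<close>

text \<open>A Markov kernel to finitely many labels with a reference sub-probability. Positive
  weights keep the logarithms finite, and total mass at most one is exactly what Gibbs' inequality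
  uses; both pass to products over tiles and to uniform mixtures.\<close>

definition kernel_on :: "'w measure \<Rightarrow> 'b set \<Rightarrow> ('b \<Rightarrow> 'w \<Rightarrow> real) \<Rightarrow> ('b \<Rightarrow> real) \<Rightarrow> bool" where
  "kernel_on \<Omega> B W r \<longleftrightarrow> finite B \<and> (\<forall>b\<in>B. W b \<in> borel_measurable \<Omega>) \<and>
     (\<forall>b\<in>B. \<forall>\<omega>\<in>space \<Omega>. 0 \<le> W b \<omega>) \<and> (\<forall>\<omega>\<in>space \<Omega>. (\<Sum>b\<in>B. W b \<omega>) = 1) \<and>
     (\<forall>b\<in>B. 0 < r b) \<and> (\<Sum>b\<in>B. r b) \<le> 1"

lemma kernel_onD:
  assumes "kernel_on \<Omega> B W r"
  shows "finite B" "b \<in> B \<Longrightarrow> W b \<in> borel_measurable \<Omega>"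
    "b \<in> B \<Longrightarrow> \<omega> \<in> space \<Omega> \<Longrightarrow> 0 \<le> W b \<omega>" "\<omega> \<in> space \<Omega> \<Longrightarrow> (\<Sum>b\<in>B. W b \<omega>) = 1"
    "b \<in> B \<Longrightarrow> 0 < r b" "(\<Sum>b\<in>B. r b) \<le> 1"
    "b \<in> B \<Longrightarrow> \<omega> \<in> space \<Omega> \<Longrightarrow> W b \<omega> \<le> 1"
  using assms kernel_le_one[of B "\<lambda>b. W b \<omega>" b] by (auto simp: kernel_on_def)

text \<open>
  \<open>d\<close> and \<open>j\<close> are the distortion and the information of the code as functions of the source point.
\<close>

definition code :: "(real ^ 'n::finite \<Rightarrow> 'a::metric_space \<Rightarrow> 'a) \<Rightarrow> real \<Rightarrow> ('a \<Rightarrow> real) \<Rightarrow> ('a \<Rightarrow> real) \<Rightarrow> bool" where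
  "code T L d j \<longleftrightarrow> (\<exists>(B :: nat set) f W r. kernel_on borel B W r \<and>
     (\<forall>b\<in>B. f b \<in> borel_measurable borel) \<and>
     d = (\<lambda>x. \<Sum>b\<in>B. W b x * mean_dist T L x (f b)) \<and>
     j = (\<lambda>x. \<Sum>b\<in>B. W b x * log 2 (W b x / r b)))"

text \<open>\<open>code\<close> fixes \<open>nat\<close> as the type of labels; a finite set of any
  other type is carried over by a bijection. Tiling needs labels that are functions and quantising
  needs labels that are sets of classes.\<close>

lemma codeI:
  fixes B :: "'b set"
  assumes "kernel_on borel B W r" "\<And>b. b \<in> B \<Longrightarrow> f b \<in> borel_measurable borel"
  shows "code T L (\<lambda>x. \<Sum>b\<in>B. W b x * mean_dist T L x (f b)) (\<lambda>x. \<Sum>b\<in>B. W b x * log 2 (W b x / r b))"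
proof -
  obtain h where h: "bij_betw h {0..<card B} B"
    using ex_bij_betw_nat_finite[OF kernel_onD(1)[OF assms(1)]] by blast
  have s: "(\<Sum>b\<in>B. g b) = (\<Sum>i\<in>{0..<card B}. g (h i))" for g :: "'b \<Rightarrow> real"
    using sum.reindex_bij_betw[OF h, of g] by simp
  have "h i \<in> B" if "i \<in> {0..<card B}" for i using h that by (auto simp: bij_betw_def)
  then show ?thesis
    unfolding code_def
    using assms by (intro exI[of _ "{0..<card B}"] exI[of _ "\<lambda>i. f (h i)"] exI[of _ "\<lambda>i. W (h i)"]
      exI[of _ "\<lambda>i. r (h i)"]) (auto simp: kernel_on_def s)
qed

lemma codeE:
  assumes "code T L d j"
  obtains B :: "nat set" and f W r where "kernel_on borel B W r"
    "\<And>b. b \<in> B \<Longrightarrow> f b \<in> borel_measurable borel"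
    "d = (\<lambda>x. \<Sum>b\<in>B. W b x * mean_dist T L x (f b))"
    "j = (\<lambda>x. \<Sum>b\<in>B. W b x * log 2 (W b x / r b))"
  using assms unfolding code_def by blast

text \<open>Gibbs' inequality, as the sum of \<open>mult_log_ge\<close> over the labels.\<close>

lemma log_sum_nonneg:
  fixes w r :: "'b \<Rightarrow> real"
  assumes "finite B" "\<And>b. b \<in> B \<Longrightarrow> 0 \<le> w b" "(\<Sum>b\<in>B. w b) = 1" "\<And>b. b \<in> B \<Longrightarrow> 0 < r b" "(\<Sum>b\<in>B. r b) \<le> 1"
  shows "0 \<le> (\<Sum>b\<in>B. w b * log 2 (w b / r b))"
proof -
  have "0 \<le> ((\<Sum>b\<in>B. w b) - (\<Sum>b\<in>B. r b)) / ln 2" using assms by simp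
  also have "\<dots> = (\<Sum>b\<in>B. (w b - r b) / ln 2)" by (simp add: sum_subtractf sum_divide_distrib[symmetric])
  also have "\<dots> \<le> (\<Sum>b\<in>B. w b * log 2 (w b / r b))"
    using assms by (intro sum_mono mult_log_ge) (auto simp: less_le)
  finally show ?thesis .
qed

context compact_action
begin

lemma kernel_mean_dist:
  assumes "kernel_on \<Omega> B W r" "\<And>b. b \<in> B \<Longrightarrow> f b \<in> borel_measurable (cube_lborel L)"
    "X \<in> borel_measurable \<Omega>" "0 < L"
  shows "(\<lambda>\<omega>. \<Sum>b\<in>B. W b \<omega> * mean_dist T L (X \<omega>) (f b)) \<in> borel_measurable \<Omega>"
    and "\<omega> \<in> space \<Omega> \<Longrightarrow> 0 \<le> (\<Sum>b\<in>B. W b \<omega> * mean_dist T L (X \<omega>) (f b))"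
    and "\<omega> \<in> space \<Omega> \<Longrightarrow> (\<Sum>b\<in>B. W b \<omega> * mean_dist T L (X \<omega>) (f b)) \<le> diameter (UNIV :: 'a set)"
proof -
  note k = kernel_onD[OF assms(1)]
  show "(\<lambda>\<omega>. \<Sum>b\<in>B. W b \<omega> * mean_dist T L (X \<omega>) (f b)) \<in> borel_measurable \<Omega>"
    by (intro borel_measurable_sum borel_measurable_times k(2) measurable_compose[OF assms(3) mean_dist_measurable] assms(2))
  assume \<omega>: "\<omega> \<in> space \<Omega>"
  show "0 \<le> (\<Sum>b\<in>B. W b \<omega> * mean_dist T L (X \<omega>) (f b))"
    by (intro sum_nonneg mult_nonneg_nonneg k(3) \<omega> mean_dist_nonneg assms(4))
  have "(\<Sum>b\<in>B. W b \<omega> * mean_dist T L (X \<omega>) (f b)) \<le> (\<Sum>b\<in>B. W b \<omega> * diameter (UNIV :: 'a set))"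
    by (intro sum_mono mult_left_mono k(3) \<omega> mean_dist_le_diameter assms(2,4))
  also have "\<dots> = diameter (UNIV :: 'a set)" using k(4)[OF \<omega>] by (simp add: sum_distrib_right[symmetric])
  finally show "(\<Sum>b\<in>B. W b \<omega> * mean_dist T L (X \<omega>) (f b)) \<le> diameter (UNIV :: 'a set)" .
qed

lemma kernel_info:
  assumes "kernel_on \<Omega> B W r"
  shows "(\<lambda>\<omega>. \<Sum>b\<in>B. W b \<omega> * log 2 (W b \<omega> / r b)) \<in> borel_measurable \<Omega>"
    and "\<omega> \<in> space \<Omega> \<Longrightarrow> 0 \<le> (\<Sum>b\<in>B. W b \<omega> * log 2 (W b \<omega> / r b))"
    and "\<omega> \<in> space \<Omega> \<Longrightarrow> (\<Sum>b\<in>B. W b \<omega> * log 2 (W b \<omega> / r b)) \<le> (\<Sum>b\<in>B. (1 + \<bar>ln (r b)\<bar>) / ln 2)"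
proof -
  note k = kernel_onD[OF assms(1)]
  show "(\<lambda>\<omega>. \<Sum>b\<in>B. W b \<omega> * log 2 (W b \<omega> / r b)) \<in> borel_measurable \<Omega>"
    using k(2) by measurable
  show "\<omega> \<in> space \<Omega> \<Longrightarrow> 0 \<le> (\<Sum>b\<in>B. W b \<omega> * log 2 (W b \<omega> / r b))"
    using k by (intro log_sum_nonneg) auto
  show "\<omega> \<in> space \<Omega> \<Longrightarrow> (\<Sum>b\<in>B. W b \<omega> * log 2 (W b \<omega> / r b)) \<le> (\<Sum>b\<in>B. (1 + \<bar>ln (r b)\<bar>) / ln 2)"
    using k by (intro sum_mono order.trans[OF abs_ge_self kernel_log_bounded]) auto
qed

lemma codeD:
  assumes "code T L d j" "0 < L"
  shows "d \<in> borel_measurable borel" "0 \<le> d x" "d x \<le> diameter (UNIV :: 'a set)"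
    and "j \<in> borel_measurable borel" "0 \<le> j x"
    and "\<exists>c. \<forall>x. j x \<le> c"
proof -
  obtain B :: "nat set" and f W r where B: "kernel_on borel B W r"
    and f: "\<And>b. b \<in> B \<Longrightarrow> f b \<in> borel_measurable borel"
    and d: "d = (\<lambda>x. \<Sum>b\<in>B. W b x * mean_dist T L x (f b))"
    and j: "j = (\<lambda>x. \<Sum>b\<in>B. W b x * log 2 (W b x / r b))"
    by (rule codeE[OF assms(1)]) blast
  note m = kernel_mean_dist[OF B borel_measurable_cube_lborel[OF f] measurable_ident assms(2)]
  show "d \<in> borel_measurable borel" unfolding d using m(1) by (simp add: id_def)
  show "0 \<le> d x" "d x \<le> diameter (UNIV :: 'a set)"
    using m(2,3)[of _ x] by (simp_all add: d id_def)
  show "j \<in> borel_measurable borel" "0 \<le> j x" unfolding j using kernel_info[OF B] by auto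
  show "\<exists>c. \<forall>x. j x \<le> c" unfolding j using kernel_info(3)[OF B] by auto
qed

text \<open>A kernel is turned into an admissible pair by drawing a label and using the class of its
  code word as second variable. The source is a function \<open>X\<close> on
  \<open>\<Omega>\<close>, while the kernel may look at all of \<open>\<omega>\<close>; this is how
  a mixture will later use the hidden component \<open>\<nu>\<close>. Only the information about
  \<open>X\<close> is counted, and \<open>finite_mutual_info_kernel_le\<close> bounds it for every
  pair of partitions.\<close>

lemma rate_distortion_L_le:
  assumes "prob_space \<Omega>" and X: "X \<in> borel_measurable \<Omega>" and k: "kernel_on \<Omega> B W r"
    and f: "\<And>b. b \<in> B \<Longrightarrow> f b \<in> borel_measurable borel" and L: "0 < L"
    and less: "(\<integral>\<omega>. (\<Sum>b\<in>B. W b \<omega> * mean_dist T L (X \<omega>) (f b)) \<partial>\<Omega>) < \<epsilon>"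
  shows "rate_distortion_L T (distr \<Omega> borel X) L \<epsilon> \<le>
    ennreal (\<integral>\<omega>. (\<Sum>b\<in>B. W b \<omega> * log 2 (W b \<omega> / r b)) \<partial>\<Omega>)"
proof -
  interpret prob_space \<Omega> by fact
  note K = kernel_onD[OF k]
  let ?N = "kernel_coupling \<Omega> B W"
  interpret N: prob_space ?N by (intro prob_space_kernel_coupling assms K)
  define cls where "cls b = ae_eq_rel L `` {f b}" for b
  let ?C = "cls ` B"
  \<comment> \<open>The finitely many classes carry the discrete \<sigma>-algebra, so the second
    coordinate is measurable into \<open>L1_borel L\<close> and measurability can be checked one
    class at a time.\<close>
  let ?P = "borel \<Otimes>\<^sub>M count_space ?C :: ('a \<times> (real ^ 'n \<Rightarrow> 'a) set) measure"
  let ?Z = "\<lambda>p. (X (fst p), cls (snd p))"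
  \<comment> \<open>The image measure moves the coupling to the type of sample points over which
    \<open>rate_distortion_L\<close> takes its infimum.\<close>
  define M where "M = distr ?N ?P ?Z"
  have f': "f b \<in> borel_measurable (cube_lborel L)" if "b \<in> B" for b
    using f[OF that] by (rule borel_measurable_cube_lborel)
  have C: "?C \<subseteq> L1_space L" using class_in_L1(1)[OF f'] by (auto simp: cls_def)
  have md: "mean_dist T L x (rep (cls b)) = mean_dist T L x (f b)" if "b \<in> B" for b x
    unfolding cls_def using that
    by (intro mean_dist_cong_AE class_in_L1(2) f' rep_L1(2) class_in_L1(1))
  have Z: "?Z \<in> measurable ?N ?P"
    unfolding measurable_cong_sets[OF sets_kernel_coupling refl]
    by (intro measurable_Pair measurable_compose[OF measurable_fst X] measurable_compose[OF measurable_snd]) auto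
  interpret M: prob_space M unfolding M_def by (rule N.prob_space_distr[OF Z])
  have fstM: "fst \<in> measurable M borel" and sndM: "snd \<in> measurable M (count_space ?C)"
    by (simp_all add: M_def)
  have Y: "snd \<in> measurable M (L1_borel L)"
    by (rule measurable_compose[OF sndM, of "\<lambda>x. x", simplified]) (use C in \<open>auto simp: space_L1_borel\<close>)
  have law: "distr M borel fst = distr \<Omega> borel X"
  proof (rule measure_eqI)
    fix A assume "A \<in> sets (distr M borel fst)"
    then have A: "A \<in> sets borel" by simp
    have [measurable]: "X -` A \<inter> space \<Omega> \<in> sets \<Omega>" using X A by (rule measurable_sets)
    have "distr M borel fst = distr ?N borel (fst \<circ> ?Z)"
      unfolding M_def by (rule distr_distr) (use Z in auto)
    also have "fst \<circ> ?Z = X \<circ> fst" by auto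
    finally have "emeasure (distr M borel fst) A = emeasure (distr ?N borel (X \<circ> fst)) A"
      by (simp add: comp_def)
    also have "\<dots> = emeasure ?N ((X -` A \<inter> space \<Omega>) \<times> B)"
    proof (subst emeasure_distr)
      show "X \<circ> fst \<in> borel_measurable ?N"
        unfolding measurable_cong_sets[OF sets_kernel_coupling refl]
        by (rule measurable_comp[OF measurable_fst X])
    qed (use A in \<open>auto simp: space_kernel_coupling intro!: arg_cong[where f = "emeasure ?N"]\<close>)
    also have "\<dots> = (\<integral>\<^sup>+p. indicator ((X -` A \<inter> space \<Omega>) \<times> B) p \<partial>?N)"
      by (intro nn_integral_indicator[symmetric]) (auto simp: sets_kernel_coupling)
    also have "\<dots> = (\<Sum>b\<in>B. \<integral>\<^sup>+\<omega>. ennreal (W b \<omega>) * indicator ((X -` A \<inter> space \<Omega>) \<times> B) (\<omega>, b) \<partial>\<Omega>)"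
      by (intro nn_integral_kernel_coupling K) (auto simp: indicator_times)
    also have "\<dots> = (\<Sum>b\<in>B. \<integral>\<^sup>+\<omega>. ennreal (W b \<omega>) * indicator (X -` A \<inter> space \<Omega>) \<omega> \<partial>\<Omega>)"
      by (simp add: indicator_times)
    also have "\<dots> = (\<integral>\<^sup>+\<omega>. (\<Sum>b\<in>B. ennreal (W b \<omega>) * indicator (X -` A \<inter> space \<Omega>) \<omega>) \<partial>\<Omega>)"
      using K(2) by (intro nn_integral_sum[symmetric]) simp
    also have "\<dots> = (\<integral>\<^sup>+\<omega>. indicator (X -` A \<inter> space \<Omega>) \<omega> \<partial>\<Omega>)"
      using K(3,4) by (intro nn_integral_cong) (simp add: sum_distrib_right[symmetric] sum_ennreal)
    also have "\<dots> = emeasure (distr \<Omega> borel X) A"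
      using X A by (simp add: emeasure_distr)
    finally show "emeasure (distr M borel fst) A = emeasure (distr \<Omega> borel X) A" .
  qed simp
  have "distortion T L M fst snd = (\<integral>\<^sup>+p. ennreal (mean_dist T L (fst p) (rep (snd p))) \<partial>M)"
    unfolding distortion_def
  proof (rule nn_integral_cong)
    fix p assume "p \<in> space M"
    then have "snd p \<in> L1_space L" using C by (auto simp: M_def space_pair_measure)
    then show "(\<integral>\<^sup>+u. ennreal (dist (T u (fst p)) (rep (snd p) u)) \<partial>cube_lborel L) / ennreal (L ^ CARD('n))
      = ennreal (mean_dist T L (fst p) (rep (snd p)))"
      by (intro ennreal_mean_dist rep_L1 L)
  qed
  also have "\<dots> = (\<integral>\<^sup>+p. ennreal (mean_dist T L (fst (?Z p)) (rep (snd (?Z p)))) \<partial>?N)"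
    unfolding M_def
  proof (rule nn_integral_distr[OF Z])
    show "(\<lambda>p. ennreal (mean_dist T L (fst p) (rep (snd p)))) \<in> borel_measurable (distr ?N ?P ?Z)"
      unfolding measurable_distr_eq1
    proof (rule measurable_pair_count_space_finite)
      fix c assume "c \<in> ?C"
      then have "c \<in> L1_space L" using C by blast
      then show "(\<lambda>x. ennreal (mean_dist T L (fst (x, c)) (rep (snd (x, c))))) \<in> borel_measurable borel"
        by (auto intro!: measurable_compose[OF mean_dist_measurable measurable_ennreal] rep_L1)
    qed (use K(1) in simp)
  qed
  also have "\<dots> = (\<Sum>b\<in>B. \<integral>\<^sup>+\<omega>. ennreal (W b \<omega>) * ennreal (mean_dist T L (X \<omega>) (rep (cls b))) \<partial>\<Omega>)"
  proof (subst nn_integral_kernel_coupling)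
    fix b assume "b \<in> B"
    then have "cls b \<in> L1_space L" using C by blast
    then show "(\<lambda>\<omega>. ennreal (mean_dist T L (fst (X (fst (\<omega>, b)), cls (snd (\<omega>, b)))) (rep (snd (X (fst (\<omega>, b)), cls (snd (\<omega>, b))))))) \<in> borel_measurable \<Omega>"
      by (auto intro!: measurable_compose[OF _ measurable_ennreal] measurable_compose[OF X mean_dist_measurable] rep_L1)
  qed (simp_all add: K(1,2))
  also have "\<dots> = (\<Sum>b\<in>B. \<integral>\<^sup>+\<omega>. ennreal (W b \<omega> * mean_dist T L (X \<omega>) (f b)) \<partial>\<Omega>)"
    using K(3) by (intro sum.cong refl nn_integral_cong) (simp add: md ennreal_mult' mean_dist_nonneg L)
  also have "\<dots> = (\<integral>\<^sup>+\<omega>. (\<Sum>b\<in>B. ennreal (W b \<omega> * mean_dist T L (X \<omega>) (f b))) \<partial>\<Omega>)"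
    by (intro nn_integral_sum[symmetric] measurable_compose[OF _ measurable_ennreal] borel_measurable_times K(2)
        measurable_compose[OF X mean_dist_measurable] f')
  also have "\<dots> = (\<integral>\<^sup>+\<omega>. ennreal (\<Sum>b\<in>B. W b \<omega> * mean_dist T L (X \<omega>) (f b)) \<partial>\<Omega>)"
    using K(3) by (intro nn_integral_cong sum_ennreal mult_nonneg_nonneg mean_dist_nonneg L) auto
  also have "\<dots> = ennreal (\<integral>\<omega>. (\<Sum>b\<in>B. W b \<omega> * mean_dist T L (X \<omega>) (f b)) \<partial>\<Omega>)"
    using kernel_mean_dist[OF k f' X L]
    by (intro nn_integral_eq_integral integrable_const_bound[where B = "diameter (UNIV :: 'a set)"] AE_I2) auto
  also have "\<dots> < ennreal \<epsilon>"
    using less kernel_mean_dist(2)[OF k f' X L] by (intro ennreal_lessI) (auto intro!: le_less_trans[OF _ less] integral_nonneg_AE AE_I2)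
  finally have dist: "distortion T L M fst snd < ennreal \<epsilon>" .
  have "mutual_info M borel fst (L1_borel L) snd \<le>
      ennreal (\<integral>\<omega>. (\<Sum>b\<in>B. W b \<omega> * log 2 (W b \<omega> / r b)) \<partial>\<Omega>)"
    unfolding mutual_info_def
  proof (rule SUP_least, clarify)
    fix \<alpha> :: "'a set set" and \<beta> :: "(real ^ 'n \<Rightarrow> 'a) set set set"
    assume \<alpha>: "finite_measurable_partition borel \<alpha>" and \<beta>: "finite_measurable_partition (L1_borel L) \<beta>"
    have fin: "finite \<alpha>" "finite \<beta>" using \<alpha> \<beta> by (auto simp: finite_measurable_partition_def)
    have c\<beta>: "cell \<beta> \<in> count_space ?C \<rightarrow>\<^sub>M count_space \<beta>"
      using measurable_space[OF measurable_cell[OF \<beta>]] C by (auto simp: space_L1_borel)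
    have "finite_mutual_info M \<alpha> (cell \<alpha> \<circ> fst) \<beta> (cell \<beta> \<circ> snd) =
      finite_mutual_info ?N \<alpha> ((cell \<alpha> \<circ> fst) \<circ> ?Z) \<beta> ((cell \<beta> \<circ> snd) \<circ> ?Z)"
      unfolding M_def
      by (rule finite_mutual_info_distr[OF Z _ _ fin N.prob_space_axioms])
        (auto intro!: measurable_comp[OF measurable_fst measurable_cell[OF \<alpha>]] measurable_comp[OF measurable_snd c\<beta>])
    also have "(cell \<alpha> \<circ> fst) \<circ> ?Z = (cell \<alpha> \<circ> X) \<circ> fst" by auto
    also have "(cell \<beta> \<circ> snd) \<circ> ?Z = (cell \<beta> \<circ> cls) \<circ> snd" by auto
    \<comment> \<open>Distinct labels may have the same class or the same cell. The bound tolerates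
      this, since it holds for every function of the label.\<close>
    also have "finite_mutual_info ?N \<alpha> ((cell \<alpha> \<circ> X) \<circ> fst) \<beta> ((cell \<beta> \<circ> cls) \<circ> snd)
      \<le> (\<integral>\<omega>. (\<Sum>b\<in>B. W b \<omega> * log 2 (W b \<omega> / r b)) \<partial>\<Omega>)"
    proof (intro finite_mutual_info_kernel_le K fin)
      show "cell \<alpha> \<circ> X \<in> \<Omega> \<rightarrow>\<^sub>M count_space \<alpha>" by (rule measurable_comp[OF X measurable_cell[OF \<alpha>]])
      show "cell \<beta> \<circ> cls \<in> B \<rightarrow> \<beta>" using measurable_space[OF c\<beta>] by auto
    qed (use prob_space_axioms in auto)
    finally show "ennreal (finite_mutual_info M \<alpha> (cell \<alpha> \<circ> fst) \<beta> (cell \<beta> \<circ> snd)) \<le>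
      ennreal (\<integral>\<omega>. (\<Sum>b\<in>B. W b \<omega> * log 2 (W b \<omega> / r b)) \<partial>\<Omega>)" by (rule ennreal_leI)
  qed
  moreover have "rate_distortion_L T (distr \<Omega> borel X) L \<epsilon> \<le> mutual_info M borel fst (L1_borel L) snd"
    unfolding rate_distortion_L_def
    by (rule Inf_lower, rule CollectI, intro exI[of _ M] exI[of _ fst] exI[of _ snd])
      (use fstM Y law dist M.prob_space_axioms in auto)
  ultimately show ?thesis by (rule order.trans[rotated])
qed

text \<open>The case in which the sample point is the source itself: \<open>\<Omega> = \<nu>\<close>
  with the identity as \<open>X\<close>.\<close>

lemma rate_distortion_L_le_code:
  assumes "prob_space \<nu>" "sets \<nu> = sets borel" "code T L d j" "0 < L" "(\<integral>x. d x \<partial>\<nu>) < \<epsilon>"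
  shows "rate_distortion_L T \<nu> L \<epsilon> \<le> ennreal (\<integral>x. j x \<partial>\<nu>)"
proof -
  obtain B :: "nat set" and f W r where B: "kernel_on borel B W r"
    and f: "\<And>b. b \<in> B \<Longrightarrow> f b \<in> borel_measurable borel"
    and d: "d = (\<lambda>x. \<Sum>b\<in>B. W b x * mean_dist T L x (f b))"
    and j: "j = (\<lambda>x. \<Sum>b\<in>B. W b x * log 2 (W b x / r b))"
    by (rule codeE[OF assms(3)]) blast
  have k: "kernel_on \<nu> B W r"
    using B measurable_cong_sets[OF assms(2) refl, of "borel :: real measure"] sets_eq_imp_space_eq[OF assms(2)]
    by (simp add: kernel_on_def)
  have id: "(\<lambda>x. x) \<in> borel_measurable \<nu>" using measurable_cong_sets[OF assms(2) refl, of "borel :: 'a measure"] by simp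
  have "distr \<nu> borel (\<lambda>x. x) = \<nu>" using distr_id2[OF assms(2)[symmetric]] by simp
  then show ?thesis
    using rate_distortion_L_le[OF assms(1) id k f assms(4) assms(5)[unfolded d]] by (simp add: j)
qed

end

section \<open>Quantising a coupling\<close>

lemma floor_divide_eq_imp_close:
  fixes x y e :: real
  assumes "0 < e" "\<lfloor>x / e\<rfloor> = \<lfloor>y / e\<rfloor>"
  shows "\<bar>x - y\<bar> \<le> e"
proof -
  have "\<bar>x / e - y / e\<bar> \<le> 1" using assms(2) by linarith
  then have "\<bar>x - y\<bar> / e \<le> 1" using assms(1) by (simp add: diff_divide_distrib[symmetric])
  then show ?thesis using assms(1) by (simp add: field_simps)
qed

context compact_action
begin

text \<open>
  The second variable is quantised by the level sets of its distances to the finitely many orbits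
  of the points \<open>pt A\<close>, so no compactness or separability of the space of maps is needed.
\<close>

lemma quantise_coupling:
  fixes M :: "'w measure" and e\<^sub>0 c \<eta> :: real
  assumes "prob_space M" and X: "X \<in> borel_measurable M" and Y: "Y \<in> measurable M (L1_borel L)"
    and L: "0 < L" and \<eta>: "0 < \<eta>" and \<alpha>: "finite_measurable_partition borel \<alpha>"
    and pt: "\<And>A. A \<in> \<alpha> \<Longrightarrow> pt A \<in> A"
    and osc: "\<And>A x y u. A \<in> \<alpha> \<Longrightarrow> x \<in> A \<Longrightarrow> y \<in> A \<Longrightarrow> u \<in> cube L \<Longrightarrow> dist (T u x) (T u y) \<le> \<eta>"
    and dist: "distortion T L M X Y \<le> ennreal e\<^sub>0" "0 \<le> e\<^sub>0"
    and MI: "mutual_info M borel X (L1_borel L) Y < ennreal c"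
  obtains d j where "code T L d j" "\<And>A x. A \<in> \<alpha> \<Longrightarrow> x \<in> A \<Longrightarrow> j x = j (pt A)"
    "\<And>A x. A \<in> \<alpha> \<Longrightarrow> x \<in> A \<Longrightarrow> d x \<le> d (pt A) + \<eta>"
    "(\<Sum>A\<in>\<alpha>. measure (distr M borel X) A * d (pt A)) \<le> e\<^sub>0 + 2 * \<eta>"
    "(\<Sum>A\<in>\<alpha>. measure (distr M borel X) A * j (pt A)) < c"
proof -
  interpret prob_space M by fact
  have \<alpha>fin: "finite \<alpha>" and \<alpha>p: "partition_on UNIV \<alpha>" and \<alpha>s: "\<alpha> \<subseteq> sets borel"
    using \<alpha> by (auto simp: finite_measurable_partition_def)
  define m where "m A F = mean_dist T L (pt A) (rep F)" for A F
  have m0: "0 \<le> m A F" for A F using L by (simp add: m_def mean_dist_nonneg)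
  have mK: "m A F \<le> diameter (UNIV :: 'a set)" if "F \<in> L1_space L" for A F
    unfolding m_def by (intro mean_dist_le_diameter L rep_L1 that)
  \<comment> \<open>Bins of width \<open>\<eta>\<close> for the distance to each sample orbit. The
    distances are bounded by the diameter, so only finitely many bins occur.\<close>
  define h where "h F = (\<lambda>A\<in>\<alpha>. \<lfloor>m A F / \<eta>\<rfloor>)" for F
  define I where "I = PiE \<alpha> (\<lambda>_. {0..\<lfloor>diameter (UNIV :: 'a set) / \<eta>\<rfloor>})"
  have Ifin: "finite I" unfolding I_def by (intro finite_PiE \<alpha>fin) auto
  have hI: "h F \<in> I" if "F \<in> L1_space L" for F
    using m0 mK[OF that] \<eta> by (auto simp: h_def I_def intro!: floor_mono divide_right_mono)
  have h_meas: "h \<in> measurable (L1_borel L) (count_space I)"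
  proof (subst measurable_count_space_eq2[OF Ifin], safe)
    fix g assume g: "g \<in> I"
    have "h -` {g} \<inter> space (L1_borel L) = {F \<in> space (L1_borel L). \<forall>A\<in>\<alpha>. \<lfloor>m A F / \<eta>\<rfloor> = g A}"
      using g by (auto simp: h_def I_def fun_eq_iff restrict_def PiE_iff extensional_def)
    also have "\<dots> \<in> sets (L1_borel L)"
    proof (rule sets.sets_Collect_finite_All[OF _ \<alpha>fin])
      fix A
      have "(\<lambda>F. m A F / \<eta>) \<in> borel_measurable (L1_borel L)"
        unfolding m_def by (intro borel_measurable_divide mean_dist_rep_measurable L) auto
      then have "(\<lambda>F. \<lfloor>m A F / \<eta>\<rfloor>) \<in> measurable (L1_borel L) (count_space UNIV)"
        by (rule measurable_compose[OF _ measurable_real_floor])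
      from measurable_sets[OF this, of "{g A}"]
      show "{F \<in> space (L1_borel L). \<lfloor>m A F / \<eta>\<rfloor> = g A} \<in> sets (L1_borel L)"
        by (simp add: vimage_def Int_def conj_commute)
    qed
    finally show "h -` {g} \<inter> space (L1_borel L) \<in> sets (L1_borel L)" .
  qed (use hI in \<open>simp add: space_L1_borel\<close>)
  define \<beta> where "\<beta> = (\<lambda>i. h -` {i} \<inter> space (L1_borel L)) ` (h ` space (L1_borel L))"
  have \<beta>: "finite_measurable_partition (L1_borel L) \<beta>"
    unfolding \<beta>_def by (rule finite_measurable_partition_fibres[OF h_meas Ifin])
  have \<beta>fin: "finite \<beta>" and \<beta>p: "partition_on (L1_space L) \<beta>"
    using \<beta> by (auto simp: finite_measurable_partition_def space_L1_borel)
  have close: "\<bar>m A F - m A G\<bar> \<le> \<eta>" if "b \<in> \<beta>" "F \<in> b" "G \<in> b" "A \<in> \<alpha>" for A F G b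
  proof -
    have "h F = h G" using that(1,2,3) unfolding \<beta>_def by auto
    then have "h F A = h G A" by simp
    then show ?thesis using that(4) \<eta> by (intro floor_divide_eq_imp_close) (auto simp: h_def)
  qed
  define F0 where "F0 b = (SOME F. F \<in> b)" for b :: "(real ^ 'n \<Rightarrow> 'a) set set"
  have F0: "F0 b \<in> b" "F0 b \<in> L1_space L" if "b \<in> \<beta>" for b
  proof -
    have "b \<noteq> {}" using partition_onD3[OF \<beta>p] that by blast
    then show "F0 b \<in> b" unfolding F0_def by (rule some_in_eq[THEN iffD2])
    then show "F0 b \<in> L1_space L" using partition_onD1[OF \<beta>p] that by blast
  qed
  define p where "p A b = prob {\<omega> \<in> space M. (cell \<alpha> \<circ> X) \<omega> = A \<and> (cell \<beta> \<circ> Y) \<omega> = b}" for A b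
  define \<nu> where "\<nu> A = (\<Sum>b\<in>\<beta>. p A b)" for A
  define q where "q b = (\<Sum>A\<in>\<alpha>. p A b)" for b
  have mX: "cell \<alpha> \<circ> X \<in> measurable M (count_space \<alpha>)" by (rule measurable_comp[OF X measurable_cell[OF \<alpha>]])
  have mY: "cell \<beta> \<circ> Y \<in> measurable M (count_space \<beta>)" by (rule measurable_comp[OF Y measurable_cell[OF \<beta>]])
  note fmi = finite_mutual_info_eq[OF prob_space_axioms \<alpha>fin \<beta>fin mX mY, folded p_def, folded \<nu>_def q_def]
  have p0: "0 \<le> p A b" for A b by (simp add: p_def)
  have \<nu>0: "0 \<le> \<nu> A" and q0: "0 \<le> q b" for A b using p0 by (auto simp: \<nu>_def q_def intro: sum_nonneg)
  have p_le: "p A b \<le> \<nu> A" "p A b \<le> q b" if "A \<in> \<alpha>" "b \<in> \<beta>" for A b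
    unfolding \<nu>_def q_def
    using that p0 \<alpha>fin \<beta>fin by (auto intro: member_le_sum[of _ _ "\<lambda>b. p A b"] member_le_sum[of _ _ "\<lambda>A. p A b"])
  have law: "measure (distr M borel X) A = \<nu> A" if A: "A \<in> \<alpha>" for A
  proof -
    have "measure (distr M borel X) A = prob (X -` A \<inter> space M)"
      using A \<alpha>s X by (intro measure_distr) auto
    also have "X -` A \<inter> space M = {\<omega> \<in> space M. (cell \<alpha> \<circ> X) \<omega> = A}"
    proof (intro equalityI subsetI)
      fix \<omega> assume "\<omega> \<in> X -` A \<inter> space M"
      then show "\<omega> \<in> {\<omega> \<in> space M. (cell \<alpha> \<circ> X) \<omega> = A}" using cell_eq[OF \<alpha>p A, of "X \<omega>"] by simp
    next
      fix \<omega> assume "\<omega> \<in> {\<omega> \<in> space M. (cell \<alpha> \<circ> X) \<omega> = A}"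
      then show "\<omega> \<in> X -` A \<inter> space M" using cell_in(2)[OF \<alpha>p, of "X \<omega>"] by simp
    qed
    finally show ?thesis using fmi(2)[OF A] by simp
  qed
  have sum_\<nu>: "(\<Sum>A\<in>\<alpha>. \<nu> A) = 1"
  proof -
    have "(\<Sum>A\<in>\<alpha>. \<nu> A) = (\<Sum>A\<in>\<alpha>. prob {\<omega> \<in> space M. (cell \<alpha> \<circ> X) \<omega> = A})" using fmi(2) by simp
    also have "\<dots> = 1" by (rule sum_fibre_prob[OF prob_space_axioms \<alpha>fin mX])
    finally show ?thesis .
  qed
  \<comment> \<open>Cells of probability zero are dropped, because \<open>q\<close> serves as the
    reference and has to be positive on all labels.\<close>
  define B where "B = {b \<in> \<beta>. 0 < q b}"
  have Bfin: "finite B" and B\<beta>: "B \<subseteq> \<beta>" using \<beta>fin by (auto simp: B_def)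
  have pB: "p A b = 0" if "A \<in> \<alpha>" "b \<in> \<beta> - B" for A b
    using that p_le(2)[of A b] p0[of A b] by (auto simp: B_def)
  have \<nu>B: "(\<Sum>b\<in>B. p A b) = \<nu> A" if "A \<in> \<alpha>" for A
    unfolding \<nu>_def using pB[OF that] B\<beta> \<beta>fin by (intro sum.mono_neutral_left) auto
  have qsum: "(\<Sum>b\<in>B. q b) = 1"
  proof -
    have "(\<Sum>b\<in>B. q b) = (\<Sum>b\<in>\<beta>. q b)"
      using q0 B\<beta> \<beta>fin by (intro sum.mono_neutral_left) (auto simp: B_def less_le)
    also have "\<dots> = (\<Sum>A\<in>\<alpha>. \<nu> A)" unfolding q_def \<nu>_def by (rule sum.swap)
    finally show ?thesis by (simp add: sum_\<nu>)
  qed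
  then have "B \<noteq> {}" by auto
  then obtain b0 where b0: "b0 \<in> B" by blast
  \<comment> \<open>The conditional probability of \<open>b\<close> given \<open>A\<close>. On cells
    of probability zero a point mass at \<open>b0\<close> keeps the kernel stochastic without
    changing any average.\<close>
  define V where "V A b = (if \<nu> A = 0 then (if b = b0 then 1 else 0) else p A b / \<nu> A)" for A b
  define W where "W b x = V (cell \<alpha> x) b" for b x
  have Vsum: "(\<Sum>b\<in>B. V A b) = 1" if "A \<in> \<alpha>" for A
    using \<nu>B[OF that] b0 Bfin by (cases "\<nu> A = 0") (auto simp: V_def sum_divide_distrib[symmetric])
  have V0: "0 \<le> V A b" for A b using p0 \<nu>0 by (simp add: V_def)
  have kernel: "kernel_on borel B W q"
    unfolding kernel_on_def
  proof (intro conjI ballI Bfin)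
    fix b
    have "V' \<in> measurable (count_space \<alpha>) borel" for V' :: "'a set \<Rightarrow> real" by simp
    then show "W b \<in> borel_measurable borel"
      unfolding W_def by (rule measurable_compose[OF measurable_cell[OF \<alpha>]])
  qed (use V0 Vsum cell_in(1)[OF \<alpha>p] qsum in \<open>auto simp: W_def B_def\<close>)
  \<comment> \<open>A representative is measurable on the cube only; a constant value outside makes
    it a Borel map on the whole space, as \<open>code\<close> demands.\<close>
  define f where "f b u = (if u \<in> cube L then rep (F0 b) u else undefined)" for b u
  have f: "f b \<in> borel_measurable borel" if "b \<in> B" for b
  proof -
    have "rep (F0 b) \<in> borel_measurable (restrict_space borel (cube L))"
      using rep_L1(2)[OF F0(2)] that B\<beta>
      by (auto simp: cube_lborel_def cong: measurable_cong_sets restrict_space_sets_cong)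
    then show ?thesis unfolding f_def
      by (subst (asm) measurable_restrict_space_iff[of _ _ undefined]) (auto simp: cube_measurable)
  qed
  have mf: "mean_dist T L x (f b) = mean_dist T L x (rep (F0 b))" for x b
    unfolding mean_dist_def by (intro arg_cong2[where f = "(/)"] Bochner_Integration.integral_cong refl) (auto simp: f_def)
  let ?d = "\<lambda>x. \<Sum>b\<in>B. W b x * mean_dist T L x (f b)"
  let ?j = "\<lambda>x. \<Sum>b\<in>B. W b x * log 2 (W b x / q b)"
  have Wc: "W b x = V A b" if "A \<in> \<alpha>" "x \<in> A" for b x A
    using cell_eq[OF \<alpha>p that] by (simp add: W_def)
  have \<nu>V: "\<nu> A * V A b = p A b" if "A \<in> \<alpha>" "b \<in> \<beta>" for A b
    using p_le(1)[OF that] p0[of A b] by (auto simp: V_def)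
  show thesis
  proof (rule that[of ?d ?j])
    show "code T L ?d ?j" by (intro codeI kernel f)
    fix A x assume A: "A \<in> \<alpha>" and x: "x \<in> A"
    show "?j x = ?j (pt A)" by (simp add: Wc[OF A x] Wc[OF A pt[OF A]])
    have "?d x \<le> (\<Sum>b\<in>B. V A b * (mean_dist T L (pt A) (f b) + \<eta>))"
      unfolding Wc[OF A x] using \<eta>
      by (intro sum_mono mult_left_mono V0 mean_dist_lipschitz L borel_measurable_cube_lborel f osc[OF A x pt[OF A]]) auto
    also have "\<dots> = ?d (pt A) + \<eta> * (\<Sum>b\<in>B. V A b)"
      by (simp add: Wc[OF A pt[OF A]] sum.distrib algebra_simps sum_distrib_left)
    finally show "?d x \<le> ?d (pt A) + \<eta>" using Vsum[OF A] by simp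
  next
    \<comment> \<open>With the true label law \<open>q\<close> as reference the information of the
      code equals the mutual information of the quantised pair, one of the numbers over which
      \<open>mutual_info\<close> takes its supremum.\<close>
    have "(\<Sum>A\<in>\<alpha>. measure (distr M borel X) A * ?j (pt A)) = (\<Sum>A\<in>\<alpha>. \<Sum>b\<in>B. p A b * log 2 (p A b / (\<nu> A * q b)))"
    proof (intro sum.cong refl)
      fix A assume A: "A \<in> \<alpha>"
      have "\<nu> A * ?j (pt A) = (\<Sum>b\<in>B. (\<nu> A * V A b) * log 2 (V A b / q b))"
        by (simp add: Wc[OF A pt[OF A]] sum_distrib_left mult.assoc)
      also have "\<dots> = (\<Sum>b\<in>B. p A b * log 2 (p A b / (\<nu> A * q b)))"
      proof (intro sum.cong refl)
        fix b assume b: "b \<in> B"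
        then have b\<beta>: "b \<in> \<beta>" using B\<beta> by blast
        show "\<nu> A * V A b * log 2 (V A b / q b) = p A b * log 2 (p A b / (\<nu> A * q b))"
        proof (cases "\<nu> A = 0")
          case True
          then have "p A b = 0" using p_le(1)[OF A b\<beta>] p0[of A b] by simp
          then show ?thesis using True by simp
        next
          case False
          then show ?thesis by (simp add: V_def)
        qed
      qed
      finally show "measure (distr M borel X) A * ?j (pt A) = (\<Sum>b\<in>B. p A b * log 2 (p A b / (\<nu> A * q b)))"
        by (simp add: law[OF A])
    qed
    also have "\<dots> = (\<Sum>A\<in>\<alpha>. \<Sum>b\<in>\<beta>. p A b * log 2 (p A b / (\<nu> A * q b)))"
      using pB B\<beta> \<beta>fin by (intro sum.cong sum.mono_neutral_left) auto
    also have "\<dots> = finite_mutual_info M \<alpha> (cell \<alpha> \<circ> X) \<beta> (cell \<beta> \<circ> Y)" by (rule fmi(1)[symmetric])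
    also have "\<dots> < c"
    proof -
      have "ennreal (finite_mutual_info M \<alpha> (cell \<alpha> \<circ> X) \<beta> (cell \<beta> \<circ> Y)) \<le> mutual_info M borel X (L1_borel L) Y"
        unfolding mutual_info_def by (rule SUP_upper2[of "(\<alpha>, \<beta>)"]) (use \<alpha> \<beta> in auto)
      then have "ennreal (finite_mutual_info M \<alpha> (cell \<alpha> \<circ> X) \<beta> (cell \<beta> \<circ> Y)) < ennreal c"
        using MI by (rule le_less_trans)
      then show ?thesis by (meson ennreal_leI not_less)
    qed
    finally show "(\<Sum>A\<in>\<alpha>. measure (distr M borel X) A * ?j (pt A)) < c" .
  next
    \<comment> \<open>The integrand of the distortion is not known to be measurable, so its integral need not be
      additive; \<open>s\<close> is a measurable lower bound up to \<open>2 * \<eta>\<close>.\<close>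
    define s where "s \<omega> = m ((cell \<alpha> \<circ> X) \<omega>) (F0 ((cell \<beta> \<circ> Y) \<omega>))" for \<omega>
    have s_eq: "s \<omega> = (\<Sum>A\<in>\<alpha>. \<Sum>b\<in>\<beta>. m A (F0 b) *
      indicator {\<omega> \<in> space M. (cell \<alpha> \<circ> X) \<omega> = A \<and> (cell \<beta> \<circ> Y) \<omega> = b} \<omega>)" if \<omega>: "\<omega> \<in> space M" for \<omega>
    proof -
      let ?A = "(cell \<alpha> \<circ> X) \<omega>" and ?b = "(cell \<beta> \<circ> Y) \<omega>"
      have in_parts: "?A \<in> \<alpha>" "?b \<in> \<beta>" using measurable_space[OF mX \<omega>] measurable_space[OF mY \<omega>] by auto
      have "(\<Sum>A\<in>\<alpha>. \<Sum>b\<in>\<beta>. m A (F0 b) *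
          indicator {\<omega> \<in> space M. (cell \<alpha> \<circ> X) \<omega> = A \<and> (cell \<beta> \<circ> Y) \<omega> = b} \<omega>) =
        (\<Sum>A\<in>\<alpha>. \<Sum>b\<in>\<beta>. if A = ?A then (if b = ?b then m A (F0 b) else 0) else 0)"
        using \<omega> by (intro sum.cong refl) auto
      also have "\<dots> = (\<Sum>A\<in>\<alpha>. if A = ?A then (\<Sum>b\<in>\<beta>. if b = ?b then m A (F0 b) else 0) else 0)"
        by (intro sum.cong refl) auto
      also have "\<dots> = m ?A (F0 ?b)" using in_parts \<alpha>fin \<beta>fin by simp
      finally show ?thesis by (simp add: s_def)
    qed
    have s_int: "has_bochner_integral M s (\<Sum>A\<in>\<alpha>. \<Sum>b\<in>\<beta>. m A (F0 b) * p A b)"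
    proof -
      have "has_bochner_integral M (\<lambda>\<omega>. \<Sum>A\<in>\<alpha>. \<Sum>b\<in>\<beta>. m A (F0 b) *
          indicator {\<omega> \<in> space M. (cell \<alpha> \<circ> X) \<omega> = A \<and> (cell \<beta> \<circ> Y) \<omega> = b} \<omega>)
          (\<Sum>A\<in>\<alpha>. \<Sum>b\<in>\<beta>. m A (F0 b) * p A b)"
        unfolding p_def
        by (intro has_bochner_integral_sum has_bochner_integral_mult_right has_bochner_integral_real_indicator fibre_pair_measurable[OF mX mY])
          (auto simp: emeasure_eq_measure)
      then show ?thesis
        by (subst has_bochner_integral_cong[OF refl s_eq refl]) auto
    qed
    have int: "integrable M s" and s_val: "integral\<^sup>L M s = (\<Sum>A\<in>\<alpha>. \<Sum>b\<in>\<beta>. m A (F0 b) * p A b)"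
      using s_int by (auto simp: has_bochner_integral_iff)
    \<comment> \<open>One \<open>\<eta>\<close> comes from replacing \<open>Y \<omega>\<close> by
      the representative of its bin, the other from moving \<open>X \<omega>\<close> to the sample
      point of its cell.\<close>
    have pointwise: "ennreal (s \<omega> - 2 * \<eta>) \<le>
        (\<integral>\<^sup>+u. ennreal (dist (T u (X \<omega>)) (rep (Y \<omega>) u)) \<partial>cube_lborel L) / ennreal (L ^ CARD('n))" if \<omega>: "\<omega> \<in> space M" for \<omega>
    proof -
      let ?A = "cell \<alpha> (X \<omega>)" and ?b = "cell \<beta> (Y \<omega>)"
      have Y\<omega>: "Y \<omega> \<in> L1_space L" using measurable_space[OF Y \<omega>] by (simp add: space_L1_borel)
      have A: "?A \<in> \<alpha>" "X \<omega> \<in> ?A" by (auto intro: cell_in[OF \<alpha>p])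
      have b: "?b \<in> \<beta>" "Y \<omega> \<in> ?b" using cell_in[OF \<beta>p Y\<omega>] by auto
      have "s \<omega> \<le> m ?A (Y \<omega>) + \<eta>" using close[OF b(1) F0(1)[OF b(1)] b(2) A(1)] by (simp add: s_def)
      also have "m ?A (Y \<omega>) \<le> mean_dist T L (X \<omega>) (rep (Y \<omega>)) + \<eta>"
        unfolding m_def using \<eta> by (intro mean_dist_lipschitz L rep_L1 Y\<omega> osc[OF A(1) pt[OF A(1)] A(2)]) auto
      finally have "s \<omega> - 2 * \<eta> \<le> mean_dist T L (X \<omega>) (rep (Y \<omega>))" by simp
      then show ?thesis by (subst ennreal_mean_dist[OF L rep_L1(2)[OF Y\<omega>]]) (rule ennreal_leI)
    qed
    \<comment> \<open>Truncation at zero matches the behaviour of \<open>ennreal\<close> on negative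
      numbers and can only raise the integral of the lower bound.\<close>
    have "ennreal (\<integral>\<omega>. max 0 (s \<omega> - 2 * \<eta>) \<partial>M) = (\<integral>\<^sup>+\<omega>. ennreal (max 0 (s \<omega> - 2 * \<eta>)) \<partial>M)"
      using int by (intro nn_integral_eq_integral[symmetric]) auto
    also have "\<dots> \<le> distortion T L M X Y"
      unfolding distortion_def by (intro nn_integral_mono) (use pointwise in \<open>simp add: ennreal_max_0\<close>)
    also have "\<dots> \<le> ennreal e\<^sub>0" by (rule dist(1))
    finally have "(\<integral>\<omega>. max 0 (s \<omega> - 2 * \<eta>) \<partial>M) \<le> e\<^sub>0" using dist(2) by (simp add: ennreal_le_iff)
    moreover have "(\<integral>\<omega>. s \<omega> - 2 * \<eta> \<partial>M) \<le> (\<integral>\<omega>. max 0 (s \<omega> - 2 * \<eta>) \<partial>M)"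
      using int by (intro integral_mono) auto
    moreover have "(\<integral>\<omega>. s \<omega> - 2 * \<eta> \<partial>M) = integral\<^sup>L M s - 2 * \<eta>" using int by (simp add: prob_space)
    ultimately have "integral\<^sup>L M s \<le> e\<^sub>0 + 2 * \<eta>" by simp
    moreover have "(\<Sum>A\<in>\<alpha>. measure (distr M borel X) A * ?d (pt A)) \<le> (\<Sum>A\<in>\<alpha>. \<Sum>b\<in>\<beta>. m A (F0 b) * p A b)"
    proof (intro sum_mono)
      fix A assume A: "A \<in> \<alpha>"
      have "measure (distr M borel X) A * ?d (pt A) = (\<Sum>b\<in>B. (\<nu> A * V A b) * m A (F0 b))"
        by (simp add: law[OF A] Wc[OF A pt[OF A]] sum_distrib_left mult.assoc mf m_def)
      also have "\<dots> = (\<Sum>b\<in>B. m A (F0 b) * p A b)"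
        using \<nu>V[OF A] B\<beta> by (intro sum.cong) auto
      also have "\<dots> \<le> (\<Sum>b\<in>\<beta>. m A (F0 b) * p A b)"
        using m0 p0 B\<beta> \<beta>fin by (intro sum_mono2) auto
      finally show "measure (distr M borel X) A * ?d (pt A) \<le> (\<Sum>b\<in>\<beta>. m A (F0 b) * p A b)" .
    qed
    ultimately show "(\<Sum>A\<in>\<alpha>. measure (distr M borel X) A * ?d (pt A)) \<le> e\<^sub>0 + 2 * \<eta>"
      by (simp add: s_val)
  qed
qed

end

section \<open>Reduction to countably many codes\<close>

lemma partition_measure_sum:
  assumes "prob_space \<nu>" "finite_measurable_partition \<nu> \<alpha>"
  shows "(\<Sum>A\<in>\<alpha>. measure \<nu> A) = 1"
proof -
  interpret prob_space \<nu> by fact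
  have p: "finite \<alpha>" "\<alpha> \<subseteq> sets \<nu>" "partition_on (space \<nu>) \<alpha>"
    using assms(2) by (auto simp: finite_measurable_partition_def)
  have "prob (\<Union>A\<in>\<alpha>. A) = (\<Sum>A\<in>\<alpha>. prob A)"
    using p partition_onD2[OF p(3)]
    by (intro finite_measure_finite_Union) (auto simp: disjoint_family_on_def disjoint_def)
  moreover have "(\<Union>A\<in>\<alpha>. A) = space \<nu>" using partition_onD1[OF p(3)] by simp
  ultimately show ?thesis by (simp add: prob_space)
qed

lemma integral_le_partition_sum:
  fixes g :: "'a \<Rightarrow> real"
  assumes "prob_space \<nu>" "finite_measurable_partition \<nu> \<alpha>" "integrable \<nu> g"
    and "\<And>A x. A \<in> \<alpha> \<Longrightarrow> x \<in> A \<Longrightarrow> g x \<le> c A"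
  shows "(\<integral>x. g x \<partial>\<nu>) \<le> (\<Sum>A\<in>\<alpha>. measure \<nu> A * c A)"
proof -
  interpret prob_space \<nu> by fact
  have p: "finite \<alpha>" "\<alpha> \<subseteq> sets \<nu>" "partition_on (space \<nu>) \<alpha>"
    using assms(2) by (auto simp: finite_measurable_partition_def)
  have s: "has_bochner_integral \<nu> (\<lambda>x. \<Sum>A\<in>\<alpha>. c A * indicator A x) (\<Sum>A\<in>\<alpha>. c A * measure \<nu> A)"
    using p(2) by (intro has_bochner_integral_sum has_bochner_integral_mult_right has_bochner_integral_real_indicator)
      (auto simp: emeasure_eq_measure)
  have "(\<integral>x. g x \<partial>\<nu>) \<le> (\<integral>x. (\<Sum>A\<in>\<alpha>. c A * indicator A x) \<partial>\<nu>)"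
  proof (intro integral_mono assms(3))
    show "integrable \<nu> (\<lambda>x. \<Sum>A\<in>\<alpha>. c A * indicator A x)" using s by (simp add: has_bochner_integral_iff)
    fix x assume x: "x \<in> space \<nu>"
    have "(\<Sum>A\<in>\<alpha>. c A * indicator A x) = (\<Sum>A\<in>\<alpha>. if A = cell \<alpha> x then c A else 0)"
    proof (intro sum.cong refl)
      fix A assume A: "A \<in> \<alpha>"
      show "c A * indicator A x = (if A = cell \<alpha> x then c A else 0)"
        using cell_eq[OF p(3) A, of x] cell_in(2)[OF p(3) x] by (cases "x \<in> A") auto
    qed
    also have "\<dots> = c (cell \<alpha> x)" using cell_in[OF p(3) x] p(1) by simp
    finally show "g x \<le> (\<Sum>A\<in>\<alpha>. c A * indicator A x)"
      using assms(4) cell_in[OF p(3) x] by simp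
  qed
  also have "\<dots> = (\<Sum>A\<in>\<alpha>. c A * measure \<nu> A)" using s by (simp add: has_bochner_integral_iff)
  finally show ?thesis by (simp add: mult.commute)
qed

text \<open>Pairs of functions are mapped to their vectors of values on \<open>P\<close>. These live
  in the second countable space of sequences in the plane, so the image has a countable dense
  subset, which is lifted back. Using sequences gives one ambient type for all sizes of
  \<open>P\<close>; only the coordinates that enumerate \<open>P\<close> are compared.\<close>

lemma countable_dense_on_finite:
  fixes \<S> :: "(('a \<Rightarrow> real) \<times> ('a \<Rightarrow> real)) set"
  assumes "finite P"
  obtains \<D> where "countable \<D>" "\<D> \<subseteq> \<S>"
    "\<And>d j e. (d, j) \<in> \<S> \<Longrightarrow> 0 < e \<Longrightarrow> \<exists>(d', j')\<in>\<D>. \<forall>x\<in>P. \<bar>d' x - d x\<bar> < e \<and> \<bar>j' x - j x\<bar> < e"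
proof -
  obtain xs where xs: "set xs = P" using finite_list[OF assms] by auto
  define \<Phi> :: "('a \<Rightarrow> real) \<times> ('a \<Rightarrow> real) \<Rightarrow> nat \<Rightarrow> real \<times> real"
    where "\<Phi> s i = (fst s (xs ! i), snd s (xs ! i))" for s i
  obtain U where U: "countable U" "U \<subseteq> \<Phi> ` \<S>" "\<Phi> ` \<S> \<subseteq> closure U" by (rule separable)
  then obtain \<D> where \<D>: "countable \<D>" "\<D> \<subseteq> \<S>" "U = \<Phi> ` \<D>"
    by (meson countable_subset_image)
  show thesis
  proof (rule that[OF \<D>(1,2)])
    fix d j and e :: real assume s: "(d, j) \<in> \<S>" and e: "0 < e"
    then have "\<Phi> (d, j) \<in> closure U" using U(3) by blast
    then obtain w where w: "\<And>n. w n \<in> U" "w \<longlonglongrightarrow> \<Phi> (d, j)" by (auto simp: closure_sequential)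
    have "(\<lambda>n. w n i) \<longlonglongrightarrow> \<Phi> (d, j) i" for i
      by (rule continuous_on_tendsto_compose[OF continuous_on_product_coordinates w(2)]) auto
    then have "\<forall>\<^sub>F n in sequentially. dist (w n i) (\<Phi> (d, j) i) < e" for i
      using e by (rule tendstoD)
    then have "\<forall>\<^sub>F n in sequentially. \<forall>i\<in>{..<length xs}. dist (w n i) (\<Phi> (d, j) i) < e"
      by (intro eventually_ball_finite) auto
    then obtain n where n: "\<And>i. i < length xs \<Longrightarrow> dist (w n i) (\<Phi> (d, j) i) < e"
      by (auto simp: eventually_sequentially)
    obtain d' j' where w': "(d', j') \<in> \<D>" "w n = \<Phi> (d', j')" using w(1)[of n] \<D>(3) by auto
    have "\<bar>d' x - d x\<bar> < e \<and> \<bar>j' x - j x\<bar> < e" if x: "x \<in> P" for x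
    proof -
      obtain i where i: "i < length xs" "xs ! i = x" using x xs by (metis in_set_conv_nth)
      have "dist (d' x, j' x) (d x, j x) < e" using n[OF i(1)] w'(2) i(2) by (simp add: \<Phi>_def)
      moreover have "dist (d' x) (d x) \<le> dist (d' x, j' x) (d x, j x)" "dist (j' x) (j x) \<le> dist (d' x, j' x) (d x, j x)"
        using dist_fst_le[of "(d' x, j' x)" "(d x, j x)"] dist_snd_le[of "(d' x, j' x)" "(d x, j x)"] by auto
      ultimately show ?thesis by (auto simp: dist_real_def)
    qed
    then show "\<exists>(d', j')\<in>\<D>. \<forall>x\<in>P. \<bar>d' x - d x\<bar> < e \<and> \<bar>j' x - j x\<bar> < e" using w'(1) by blast
  qed
qed

context compact_action
begin

lemma code_integrable:
  assumes "code T L d j" "0 < L" "prob_space \<nu>" "sets \<nu> = sets borel"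
  shows "integrable \<nu> d" "integrable \<nu> j"
proof -
  interpret prob_space \<nu> by fact
  note c = codeD[OF assms(1,2)]
  have m: "d \<in> borel_measurable \<nu>" "j \<in> borel_measurable \<nu>"
    using c(1,4) measurable_cong_sets[OF assms(4) refl, of "borel :: real measure"] by auto
  show "integrable \<nu> d" using m c(2,3) by (intro integrable_const_bound AE_I2) auto
  obtain b where "\<And>x. j x \<le> b" using c(6) by blast
  then show "integrable \<nu> j" using m c(5) by (intro integrable_const_bound[where B = b] AE_I2) auto
qed

text \<open>
  For codes that are constant on the cells of a fixed partition, up to a small error in \<open>d\<close>, only
  the values of \<open>d\<close> and \<open>j\<close> at one point of each cell matter; a countable dense set of these vectors
  suffices.
\<close>

lemma countable_codes:
  assumes L: "0 < L"
  obtains \<C> where "countable \<C>" "\<And>d j. (d, j) \<in> \<C> \<Longrightarrow> code T L d j"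
    "\<And>\<nu> \<epsilon> c. prob_space \<nu> \<Longrightarrow> sets \<nu> = sets borel \<Longrightarrow> rate_distortion_L T \<nu> L \<epsilon> < ennreal c \<Longrightarrow>
      \<exists>(d, j)\<in>\<C>. (\<integral>x. d x \<partial>\<nu>) < \<epsilon> \<and> (\<integral>x. j x \<partial>\<nu>) < c"
proof -
  define good where "good n \<alpha> pt \<longleftrightarrow> finite_measurable_partition borel \<alpha> \<and> (\<forall>A\<in>\<alpha>. pt A \<in> A) \<and>
     (\<forall>A\<in>\<alpha>. \<forall>x\<in>A. \<forall>y\<in>A. \<forall>u\<in>cube L. dist (T u x) (T u y) \<le> inverse (real (Suc n)))" for n \<alpha> pt
  have "\<exists>\<alpha> pt. good n \<alpha> pt" for n
  proof -
    obtain \<delta> where \<delta>: "0 < \<delta>" "\<And>x y u. dist x y < \<delta> \<Longrightarrow> u \<in> cube L \<Longrightarrow> dist (T u x) (T u y) < inverse (real (Suc n))"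
      using T_equicontinuous[of "inverse (real (Suc n))"] by (metis inverse_Suc of_nat_Suc)
    obtain \<alpha> :: "'a set set" where \<alpha>: "finite_measurable_partition borel \<alpha>"
      "\<And>A x y. A \<in> \<alpha> \<Longrightarrow> x \<in> A \<Longrightarrow> y \<in> A \<Longrightarrow> dist x y < \<delta>" by (rule fine_partition[OF \<delta>(1)]) blast
    have "{} \<notin> \<alpha>" using \<alpha>(1) partition_onD3[of "space borel" \<alpha>]
      unfolding finite_measurable_partition_def by blast
    then have "\<forall>A\<in>\<alpha>. \<exists>x. x \<in> A" by (metis equals0I)
    then obtain pt where "\<forall>A\<in>\<alpha>. pt A \<in> A" by metis
    then have "good n \<alpha> pt" unfolding good_def using \<alpha> \<delta>(2) by (auto intro!: less_imp_le)
    then show ?thesis by blast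
  qed
  then obtain \<alpha> pt where good: "\<And>n. good n (\<alpha> n) (pt n)" by metis
  \<comment> \<open>The first conclusions of \<open>quantise_coupling\<close>, stated without any
    measure: for such codes the values at the points \<open>pt n A\<close> control the integrals for
    every \<open>\<nu>\<close>.\<close>
  define \<S> where "\<S> n = {(d, j). code T L d j \<and> (\<forall>A\<in>\<alpha> n. \<forall>x\<in>A. j x = j (pt n A)) \<and>
    (\<forall>A\<in>\<alpha> n. \<forall>x\<in>A. d x \<le> d (pt n A) + inverse (real (Suc n)))}" for n
  define net where "net n \<D> \<longleftrightarrow> countable \<D> \<and> \<D> \<subseteq> \<S> n \<and> (\<forall>d j e. 0 < e \<longrightarrow> (d, j) \<in> \<S> n \<longrightarrow>
    (\<exists>(d', j')\<in>\<D>. \<forall>x\<in>pt n ` \<alpha> n. \<bar>d' x - d x\<bar> < e \<and> \<bar>j' x - j x\<bar> < e))" for n \<D>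
  have "\<exists>\<D>. net n \<D>" for n
  proof -
    have "finite (pt n ` \<alpha> n)" using good[of n] by (auto simp: good_def finite_measurable_partition_def)
    then show ?thesis
    proof (rule countable_dense_on_finite[of _ "\<S> n"])
      fix \<D> assume "countable \<D>" "\<D> \<subseteq> \<S> n"
        "\<And>d j e. (d, j) \<in> \<S> n \<Longrightarrow> 0 < e \<Longrightarrow> \<exists>(d', j')\<in>\<D>. \<forall>x\<in>pt n ` \<alpha> n. \<bar>d' x - d x\<bar> < e \<and> \<bar>j' x - j x\<bar> < e"
      then have "net n \<D>" unfolding net_def by (intro conjI allI impI)
      then show "\<exists>\<D>. net n \<D>" by (rule exI)
    qed
  qed
  then obtain \<D> where net: "\<And>n. net n (\<D> n)" by metis
  have \<D>: "countable (\<D> n)" "\<D> n \<subseteq> \<S> n"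
    "0 < e \<Longrightarrow> (d, j) \<in> \<S> n \<Longrightarrow> \<exists>(d', j')\<in>\<D> n. \<forall>x\<in>pt n ` \<alpha> n. \<bar>d' x - d x\<bar> < e \<and> \<bar>j' x - j x\<bar> < e" for n d j e
    by (rule net[of n, unfolded net_def, THEN conjunct1]
        net[of n, unfolded net_def, THEN conjunct2, THEN conjunct1]
        net[of n, unfolded net_def, THEN conjunct2, THEN conjunct2, rule_format]; assumption?)+
  show thesis
  proof (rule that[of "\<Union>n. \<D> n"])
    show "countable (\<Union>n. \<D> n)" using \<D>(1) by auto
    show "code T L d j" if "(d, j) \<in> (\<Union>n. \<D> n)" for d j using that \<D>(2) by (auto simp: \<S>_def)
    fix \<nu> :: "'a measure" and \<epsilon> c assume \<nu>: "prob_space \<nu>" "sets \<nu> = sets borel" and rate: "rate_distortion_L T \<nu> L \<epsilon> < ennreal c"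
    interpret \<nu>: prob_space \<nu> by fact
    obtain M :: "('a \<times> (real ^ 'n \<Rightarrow> 'a) set) measure" and X Y where M: "prob_space M" "X \<in> borel_measurable M" "distr M borel X = \<nu>"
      "Y \<in> measurable M (L1_borel L)" "distortion T L M X Y < ennreal \<epsilon>" "mutual_info M borel X (L1_borel L) Y < ennreal c"
      using rate unfolding rate_distortion_L_def Inf_less_iff by blast
    define e\<^sub>0 where "e\<^sub>0 = enn2real (distortion T L M X Y)"
    have e0: "distortion T L M X Y = ennreal e\<^sub>0" "0 \<le> e\<^sub>0"
      using order.strict_trans[OF M(5) ennreal_less_top] by (simp_all add: e\<^sub>0_def)
    have "e\<^sub>0 < \<epsilon>" using M(5) unfolding e0(1) using e0(2) by (metis ennreal_leI not_less)
    then have "0 < (\<epsilon> - e\<^sub>0) / 4" by simp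
    \<comment> \<open>The slack is split into four parts: two for the quantisation of the coupling,
      one for the passage from \<open>d\<close> to \<open>d'\<close> at the sample points, one for
      the variation of \<open>d'\<close> inside a cell.\<close>
    then obtain n where n: "inverse (real (Suc n)) < (\<epsilon> - e\<^sub>0) / 4" using reals_Archimedean by blast
    let ?\<eta> = "inverse (real (Suc n))"
    have g: "finite_measurable_partition borel (\<alpha> n)" "\<And>A. A \<in> \<alpha> n \<Longrightarrow> pt n A \<in> A"
      "\<And>A x y u. A \<in> \<alpha> n \<Longrightarrow> x \<in> A \<Longrightarrow> y \<in> A \<Longrightarrow> u \<in> cube L \<Longrightarrow> dist (T u x) (T u y) \<le> ?\<eta>"
      using good[of n] unfolding good_def by auto
    have fmp: "finite_measurable_partition \<nu> (\<alpha> n)"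
      using g(1) \<nu>(2) sets_eq_imp_space_eq[OF \<nu>(2)] by (simp add: finite_measurable_partition_def)
    obtain d j where dj: "code T L d j" "\<And>A x. A \<in> \<alpha> n \<Longrightarrow> x \<in> A \<Longrightarrow> j x = j (pt n A)"
      "\<And>A x. A \<in> \<alpha> n \<Longrightarrow> x \<in> A \<Longrightarrow> d x \<le> d (pt n A) + ?\<eta>"
      "(\<Sum>A\<in>\<alpha> n. measure (distr M borel X) A * d (pt n A)) \<le> e\<^sub>0 + 2 * ?\<eta>"
      "(\<Sum>A\<in>\<alpha> n. measure (distr M borel X) A * j (pt n A)) < c"
      by (rule quantise_coupling[OF M(1,2,4) L _ g _ e0(2) M(6)]) (use e0(1) in auto)
    note sums = dj(4,5)[unfolded M(3)]
    \<comment> \<open>The approximation must fit both budgets: one quarter of the distortion slack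
      and the whole slack of the strict information bound.\<close>
    define e where "e = min ?\<eta> (c - (\<Sum>A\<in>\<alpha> n. measure \<nu> A * j (pt n A)))"
    have e: "0 < e" "e \<le> ?\<eta>" "e \<le> c - (\<Sum>A\<in>\<alpha> n. measure \<nu> A * j (pt n A))" using sums by (auto simp: e_def)
    have "(d, j) \<in> \<S> n" using dj(1-3) by (auto simp: \<S>_def)
    from \<D>(3)[OF e(1) this] obtain d' j' where D': "(d', j') \<in> \<D> n"
      "\<And>A. A \<in> \<alpha> n \<Longrightarrow> \<bar>d' (pt n A) - d (pt n A)\<bar> < e \<and> \<bar>j' (pt n A) - j (pt n A)\<bar> < e" by auto
    then have S': "code T L d' j'" "\<And>A x. A \<in> \<alpha> n \<Longrightarrow> x \<in> A \<Longrightarrow> j' x = j' (pt n A)"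
      "\<And>A x. A \<in> \<alpha> n \<Longrightarrow> x \<in> A \<Longrightarrow> d' x \<le> d' (pt n A) + ?\<eta>"
      using \<D>(2)[of n] by (auto simp: \<S>_def)
    note one = partition_measure_sum[OF \<nu>(1) fmp]
    have add: "(\<Sum>A\<in>\<alpha> n. measure \<nu> A * (g A + t)) = (\<Sum>A\<in>\<alpha> n. measure \<nu> A * g A) + t" for g and t :: real
      using one by (simp add: distrib_left sum.distrib sum_distrib_right[symmetric])
    have budget: "e\<^sub>0 + 2 * t + (t + t) < \<epsilon>" if "t < (\<epsilon> - e\<^sub>0) / 4" for t :: real
    proof -
      have "4 * t < \<epsilon> - e\<^sub>0" using that by (simp add: field_simps)
      then show ?thesis by simp
    qed
    have "(\<integral>x. d' x \<partial>\<nu>) \<le> (\<Sum>A\<in>\<alpha> n. measure \<nu> A * (d' (pt n A) + ?\<eta>))"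
      using S'(3) by (intro integral_le_partition_sum \<nu> fmp code_integrable[OF S'(1) L \<nu>]) auto
    also have "\<dots> \<le> (\<Sum>A\<in>\<alpha> n. measure \<nu> A * (d (pt n A) + (e + ?\<eta>)))"
      using D'(2) by (intro sum_mono mult_left_mono) (fastforce simp: abs_less_iff)+
    also have "\<dots> \<le> e\<^sub>0 + 2 * ?\<eta> + (?\<eta> + ?\<eta>)" unfolding add using sums(1) e(2) by linarith
    also have "\<dots> < \<epsilon>" by (rule budget[OF n])
    finally have 1: "(\<integral>x. d' x \<partial>\<nu>) < \<epsilon>" .
    \<comment> \<open>A cell of positive mass is needed for strictness: there \<open>j'\<close>
      stays strictly below \<open>j + e\<close>, which gives a strict inequality between the sums
      although \<open>e\<close> may use up the whole slack.\<close>
    obtain A0 where A0: "A0 \<in> \<alpha> n" "0 < measure \<nu> A0"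
    proof -
      have "\<exists>A\<in>\<alpha> n. measure \<nu> A \<noteq> 0" using one by (rule_tac ccontr) auto
      then show thesis using that by (metis measure_nonneg less_le)
    qed
    have "(\<integral>x. j' x \<partial>\<nu>) \<le> (\<Sum>A\<in>\<alpha> n. measure \<nu> A * j' (pt n A))"
      using S'(2) by (intro integral_le_partition_sum \<nu> fmp code_integrable[OF S'(1) L \<nu>]) auto
    also have "\<dots> < (\<Sum>A\<in>\<alpha> n. measure \<nu> A * (j (pt n A) + e))"
    proof (rule sum_strict_mono_ex1)
      show "finite (\<alpha> n)" using g(1) by (simp add: finite_measurable_partition_def)
      show "\<forall>A\<in>\<alpha> n. measure \<nu> A * j' (pt n A) \<le> measure \<nu> A * (j (pt n A) + e)"
        using D'(2) by (intro ballI mult_left_mono) (fastforce simp: abs_less_iff)+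
      show "\<exists>A\<in>\<alpha> n. measure \<nu> A * j' (pt n A) < measure \<nu> A * (j (pt n A) + e)"
        using D'(2)[OF A0(1)] A0 by (intro bexI[of _ A0] mult_strict_left_mono) auto
    qed
    also have "\<dots> \<le> c" unfolding add using e(3) by linarith
    finally have "(\<integral>x. j' x \<partial>\<nu>) < c" .
    with 1 D'(1) show "\<exists>(d, j)\<in>(\<Union>n. \<D> n). (\<integral>x. d x \<partial>\<nu>) < \<epsilon> \<and> (\<integral>x. j x \<partial>\<nu>) < c" by blast
  qed
qed

end

section \<open>Tiling\<close>

text \<open>The value \<open>\<phi> (g l)\<close> is absorbed into the factor at \<open>l\<close>.
  The sum over all families then factorises by \<open>prod_sum_PiE\<close>, and every other factor
  is one.\<close>

lemma sum_PiE_marginal: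
  fixes w :: "'k \<Rightarrow> 'b \<Rightarrow> real"
  assumes "finite K" "finite B" "l \<in> K" "\<And>k. k \<in> K \<Longrightarrow> (\<Sum>b\<in>B. w k b) = 1"
  shows "(\<Sum>g\<in>PiE K (\<lambda>_. B). (\<Prod>k\<in>K. w k (g k)) * \<phi> (g l)) = (\<Sum>b\<in>B. w l b * \<phi> b)"
proof -
  have "(\<Prod>k\<in>K. w k (g k)) * \<phi> (g l) = (\<Prod>k\<in>K. w k (g k) * (if k = l then \<phi> (g k) else 1))" for g
    using assms(1,3) by (simp add: prod.distrib prod.delta)
  then have "(\<Sum>g\<in>PiE K (\<lambda>_. B). (\<Prod>k\<in>K. w k (g k)) * \<phi> (g l)) =
    (\<Prod>k\<in>K. \<Sum>b\<in>B. w k b * (if k = l then \<phi> b else 1))"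
    using assms(1,2) by (simp add: prod_sum_PiE)
  also have "\<dots> = (\<Prod>k\<in>K. if k = l then (\<Sum>b\<in>B. w l b * \<phi> b) else 1)"
    using assms(4) by (intro prod.cong) auto
  also have "\<dots> = (\<Sum>b\<in>B. w l b * \<phi> b)" using assms(1,3) by (simp add: prod.delta)
  finally show ?thesis .
qed

text \<open>The source of additivity for product codes. If some \<open>w k\<close> vanishes, the
  common factor makes both sides zero; otherwise the logarithm of the product splits.\<close>

lemma log_prod_ratio:
  fixes w r :: "'k \<Rightarrow> real"
  assumes "finite K" "\<And>k. k \<in> K \<Longrightarrow> 0 \<le> w k" "\<And>k. k \<in> K \<Longrightarrow> 0 < r k"
  shows "(\<Prod>k\<in>K. w k) * log 2 ((\<Prod>k\<in>K. w k) / (\<Prod>k\<in>K. r k)) = (\<Sum>k\<in>K. (\<Prod>k\<in>K. w k) * log 2 (w k / r k))"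
proof (cases "\<exists>k\<in>K. w k = 0")
  case True
  then have "(\<Prod>k\<in>K. w k) = 0" using assms(1) by (simp add: prod_zero_iff)
  then show ?thesis by simp
next
  case False
  then have pos: "0 < w k" if "k \<in> K" for k using assms(2)[OF that] that by (auto simp: less_le)
  have "log 2 ((\<Prod>k\<in>K. w k) / (\<Prod>k\<in>K. r k)) = log 2 (\<Prod>k\<in>K. w k / r k)"
    by (simp add: prod_dividef)
  also have "\<dots> = (\<Sum>k\<in>K. log 2 (w k / r k))"
  proof -
    have "ln (\<Prod>k\<in>K. w k / r k) = (\<Sum>k\<in>K. ln (w k / r k))"
      using pos assms(3) by (intro ln_prod assms(1)) (metis divide_eq_0_iff less_irrefl)
    then show ?thesis by (simp add: log_def sum_divide_distrib)
  qed
  finally show ?thesis by (simp add: sum_distrib_left)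
qed

definition tile_index :: "nat \<Rightarrow> ('n::finite \<Rightarrow> nat) set" where
  "tile_index n = PiE UNIV (\<lambda>_. {..<n})"

definition shift :: "real \<Rightarrow> ('n::finite \<Rightarrow> nat) \<Rightarrow> real ^ 'n" where
  "shift L k = (\<chi> i. real (k i) * L)"

definition tile_of :: "real \<Rightarrow> real ^ 'n::finite \<Rightarrow> 'n \<Rightarrow> nat" where
  "tile_of L u = (\<lambda>i. nat \<lfloor>u $ i / L\<rfloor>)"

lemma finite_tile_index: "finite (tile_index n :: ('n::finite \<Rightarrow> nat) set)"
  by (simp add: tile_index_def finite_PiE)

lemma card_tile_index: "card (tile_index n :: ('n::finite \<Rightarrow> nat) set) = n ^ CARD('n)"
  by (simp add: tile_index_def card_PiE)

lemma tile_of: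
  assumes "0 < L" "L' \<le> real n * L" "u \<in> cube L'"
  shows "tile_of L u \<in> tile_index n" "u - shift L (tile_of L u) \<in> cube L"
proof -
  have *: "real (tile_of L u i) \<le> u $ i / L" "u $ i / L < real (tile_of L u i) + 1" for i
  proof -
    have "0 \<le> u $ i / L" using assms by (simp add: cube_def)
    then show "real (tile_of L u i) \<le> u $ i / L" "u $ i / L < real (tile_of L u i) + 1"
      by (simp_all add: tile_of_def of_nat_nat)
  qed
  have "tile_of L u i < n" for i
  proof -
    have "u $ i < real n * L" using assms by (auto simp: cube_def intro: less_le_trans)
    then have "u $ i / L < real n" using assms(1) by (simp add: field_simps)
    then show ?thesis using *(1)[of i] by linarith
  qed
  then show "tile_of L u \<in> tile_index n" by (auto simp: tile_index_def)
  show "u - shift L (tile_of L u) \<in> cube L"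
    using * assms(1) by (auto simp: cube_def shift_def field_simps)
qed

lemma measurable_tile_of: "tile_of L \<in> measurable borel (count_space UNIV)"
proof (rule measurable_count_space_eq2_countable[THEN iffD2], intro conjI ballI)
  fix k :: "'a \<Rightarrow> nat"
  have m: "(\<lambda>u :: real ^ 'a. nat \<lfloor>u $ i / L\<rfloor>) \<in> measurable borel (count_space UNIV)" for i
    by measurable
  have "{u \<in> space (borel :: (real ^ 'a) measure). \<forall>i\<in>UNIV. nat \<lfloor>u $ i / L\<rfloor> = k i} \<in> sets borel"
  proof (rule sets.sets_Collect_finite_All)
    fix i show "{u \<in> space (borel :: (real ^ 'a) measure). nat \<lfloor>u $ i / L\<rfloor> = k i} \<in> sets borel"
      using measurable_sets[OF m, of "{k i}" i] by (simp add: vimage_def)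
  qed simp
  moreover have "{u \<in> space (borel :: (real ^ 'a) measure). \<forall>i\<in>UNIV. nat \<lfloor>u $ i / L\<rfloor> = k i} =
    tile_of L -` {k} \<inter> space borel" by (auto simp: tile_of_def)
  ultimately show "tile_of L -` {k} \<inter> space borel \<in> sets borel" by (simp only:)
qed auto

lemma
  fixes \<phi> :: "'e::euclidean_space \<Rightarrow> real"
  assumes "\<phi> \<in> borel_measurable borel"
  shows integral_lborel_shift: "(\<integral>u. \<phi> (u - a) \<partial>lborel) = (\<integral>u. \<phi> u \<partial>lborel)"
    and integrable_lborel_shift: "integrable lborel (\<lambda>u. \<phi> (u - a)) \<longleftrightarrow> integrable lborel \<phi>"
proof -
  have d: "distr lborel borel (\<lambda>u. u - a) = (lborel :: 'e measure)"
  proof -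
    have "(\<lambda>u. u - a) = (+) (- a)" by auto
    then show ?thesis using lborel_distr_plus[of "- a"] by simp
  qed
  have m: "(\<lambda>u. u - a) \<in> measurable lborel borel" by simp
  show "(\<integral>u. \<phi> (u - a) \<partial>lborel) = (\<integral>u. \<phi> u \<partial>lborel)"
    using integral_distr[OF m assms] d by simp
  show "integrable lborel (\<lambda>u. \<phi> (u - a)) \<longleftrightarrow> integrable lborel \<phi>"
    using integrable_distr_eq[OF m assms] d by simp
qed

context compact_action
begin

lemma mean_dist_lborel:
  assumes "g \<in> borel_measurable borel"
  shows "mean_dist T L x g = (\<integral>u. indicator (cube L) u * dist (T u x) (g u) \<partial>lborel) / L ^ CARD('n)"
    and "integrable lborel (\<lambda>u. indicator (cube L) u * dist (T u x) (g u))"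
    and "(\<lambda>u. indicator (cube L) u * dist (T u x) (g u) :: real) \<in> borel_measurable borel"
proof -
  show "mean_dist T L x g = (\<integral>u. indicator (cube L) u * dist (T u x) (g u) \<partial>lborel) / L ^ CARD('n)"
    unfolding mean_dist_def cube_lborel_def by (subst integral_restrict_space) (auto simp: cube_measurable)
  show "integrable lborel (\<lambda>u. indicator (cube L) u * dist (T u x) (g u))"
    using integrable_dist[OF measurable_orbit borel_measurable_cube_lborel[OF assms]]
    unfolding cube_lborel_def by (subst (asm) integrable_restrict_space) (auto simp: cube_measurable)
  show "(\<lambda>u. indicator (cube L) u * dist (T u x) (g u) :: real) \<in> borel_measurable borel"
    by (intro borel_measurable_times borel_measurable_indicator cube_measurable borel_measurable_dist
        measurable_T assms) auto
qed

text \<open>The code word for a large cube that shows on each tile the translated code word chosen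
  for it. Outside the grid the choice \<open>g\<close> carries no information, so a constant is used
  there to keep the map measurable.\<close>

definition tiled :: "real \<Rightarrow> nat \<Rightarrow> ('b \<Rightarrow> real ^ 'n \<Rightarrow> 'a) \<Rightarrow> (('n \<Rightarrow> nat) \<Rightarrow> 'b) \<Rightarrow> real ^ 'n \<Rightarrow> 'a" where
  "tiled L n f g u = (if tile_of L u \<in> tile_index n
     then f (g (tile_of L u)) (u - shift L (tile_of L u)) else undefined)"

lemma tiled_measurable:
  assumes "\<And>k. k \<in> tile_index n \<Longrightarrow> f (g k) \<in> borel_measurable borel"
  shows "tiled L n f g \<in> borel_measurable borel"
proof -
  have "(\<lambda>u. (\<lambda>k u. if k \<in> tile_index n then f (g k) (u - shift L k) else undefined) (tile_of L u) u) \<in> borel_measurable borel"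
  proof (rule measurable_compose_countable[OF _ measurable_tile_of])
    fix k
    show "(\<lambda>u. if k \<in> tile_index n then f (g k) (u - shift L k) else undefined) \<in> borel_measurable borel"
      using assms by (cases "k \<in> tile_index n") (auto intro: measurable_compose[of "\<lambda>u. u - shift L k"])
  qed
  then show ?thesis by (simp add: tiled_def[abs_def])
qed

text \<open>On its tile a point \<open>u\<close> sees the orbit of \<open>T (shift L k) x\<close> at
  time \<open>u - shift L k\<close>. The tiles cover the large cube but may stick out of it, hence
  an inequality; \<open>(L / L') ^ CARD('n)\<close> changes the normalisation.\<close>

lemma mean_dist_tiled_le:
  assumes L: "0 < L" "0 < L'" "L' \<le> real n * L"
    and f: "\<And>k. k \<in> tile_index n \<Longrightarrow> f (g k) \<in> borel_measurable borel"
  shows "mean_dist T L' x (tiled L n f g) \<le>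
    (L / L') ^ CARD('n) * (\<Sum>k\<in>tile_index n. mean_dist T L (T (shift L k) x) (f (g k)))"
proof -
  let ?h = "\<lambda>k u. indicator (cube L) u * dist (T u (T (shift L k) x)) (f (g k) u) :: real"
  have int: "integrable lborel (\<lambda>u. ?h k (u - shift L k))" if "k \<in> tile_index n" for k
    by (subst integrable_lborel_shift) (intro mean_dist_lborel f that)+
  have "(\<integral>u. indicator (cube L') u * dist (T u x) (tiled L n f g u) \<partial>lborel) \<le>
    (\<integral>u. (\<Sum>k\<in>tile_index n. ?h k (u - shift L k)) \<partial>lborel)"
  proof (intro integral_mono mean_dist_lborel tiled_measurable f Bochner_Integration.integrable_sum int)
    fix u :: "real ^ 'n"
    show "indicator (cube L') u * dist (T u x) (tiled L n f g u) \<le> (\<Sum>k\<in>tile_index n. ?h k (u - shift L k))"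
    proof (cases "u \<in> cube L'")
      case True
      note t = tile_of[OF L(1,3) True]
      let ?k = "tile_of L u"
      have "indicator (cube L') u * dist (T u x) (tiled L n f g u) = ?h ?k (u - shift L ?k)"
        using True t by (simp add: tiled_def T_add[symmetric])
      also have "\<dots> \<le> (\<Sum>k\<in>tile_index n. ?h k (u - shift L k))"
        using t(1) by (intro member_le_sum[of ?k _ "\<lambda>k. ?h k (u - shift L k)"] finite_tile_index) auto
      finally show ?thesis .
    qed (auto intro!: sum_nonneg)
  qed auto
  also have "\<dots> = (\<Sum>k\<in>tile_index n. \<integral>u. ?h k (u - shift L k) \<partial>lborel)"
    by (intro Bochner_Integration.integral_sum int)
  also have "\<dots> = (\<Sum>k\<in>tile_index n. \<integral>u. ?h k u \<partial>lborel)"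
    by (intro sum.cong refl integral_lborel_shift mean_dist_lborel f)
  also have "\<dots> = (\<Sum>k\<in>tile_index n. L ^ CARD('n) * mean_dist T L (T (shift L k) x) (f (g k)))"
    using L by (intro sum.cong refl) (simp add: mean_dist_lborel(1) f)
  finally have "mean_dist T L' x (tiled L n f g) \<le>
     (\<Sum>k\<in>tile_index n. L ^ CARD('n) * mean_dist T L (T (shift L k) x) (f (g k))) / L' ^ CARD('n)"
    using L by (simp add: mean_dist_lborel(1) tiled_measurable f divide_right_mono)
  then show ?thesis by (simp add: power_divide sum_distrib_left[symmetric])
qed

text \<open>Given \<open>x\<close>, the labels of the tiles are drawn independently, each from the
  kernel at the translated point, and the reference is the product of the references. Information
  then adds up exactly, and marginalisation reduces the distortion to the single tiles.\<close>

lemma tile_code: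
  assumes code: "code T L d j" and L: "0 < L" "0 < L'" "L' \<le> real n * L"
  obtains d' where "code T L' d' (\<lambda>x. \<Sum>k\<in>tile_index n. j (T (shift L k) x))"
    "\<And>x. d' x \<le> (L / L') ^ CARD('n) * (\<Sum>k\<in>tile_index n. d (T (shift L k) x))"
proof -
  obtain B :: "nat set" and f W r where k: "kernel_on borel B W r"
    and f: "\<And>b. b \<in> B \<Longrightarrow> f b \<in> borel_measurable borel"
    and d: "d = (\<lambda>x. \<Sum>b\<in>B. W b x * mean_dist T L x (f b))"
    and j: "j = (\<lambda>x. \<Sum>b\<in>B. W b x * log 2 (W b x / r b))"
    by (rule codeE[OF code]) blast
  note K = kernel_onD[OF k]
  let ?I = "tile_index n :: ('n \<Rightarrow> nat) set"
  let ?B = "PiE ?I (\<lambda>_. B)"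
  have in_B: "g l \<in> B" if "g \<in> ?B" "l \<in> ?I" for g l using that by (auto simp: PiE_def)
  define W' where "W' g x = (\<Prod>l\<in>?I. W (g l) (T (shift L l) x))" for g x
  define r' where "r' g = (\<Prod>l\<in>?I. r (g l))" for g
  have marg: "(\<Sum>g\<in>?B. W' g x * \<phi> (g l)) = (\<Sum>b\<in>B. W b (T (shift L l) x) * \<phi> b)" if "l \<in> ?I" for x l \<phi>
    unfolding W'_def using K(4) by (intro sum_PiE_marginal[OF finite_tile_index K(1) that]) simp
  have k': "kernel_on borel ?B W' r'"
    unfolding kernel_on_def
  proof (intro conjI ballI)
    show "finite ?B" by (intro finite_PiE finite_tile_index K(1))
    fix g assume g: "g \<in> ?B"
    show "W' g \<in> borel_measurable borel"
      unfolding W'_def[abs_def]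
      by (intro borel_measurable_prod measurable_compose[OF measurable_T K(2)] in_B[OF g]) auto
    show "0 \<le> W' g x" for x unfolding W'_def using in_B[OF g] K(3) by (intro prod_nonneg) auto
    show "0 < r' g" unfolding r'_def using in_B[OF g] K(5) by (intro prod_pos) auto
  next
    fix x :: 'a
    have "(\<Sum>g\<in>?B. W' g x) = (\<Prod>l\<in>?I. \<Sum>b\<in>B. W b (T (shift L l) x))"
      unfolding W'_def using finite_tile_index K(1) by (intro prod_sum_PiE[symmetric])
    then show "(\<Sum>g\<in>?B. W' g x) = 1" using K(4) by simp
  next
    have "(\<Sum>g\<in>?B. r' g) = (\<Prod>l\<in>?I. \<Sum>b\<in>B. r b)"
      unfolding r'_def using finite_tile_index K(1) by (intro prod_sum_PiE[symmetric])
    also have "\<dots> \<le> 1" by (intro prod_le_1 conjI sum_nonneg less_imp_le K(5,6))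
    finally show "(\<Sum>g\<in>?B. r' g) \<le> 1" .
  qed
  let ?f = "tiled L n f"
  have f': "?f g \<in> borel_measurable borel" if "g \<in> ?B" for g
    using in_B[OF that] f by (intro tiled_measurable) auto
  have j': "(\<Sum>g\<in>?B. W' g x * log 2 (W' g x / r' g)) = (\<Sum>l\<in>?I. j (T (shift L l) x))" for x
  proof -
    have "(\<Sum>g\<in>?B. W' g x * log 2 (W' g x / r' g)) =
      (\<Sum>g\<in>?B. \<Sum>l\<in>?I. W' g x * log 2 (W (g l) (T (shift L l) x) / r (g l)))"
      unfolding W'_def r'_def using in_B K(3,5)
      by (intro sum.cong refl log_prod_ratio finite_tile_index) auto
    also have "\<dots> = (\<Sum>l\<in>?I. \<Sum>g\<in>?B. W' g x * log 2 (W (g l) (T (shift L l) x) / r (g l)))"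
      by (rule sum.swap)
    also have "\<dots> = (\<Sum>l\<in>?I. j (T (shift L l) x))"
    proof (rule sum.cong[OF refl])
      fix l assume "l \<in> ?I"
      from marg[OF this, of x "\<lambda>b. log 2 (W b (T (shift L l) x) / r b)"]
      show "(\<Sum>g\<in>?B. W' g x * log 2 (W (g l) (T (shift L l) x) / r (g l))) = j (T (shift L l) x)"
        by (simp add: j)
    qed
    finally show ?thesis .
  qed
  show thesis
  proof (rule that)
    show "code T L' (\<lambda>x. \<Sum>g\<in>?B. W' g x * mean_dist T L' x (?f g)) (\<lambda>x. \<Sum>k\<in>tile_index n. j (T (shift L k) x))"
      using codeI[where T = T and L = L' and f = ?f, OF k' f'] by (simp add: j')
    fix x
    have "(\<Sum>g\<in>?B. W' g x * mean_dist T L' x (?f g)) \<le>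
      (\<Sum>g\<in>?B. W' g x * ((L / L') ^ CARD('n) * (\<Sum>l\<in>?I. mean_dist T L (T (shift L l) x) (f (g l)))))"
      using kernel_onD(3)[OF k'] in_B f by (intro sum_mono mult_left_mono mean_dist_tiled_le L) auto
    also have "\<dots> = (L / L') ^ CARD('n) * (\<Sum>l\<in>?I. \<Sum>g\<in>?B. W' g x * mean_dist T L (T (shift L l) x) (f (g l)))"
      by (subst sum.swap) (simp add: sum_distrib_left mult.left_commute)
    also have "\<dots> = (L / L') ^ CARD('n) * (\<Sum>l\<in>?I. d (T (shift L l) x))"
    proof (intro arg_cong2[where f = "(*)"] sum.cong[OF refl] refl)
      fix l assume "l \<in> ?I"
      from marg[OF this, of x "\<lambda>b. mean_dist T L (T (shift L l) x) (f b)"]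
      show "(\<Sum>g\<in>?B. W' g x * mean_dist T L (T (shift L l) x) (f (g l))) = d (T (shift L l) x)"
        by (simp add: d)
    qed
    finally show "(\<Sum>g\<in>?B. W' g x * mean_dist T L' x (?f g)) \<le> (L / L') ^ CARD('n) * (\<Sum>k\<in>tile_index n. d (T (shift L k) x))" .
  qed
qed

lemma invariant_measuresD:
  assumes "\<nu> \<in> invariant_measures T"
  shows "prob_space \<nu>" "sets \<nu> = sets borel" "distr \<nu> borel (T u) = \<nu>"
  using assms by (auto simp: invariant_measures_def)

lemma invariant_integral:
  fixes \<phi> :: "'a \<Rightarrow> real"
  assumes "\<nu> \<in> invariant_measures T" "\<phi> \<in> borel_measurable borel"
  shows "(\<integral>x. \<phi> (T u x) \<partial>\<nu>) = (\<integral>x. \<phi> x \<partial>\<nu>)"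
    and "integrable \<nu> \<phi> \<Longrightarrow> integrable \<nu> (\<lambda>x. \<phi> (T u x))"
proof -
  have m: "T u \<in> measurable \<nu> borel"
    using measurable_T[of "\<lambda>_. u" borel "\<lambda>x. x"] measurable_cong_sets[OF invariant_measuresD(2)[OF assms(1)] refl, of "borel :: 'a measure"]
    by simp
  show "(\<integral>x. \<phi> (T u x) \<partial>\<nu>) = (\<integral>x. \<phi> x \<partial>\<nu>)"
    using integral_distr[OF m assms(2)] invariant_measuresD(3)[OF assms(1)] by simp
  show "integrable \<nu> \<phi> \<Longrightarrow> integrable \<nu> (\<lambda>x. \<phi> (T u x))"
    using integrable_distr_eq[OF m assms(2)] invariant_measuresD(3)[OF assms(1)] by simp
qed

text \<open>Invariance gives every tile the same integral, so the sums become multiples by the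
  number of tiles. The new code is fixed before \<open>\<nu>\<close>; this uniformity is essential
  when the code index later depends on \<open>\<nu>\<close>.\<close>

lemma tile_code_invariant:
  assumes code: "code T L d j" and L: "0 < L" "0 < L'" "L' \<le> real n * L"
  obtains d' j' where "code T L' d' j'"
    "\<And>\<nu>. \<nu> \<in> invariant_measures T \<Longrightarrow> (\<integral>x. d' x \<partial>\<nu>) \<le> (real n * L / L') ^ CARD('n) * (\<integral>x. d x \<partial>\<nu>)"
    "\<And>\<nu>. \<nu> \<in> invariant_measures T \<Longrightarrow> (\<integral>x. j' x \<partial>\<nu>) = real n ^ CARD('n) * (\<integral>x. j x \<partial>\<nu>)"
proof -
  obtain d' where d': "code T L' d' (\<lambda>x. \<Sum>k\<in>tile_index n. j (T (shift L k) x))"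
    "\<And>x. d' x \<le> (L / L') ^ CARD('n) * (\<Sum>k\<in>tile_index n. d (T (shift L k) x))"
    by (rule tile_code[OF assms]) blast
  note c = codeD[OF code L(1)]
  show thesis
  proof (rule that[OF d'(1)])
    fix \<nu> assume \<nu>: "\<nu> \<in> invariant_measures T"
    note p = invariant_measuresD(1,2)[OF \<nu>]
    note int = code_integrable[OF code L(1) p]
    have "(\<integral>x. d' x \<partial>\<nu>) \<le> (\<integral>x. (L / L') ^ CARD('n) * (\<Sum>k\<in>tile_index n. d (T (shift L k) x)) \<partial>\<nu>)"
      by (intro integral_mono code_integrable[OF d'(1) L(2) p] d'(2) integrable_mult_right
          Bochner_Integration.integrable_sum invariant_integral(2)[OF \<nu>] c int)
    also have "\<dots> = (L / L') ^ CARD('n) * (\<Sum>k\<in>(tile_index n :: ('n \<Rightarrow> nat) set). \<integral>x. d (T (shift L k) x) \<partial>\<nu>)"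
      by (subst integral_mult_right_zero, subst Bochner_Integration.integral_sum) (intro invariant_integral(2)[OF \<nu>] c int, simp)
    also have "\<dots> = (L / L') ^ CARD('n) * (real n ^ CARD('n) * (\<integral>x. d x \<partial>\<nu>))"
      by (simp add: invariant_integral(1)[OF \<nu>] c card_tile_index)
    finally show "(\<integral>x. d' x \<partial>\<nu>) \<le> (real n * L / L') ^ CARD('n) * (\<integral>x. d x \<partial>\<nu>)"
      by (simp add: power_mult_distrib power_divide mult_ac)
    have "(\<integral>x. (\<Sum>k\<in>(tile_index n :: ('n \<Rightarrow> nat) set). j (T (shift L k) x)) \<partial>\<nu>) =
        (\<Sum>k\<in>(tile_index n :: ('n \<Rightarrow> nat) set). \<integral>x. j (T (shift L k) x) \<partial>\<nu>)"
      by (intro Bochner_Integration.integral_sum invariant_integral(2)[OF \<nu>] c int)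
    then show "(\<integral>x. (\<Sum>k\<in>(tile_index n :: ('n \<Rightarrow> nat) set). j (T (shift L k) x)) \<partial>\<nu>) = real n ^ CARD('n) * (\<integral>x. j x \<partial>\<nu>)"
      by (simp add: invariant_integral(1)[OF \<nu>] c card_tile_index)
  qed
qed

end

section \<open>Open covers\<close>

definition small_cover :: "('a::metric_space \<Rightarrow> 'a \<Rightarrow> real) \<Rightarrow> real \<Rightarrow> 'a set set \<Rightarrow> bool" where
  "small_cover \<rho> \<epsilon> \<U> \<longleftrightarrow> finite \<U> \<and> \<Union>\<U> = UNIV \<and> (\<forall>U\<in>\<U>. open U \<and> diam_wrt \<rho> U < \<epsilon>)"

context compact_action
begin

lemma cube_nonempty: "0 < L \<Longrightarrow> (0 :: real ^ 'n) \<in> cube L"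
  by (simp add: cube_def)

lemma bowen_bdd: "bdd_above ((\<lambda>u. dist (T u x) (T u y)) ` cube L)"
  using dist_le_diameter by (intro bdd_aboveI) auto

lemma dist_le_bowen: "u \<in> cube L \<Longrightarrow> dist (T u x) (T u y) \<le> bowen_dist T L x y"
  unfolding bowen_dist_def by (intro cSUP_upper bowen_bdd)

lemma bowen_le: "0 < L \<Longrightarrow> (\<And>u. u \<in> cube L \<Longrightarrow> dist (T u x) (T u y) \<le> c) \<Longrightarrow> bowen_dist T L x y \<le> c"
  unfolding bowen_dist_def using cube_nonempty by (intro cSUP_least) auto

lemma bowen_nonneg: "0 < L \<Longrightarrow> 0 \<le> bowen_dist T L x y"
  using dist_le_bowen[OF cube_nonempty] zero_le_dist order.trans by blast

lemma bowen_le_diam: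
  assumes "0 < L" "x \<in> U" "y \<in> U"
  shows "bowen_dist T L x y \<le> diam_wrt (bowen_dist T L) U"
proof -
  have "bdd_above ((\<lambda>(x, y). bowen_dist T L x y) ` (U \<times> U))"
    using assms(1) dist_le_diameter by (intro bdd_aboveI[of _ "diameter (UNIV :: 'a set)"]) (auto intro!: bowen_le)
  then show ?thesis
    using assms(2,3) cSUP_upper[of "(x, y)" "U \<times> U" "\<lambda>(x, y). bowen_dist T L x y"]
    by (auto simp: diam_wrt_def)
qed

lemma diam_le:
  assumes "0 \<le> c" "\<And>x y. x \<in> U \<Longrightarrow> y \<in> U \<Longrightarrow> bowen_dist T L x y \<le> c"
  shows "diam_wrt (bowen_dist T L) U \<le> c"
  using assms by (auto simp: diam_wrt_def intro!: cSUP_least)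

lemma small_cover_exists:
  assumes "0 < L" "0 < \<epsilon>"
  obtains \<U> where "small_cover (bowen_dist T L) \<epsilon> \<U>"
proof -
  obtain \<delta> where \<delta>: "0 < \<delta>" "\<And>x y u. dist x y < \<delta> \<Longrightarrow> u \<in> cube L \<Longrightarrow> dist (T u x) (T u y) < \<epsilon> / 2"
    using T_equicontinuous[of "\<epsilon> / 2" L] assms(2) by auto
  obtain k where k: "finite k" "(UNIV :: 'a set) \<subseteq> (\<Union>x\<in>k. ball x (\<delta> / 2))"
    using compact_UNIV[unfolded compact_eq_totally_bounded] \<delta>(1) by (meson half_gt_zero)
  have "small_cover (bowen_dist T L) \<epsilon> ((\<lambda>x. ball x (\<delta> / 2)) ` k)"
    unfolding small_cover_def
  proof (intro conjI ballI)
    fix U assume "U \<in> (\<lambda>x. ball x (\<delta> / 2)) ` k"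
    then obtain z where z: "U = ball z (\<delta> / 2)" by blast
    then show "open U" by simp
    have "diam_wrt (bowen_dist T L) U \<le> \<epsilon> / 2"
    proof (rule diam_le)
      fix x y assume "x \<in> U" "y \<in> U"
      then have "dist x y < \<delta>" using z dist_triangle_half_r[of z x \<delta> y] by auto
      then show "bowen_dist T L x y \<le> \<epsilon> / 2" using \<delta>(2) by (intro bowen_le assms(1)) (auto intro: less_imp_le)
    qed (use assms in auto)
    then show "diam_wrt (bowen_dist T L) U < \<epsilon>" using assms(2) by simp
  qed (use k in auto)
  then show thesis by (rule that)
qed

lemma covering_number_attained:
  assumes "0 < L" "0 < \<epsilon>"
  obtains \<U> where "small_cover (bowen_dist T L) \<epsilon> \<U>" "card \<U> = covering_number (bowen_dist T L) \<epsilon>"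
proof -
  obtain \<V> where "small_cover (bowen_dist T L) \<epsilon> \<V>" using small_cover_exists[OF assms] .
  then have "\<exists>n \<U>. finite \<U> \<and> card \<U> = n \<and> \<Union>\<U> = UNIV \<and> (\<forall>U\<in>\<U>. open U \<and> diam_wrt (bowen_dist T L) U < \<epsilon>)"
    unfolding small_cover_def by blast
  from LeastI_ex[OF this, folded covering_number_def] show thesis
    using that unfolding small_cover_def by blast
qed

lemma covering_number_le:
  "small_cover (bowen_dist T L) \<epsilon> \<U> \<Longrightarrow> covering_number (bowen_dist T L) \<epsilon> \<le> card \<U>"
  unfolding covering_number_def small_cover_def by (intro Least_le) blast

lemma small_cover_card_pos: "small_cover \<rho> \<epsilon> (\<U> :: 'a set set) \<Longrightarrow> 0 < card \<U>"
  unfolding small_cover_def by (auto simp: card_gt_0_iff)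

lemma covering_number_pos:
  assumes "0 < L" "0 < \<epsilon>"
  shows "0 < covering_number (bowen_dist T L) \<epsilon>"
  using covering_number_attained[OF assms] small_cover_card_pos by metis

text \<open>Prescribing for each tile the element of a small cover that contains the translated
  point gives open sets that are small in the metric of the large cube. There are at most as many as
  there are choices over the \<open>n ^ CARD('n)\<close> tiles.\<close>

lemma covering_number_tile:
  assumes L: "0 < L" "0 < L'" "L' \<le> real n * L" and "0 < \<epsilon>"
  shows "covering_number (bowen_dist T L') \<epsilon> \<le> covering_number (bowen_dist T L) \<epsilon> ^ (n ^ CARD('n))"
proof -
  obtain \<U> where \<U>: "small_cover (bowen_dist T L) \<epsilon> \<U>" "card \<U> = covering_number (bowen_dist T L) \<epsilon>"
    using covering_number_attained[OF L(1) assms(4)] .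
  have fin: "finite \<U>" and cov: "\<Union>\<U> = UNIV" and op: "\<And>U. U \<in> \<U> \<Longrightarrow> open U"
    and diam: "\<And>U. U \<in> \<U> \<Longrightarrow> diam_wrt (bowen_dist T L) U < \<epsilon>"
    using \<U>(1) by (auto simp: small_cover_def)
  let ?I = "tile_index n :: ('n \<Rightarrow> nat) set"
  let ?P = "PiE ?I (\<lambda>_. \<U>)"
  define V where "V g = (\<Inter>k\<in>?I. {x. T (shift L k) x \<in> g k})" for g
  have cont: "continuous_on UNIV (T u)" for u
  proof -
    have "continuous_on UNIV ((\<lambda>(u, x). T u x) \<circ> (\<lambda>x. (u, x)))"
      by (intro continuous_on_compose continuous_on_subset[OF continuous_T] continuous_intros) auto
    then show ?thesis by (simp add: comp_def)
  qed
  have "\<U> \<noteq> {}" using cov by auto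
  then have Max: "Max (diam_wrt (bowen_dist T L) ` \<U>) < \<epsilon>" using fin diam by (subst Max_less_iff) auto
  \<comment> \<open>A supremum of distances below \<open>\<epsilon>\<close> could equal
    \<open>\<epsilon>\<close>. The maximum over the finite cover leaves a gap, and the value 0 is
    included because \<open>diam_le\<close> asks for a nonnegative bound.\<close>
  define e where "e = max 0 (Max (diam_wrt (bowen_dist T L) ` \<U>))"
  have e: "0 \<le> e" "e < \<epsilon>" using Max assms(4) by (auto simp: e_def)
  have diam_e: "diam_wrt (bowen_dist T L) U \<le> e" if "U \<in> \<U>" for U
    unfolding e_def using fin that by (intro max.coboundedI2 Max_ge) auto
  have "small_cover (bowen_dist T L') \<epsilon> (V ` ?P)"
    unfolding small_cover_def
  proof (intro conjI ballI)
    show "finite (V ` ?P)" by (intro finite_imageI finite_PiE finite_tile_index fin)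
    show "\<Union> (V ` ?P) = UNIV"
    proof (intro equalityI subsetI UNIV_I)
      fix x :: 'a
      have "\<forall>k. \<exists>U\<in>\<U>. T (shift L k) x \<in> U" using cov by (metis UNIV_I Union_iff)
      then obtain g where g: "\<And>k. g k \<in> \<U>" "\<And>k. T (shift L k) x \<in> g k" by metis
      then have "restrict g ?I \<in> ?P" "x \<in> V (restrict g ?I)" by (auto simp: V_def)
      then show "x \<in> \<Union> (V ` ?P)" by blast
    qed
    fix U assume "U \<in> V ` ?P"
    then obtain g where g: "g \<in> ?P" "U = V g" by blast
    have gk: "g k \<in> \<U>" if "k \<in> ?I" for k using g(1) that by (auto simp: PiE_def)
    show "open U" unfolding g(2) V_def
    proof (intro open_INT finite_tile_index ballI)
      fix k assume "k \<in> ?I"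
      then have "open (T (shift L k) -` g k)" by (intro open_vimage op gk cont)
      then show "open {x. T (shift L k) x \<in> g k}" by (simp add: vimage_def)
    qed
    have "diam_wrt (bowen_dist T L') U \<le> e"
    proof (rule diam_le[OF e(1)])
      fix x y assume xy: "x \<in> U" "y \<in> U"
      show "bowen_dist T L' x y \<le> e"
      proof (rule bowen_le[OF L(2)])
        fix u :: "real ^ 'n" assume u: "u \<in> cube L'"
        note t = tile_of[OF L(1,3) u]
        let ?k = "tile_of L u" let ?a = "shift L (tile_of L u)"
        have "T u z = T (u - ?a) (T ?a z)" for z by (simp add: T_add[symmetric])
        then have "dist (T u x) (T u y) = dist (T (u - ?a) (T ?a x)) (T (u - ?a) (T ?a y))" by simp
        also have "\<dots> \<le> bowen_dist T L (T ?a x) (T ?a y)" by (rule dist_le_bowen[OF t(2)])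
        also have "\<dots> \<le> diam_wrt (bowen_dist T L) (g ?k)"
          using xy t(1) by (intro bowen_le_diam L(1)) (auto simp: g(2) V_def)
        also have "\<dots> \<le> e" by (intro diam_e gk t(1))
        finally show "dist (T u x) (T u y) \<le> e" .
      qed
    qed
    then show "diam_wrt (bowen_dist T L') U < \<epsilon>" using e(2) by simp
  qed
  then have "covering_number (bowen_dist T L') \<epsilon> \<le> card (V ` ?P)" by (rule covering_number_le)
  also have "\<dots> \<le> card ?P" by (intro card_image_le finite_PiE finite_tile_index fin)
  also have "\<dots> = card \<U> ^ (n ^ CARD('n))" by (simp add: card_PiE finite_tile_index card_tile_index)
  finally show ?thesis by (simp add: \<U>(2))
qed

text \<open>A deterministic code: \<open>x\<close> is described by the index of a set that contains
  it and reproduced by the orbit of a point of that set. With the uniform reference the information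
  is the same at all points, and an average distance is at most the supremum distance.\<close>

lemma cover_code:
  assumes L: "0 < L" and \<U>: "small_cover (bowen_dist T L) \<epsilon> \<U>"
  obtains d where "code T L d (\<lambda>_. log 2 (real (card \<U>)))" "\<And>x. d x < \<epsilon>"
proof -
  have fin: "finite \<U>" and cov: "\<Union>\<U> = UNIV" and op: "\<And>U. U \<in> \<U> \<Longrightarrow> open U"
    and diam: "\<And>U. U \<in> \<U> \<Longrightarrow> diam_wrt (bowen_dist T L) U < \<epsilon>"
    using \<U>(1) by (auto simp: small_cover_def)
  let ?N = "card \<U>"
  have Npos: "0 < ?N" using small_cover_card_pos[OF \<U>] .
  obtain h where h: "bij_betw h {0..<?N} \<U>" using ex_bij_betw_nat_finite[OF fin] by blast
  have "(\<Union>i<?N. h i) = UNIV" using h cov by (simp add: bij_betw_def atLeast0LessThan)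
  moreover have "open (h i)" if "i < ?N" for i
    using h that by (intro op) (auto simp: bij_betw_def)
  ultimately obtain c where c: "\<And>x. c x < ?N" "\<And>x. x \<in> h (c x)"
    and c_meas: "c \<in> measurable borel (count_space UNIV)"
    using open_cover_index[of ?N h] by blast
  define pt where "pt i = (SOME x. x \<in> h i)" for i
  have pt: "pt (c x) \<in> h (c x)" for x unfolding pt_def by (rule someI[of "\<lambda>y. y \<in> h (c x)", OF c(2)])
  let ?B = "{0..<?N}"
  let ?W = "\<lambda>i x. if c x = i then 1 else 0 :: real"
  let ?f = "\<lambda>i u. T u (pt i)"
  have W: "(\<Sum>i\<in>?B. ?W i x * \<phi> i) = \<phi> (c x)" for \<phi> :: "nat \<Rightarrow> real" and x
  proof -
    have "(\<Sum>i\<in>?B. ?W i x * \<phi> i) = (\<Sum>i\<in>?B. if i = c x then \<phi> i else 0)"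
      by (intro sum.cong) auto
    then show ?thesis using c(1)[of x] by simp
  qed
  have k: "kernel_on borel ?B ?W (\<lambda>_. 1 / real ?N)"
    unfolding kernel_on_def
  proof (intro conjI ballI)
    fix i
    show "?W i \<in> borel_measurable borel"
      by (rule measurable_compose[OF c_meas, of "\<lambda>j. if j = i then 1 else 0"]) simp
    show "(\<Sum>i\<in>?B. ?W i x) = 1" for x using W[of x "\<lambda>_. 1"] by simp
  qed (use Npos in auto)
  have "code T L (\<lambda>x. \<Sum>i\<in>?B. ?W i x * mean_dist T L x (?f i)) (\<lambda>x. \<Sum>i\<in>?B. ?W i x * log 2 (?W i x / (1 / real ?N)))"
    by (intro codeI k measurable_T) auto
  also have "(\<lambda>x. \<Sum>i\<in>?B. ?W i x * mean_dist T L x (?f i)) = (\<lambda>x. mean_dist T L x (?f (c x)))"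
    by (simp only: W)
  also have "(\<lambda>x. \<Sum>i\<in>?B. ?W i x * log 2 (?W i x / (1 / real ?N))) = (\<lambda>_. log 2 (real ?N))"
    by (rule ext, subst W) simp
  finally show thesis
  proof (rule that)
    fix x
    have "h (c x) \<in> \<U>" using c(1)[of x] h by (auto simp: bij_betw_def)
    have "mean_dist T L x (?f (c x)) \<le> bowen_dist T L x (pt (c x))"
      unfolding mean_dist_def
      by (intro mean_le_const L integrable_dist measurable_orbit dist_le_bowen bowen_nonneg)
    also have "\<dots> \<le> diam_wrt (bowen_dist T L) (h (c x))" by (intro bowen_le_diam L c(2) pt)
    also have "\<dots> < \<epsilon>" by (rule diam) fact
    finally show "mean_dist T L x (?f (c x)) < \<epsilon>" .
  qed
qed

end

section \<open>Subadditivity\<close>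

lemma tendsto_nat_ceiling_ratio:
  assumes "0 < L"
  shows "((\<lambda>x. real (nat \<lceil>x / L\<rceil>) / x) \<longlongrightarrow> 1 / L) at_top"
proof (rule tendsto_sandwich)
  show "\<forall>\<^sub>F x in at_top. 1 / L \<le> real (nat \<lceil>x / L\<rceil>) / x"
    using eventually_gt_at_top[of 0]
  proof eventually_elim
    case (elim x)
    have "x / L \<le> real (nat \<lceil>x / L\<rceil>)" by linarith
    then have "x / L / x \<le> real (nat \<lceil>x / L\<rceil>) / x" using elim by (intro divide_right_mono) auto
    then show ?case using elim by simp
  qed
  show "\<forall>\<^sub>F x in at_top. real (nat \<lceil>x / L\<rceil>) / x \<le> 1 / L + 1 / x"
    using eventually_gt_at_top[of 0]
  proof eventually_elim
    case (elim x)
    have "0 \<le> x / L" using elim assms by simp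
    then have "real (nat \<lceil>x / L\<rceil>) \<le> x / L + 1" by linarith
    then have "real (nat \<lceil>x / L\<rceil>) / x \<le> (x / L + 1) / x" using elim by (intro divide_right_mono) auto
    then show ?case using elim by (simp add: add_divide_distrib)
  qed
  show "((\<lambda>x. 1 / L + 1 / x) \<longlongrightarrow> 1 / L) at_top"
    using tendsto_add[OF tendsto_const[of "1 / L"] tendsto_inverse_0_at_top[OF filterlim_ident]]
    by (simp add: divide_inverse)
qed (rule tendsto_const)

lemma le_nat_ceiling_mult: "0 < L \<Longrightarrow> x \<le> real (nat \<lceil>x / L\<rceil>) * (L :: real)"
proof -
  assume L: "0 < L"
  have "x / L \<le> real (nat \<lceil>x / L\<rceil>)" by linarith
  then show ?thesis using L by (simp add: field_simps)
qed

lemma tiling_tendsto: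
  assumes "0 < L"
  shows "((\<lambda>x. ennreal (real (nat \<lceil>x / L\<rceil>) ^ D * c) / ennreal (x ^ D)) \<longlongrightarrow> ennreal (c / L ^ D)) at_top"
proof (cases "0 \<le> c")
  case True
  have "((\<lambda>x. ennreal ((real (nat \<lceil>x / L\<rceil>) / x) ^ D * c)) \<longlongrightarrow> ennreal ((1 / L) ^ D * c)) at_top"
    by (intro tendsto_ennrealI tendsto_intros tendsto_nat_ceiling_ratio assms)
  moreover have "\<forall>\<^sub>F x in at_top. ennreal ((real (nat \<lceil>x / L\<rceil>) / x) ^ D * c) =
    ennreal (real (nat \<lceil>x / L\<rceil>) ^ D * c) / ennreal (x ^ D)"
    using eventually_gt_at_top[of 0]
    by eventually_elim (use True in \<open>simp add: divide_ennreal power_divide\<close>)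
  ultimately have "((\<lambda>x. ennreal (real (nat \<lceil>x / L\<rceil>) ^ D * c) / ennreal (x ^ D)) \<longlongrightarrow> ennreal ((1 / L) ^ D * c)) at_top"
    by (rule Lim_transform_eventually)
  then show ?thesis by (simp add: power_divide)
next
  case False
  then have "real (nat \<lceil>x / L\<rceil>) ^ D * c \<le> 0" for x by (intro mult_nonneg_nonpos) auto
  moreover have "c / L ^ D \<le> 0" using False assms by (simp add: divide_nonpos_pos)
  ultimately show ?thesis by (simp add: ennreal_neg)
qed

text \<open>Fekete's argument: comparison with a grid of tiles of side \<open>L\<close> bounds the
  upper limit by the value at \<open>L\<close>, so the upper limit is at most the infimum, which is
  at most the lower limit. The hypothesis speaks of strict upper bounds \<open>c\<close> because
  optimal couplings need not exist. Since \<open>Lim\<close> is only a choice operator, convergence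
  must be proved before the limits in the definitions mean anything.\<close>

lemma Fekete_Lim:
  fixes F :: "real \<Rightarrow> ennreal"
  assumes "\<And>L c. 0 < L \<Longrightarrow> F L < ennreal c \<Longrightarrow>
    \<exists>c'\<le>c. \<forall>\<^sub>F x in at_top. F x \<le> ennreal (real (nat \<lceil>x / L\<rceil>) ^ D * c')"
  shows "((\<lambda>x. F x / ennreal (x ^ D)) \<longlongrightarrow> Lim at_top (\<lambda>x. F x / ennreal (x ^ D))) at_top"
    and "0 < L \<Longrightarrow> Lim at_top (\<lambda>x. F x / ennreal (x ^ D)) \<le> F L / ennreal (L ^ D)"
proof -
  let ?G = "\<lambda>x. F x / ennreal (x ^ D)"
  have le: "Limsup at_top ?G \<le> ?G L" if L: "0 < L" for L
  proof (rule ccontr)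
    assume "\<not> ?thesis"
    then obtain z where z: "?G L < z" "z < Limsup at_top ?G" by (auto simp: not_le dest: dense)
    then have "z < top" by (auto intro: less_le_trans)
    then obtain c where c: "z = ennreal c" "0 \<le> c" by (cases z) auto
    have "F L < ennreal c * ennreal (L ^ D)"
      using z(1) L unfolding c by (subst (asm) divide_less_ennreal) auto
    then have "F L < ennreal (c * L ^ D)" using L c by (simp add: ennreal_mult)
    from assms[OF L this] obtain c' where c': "c' \<le> c * L ^ D"
      "\<forall>\<^sub>F x in at_top. F x \<le> ennreal (real (nat \<lceil>x / L\<rceil>) ^ D * c')" by blast
    have "Limsup at_top ?G \<le> Limsup at_top (\<lambda>x. ennreal (real (nat \<lceil>x / L\<rceil>) ^ D * c') / ennreal (x ^ D))"
      by (rule Limsup_mono) (use c'(2) in \<open>eventually_elim, auto intro: divide_right_mono_ennreal\<close>)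
    also have "\<dots> = ennreal (c' / L ^ D)"
      by (intro lim_imp_Limsup tiling_tendsto L) simp
    also have "\<dots> \<le> ennreal c" using c' L by (intro ennreal_leI) (simp add: field_simps)
    finally show False using z(2) c by simp
  qed
  let ?i = "INF x\<in>{0<..}. ?G x"
  have "Limsup at_top ?G \<le> ?i" by (rule INF_greatest) (use le in auto)
  moreover have "?i \<le> Liminf at_top ?G"
  proof (rule Liminf_bounded)
    show "\<forall>\<^sub>F x in at_top. ?i \<le> ?G x"
      using eventually_gt_at_top[of 0] by eventually_elim (auto intro: INF_lower)
  qed
  moreover have "Liminf at_top ?G \<le> Limsup at_top ?G" by (rule Liminf_le_Limsup) simp
  ultimately have "Liminf at_top ?G = ?i" "Limsup at_top ?G = ?i" by (auto intro: antisym order.trans)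
  then have lim: "(?G \<longlongrightarrow> ?i) at_top" by (intro Liminf_eq_Limsup) auto
  then have eq: "Lim at_top ?G = ?i" by (intro tendsto_Lim) auto
  show "(?G \<longlongrightarrow> Lim at_top ?G) at_top" using lim eq by simp
  show "Lim at_top ?G \<le> ?G L" if "0 < L" using that unfolding eq by (auto intro: INF_lower)
qed

context compact_action
begin

text \<open>The grid exceeds the large cube by less than one tile per direction, so the volume ratio
  tends to one, and a strict inequality absorbs it.\<close>

lemma tile_distortion_eventually:
  assumes "0 < L" "a < (\<epsilon> :: real)"
  shows "\<forall>\<^sub>F x in at_top. (real (nat \<lceil>x / L\<rceil>) * L / x) ^ CARD('n) * a < \<epsilon>"
proof -
  have "((\<lambda>x. (real (nat \<lceil>x / L\<rceil>) / x * L) ^ CARD('n) * a) \<longlongrightarrow> (1 / L * L) ^ CARD('n) * a) at_top"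
    by (intro tendsto_intros tendsto_nat_ceiling_ratio assms)
  then have "\<forall>\<^sub>F x in at_top. (real (nat \<lceil>x / L\<rceil>) / x * L) ^ CARD('n) * a < \<epsilon>"
    by (rule order_tendstoD) (use assms in simp)
  then show ?thesis by simp
qed

text \<open>A general coupling cannot be tiled directly. \<open>countable_codes\<close> first
  replaces it by a code below the same strict bounds, and the integral of its information serves as
  \<open>c'\<close>.\<close>

lemma rate_distortion_tiling:
  assumes \<nu>: "\<nu> \<in> invariant_measures T" and L: "0 < L" and less: "rate_distortion_L T \<nu> L \<epsilon> < ennreal c"
  shows "\<exists>c'\<le>c. \<forall>\<^sub>F x in at_top. rate_distortion_L T \<nu> x \<epsilon> \<le> ennreal (real (nat \<lceil>x / L\<rceil>) ^ CARD('n) * c')"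
proof -
  note p = invariant_measuresD(1,2)[OF \<nu>]
  obtain \<C> where \<C>: "\<And>d j. (d, j) \<in> \<C> \<Longrightarrow> code T L d j"
    "\<And>\<nu> \<epsilon> c. prob_space \<nu> \<Longrightarrow> sets \<nu> = sets borel \<Longrightarrow> rate_distortion_L T \<nu> L \<epsilon> < ennreal c \<Longrightarrow>
      \<exists>(d, j)\<in>\<C>. (\<integral>x. d x \<partial>\<nu>) < \<epsilon> \<and> (\<integral>x. j x \<partial>\<nu>) < c"
    using countable_codes[OF L] by metis
  from \<C>(2)[OF p less] obtain d j where dj: "code T L d j" "(\<integral>x. d x \<partial>\<nu>) < \<epsilon>" "(\<integral>x. j x \<partial>\<nu>) < c"
    using \<C>(1) by blast
  have "\<forall>\<^sub>F x in at_top. rate_distortion_L T \<nu> x \<epsilon> \<le> ennreal (real (nat \<lceil>x / L\<rceil>) ^ CARD('n) * (\<integral>x. j x \<partial>\<nu>))"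
    using tile_distortion_eventually[OF L dj(2)] eventually_gt_at_top[of 0]
  proof eventually_elim
    case (elim x)
    obtain d' j' where d': "code T x d' j'"
      "\<And>\<nu>. \<nu> \<in> invariant_measures T \<Longrightarrow> (\<integral>y. d' y \<partial>\<nu>) \<le> (real (nat \<lceil>x / L\<rceil>) * L / x) ^ CARD('n) * (\<integral>y. d y \<partial>\<nu>)"
      "\<And>\<nu>. \<nu> \<in> invariant_measures T \<Longrightarrow> (\<integral>y. j' y \<partial>\<nu>) = real (nat \<lceil>x / L\<rceil>) ^ CARD('n) * (\<integral>y. j y \<partial>\<nu>)"
      using tile_code_invariant[OF dj(1) L elim(2) le_nat_ceiling_mult[OF L]] by blast
    have "rate_distortion_L T \<nu> x \<epsilon> \<le> ennreal (\<integral>y. j' y \<partial>\<nu>)"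
      by (rule rate_distortion_L_le_code[OF p d'(1) elim(2) le_less_trans[OF d'(2)[OF \<nu>] elim(1)]])
    then show ?case by (simp add: d'(3)[OF \<nu>])
  qed
  then show ?thesis using dj(3) by (intro exI[of _ "\<integral>x. j x \<partial>\<nu>"]) auto
qed

text \<open>For invariant measures \<open>rate_distortion\<close> is from here on a genuine limit
  and a lower bound for the normalised values at all positive sides.\<close>

lemmas rate_distortion_tendsto =
  Fekete_Lim(1)[of "\<lambda>L. rate_distortion_L T \<nu> L \<epsilon>" "CARD('n)" for \<nu> \<epsilon>, folded rate_distortion_def, OF rate_distortion_tiling]
lemmas rate_distortion_le =
  Fekete_Lim(2)[of "\<lambda>L. rate_distortion_L T \<nu> L \<epsilon>" "CARD('n)" for \<nu> \<epsilon>, folded rate_distortion_def, OF rate_distortion_tiling]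

lemma covering_number_tiling:
  assumes "0 < \<epsilon>" "0 < L" and less: "ennreal (log 2 (real (covering_number (bowen_dist T L) \<epsilon>))) < ennreal c"
  shows "\<exists>c'\<le>c. \<forall>\<^sub>F x in at_top. ennreal (log 2 (real (covering_number (bowen_dist T x) \<epsilon>))) \<le>
    ennreal (real (nat \<lceil>x / L\<rceil>) ^ CARD('n) * c')"
proof (intro exI conjI)
  let ?c = "log 2 (real (covering_number (bowen_dist T L) \<epsilon>))"
  show "?c \<le> c" using less by (meson ennreal_leI leD linear)
  show "\<forall>\<^sub>F x in at_top. ennreal (log 2 (real (covering_number (bowen_dist T x) \<epsilon>))) \<le>
    ennreal (real (nat \<lceil>x / L\<rceil>) ^ CARD('n) * ?c)"
    using eventually_gt_at_top[of 0]
  proof eventually_elim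
    case (elim x)
    let ?n = "nat \<lceil>x / L\<rceil>"
    have pos: "0 < covering_number (bowen_dist T x) \<epsilon>" "0 < covering_number (bowen_dist T L) \<epsilon>"
      using covering_number_pos assms elim by auto
    have "real (covering_number (bowen_dist T x) \<epsilon>) \<le> real (covering_number (bowen_dist T L) \<epsilon>) ^ (?n ^ CARD('n))"
      using covering_number_tile[OF assms(2) elim le_nat_ceiling_mult[OF assms(2)] assms(1)]
      by (metis of_nat_le_iff of_nat_power)
    then have "log 2 (real (covering_number (bowen_dist T x) \<epsilon>)) \<le> log 2 (real (covering_number (bowen_dist T L) \<epsilon>) ^ (?n ^ CARD('n)))"
      using pos by (subst log_le_cancel_iff) auto
    also have "\<dots> = real ?n ^ CARD('n) * ?c" using pos by (simp add: log_nat_power)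
    finally show ?case by (rule ennreal_leI)
  qed
qed

text \<open>The code of an optimal cover proves the inequality already for each side
  \<open>L\<close>; both sides then pass to their limits. This supplies the bound uniform in
  \<open>\<nu>\<close> for dominated convergence arguments.\<close>

lemma rate_distortion_le_metric_entropy_rate:
  assumes \<nu>: "\<nu> \<in> invariant_measures T" and \<epsilon>: "0 < \<epsilon>"
  shows "rate_distortion T \<nu> \<epsilon> \<le> metric_entropy_rate T \<epsilon>"
proof (rule tendsto_le)
  show "((\<lambda>L. rate_distortion_L T \<nu> L \<epsilon> / ennreal (L ^ CARD('n))) \<longlongrightarrow> rate_distortion T \<nu> \<epsilon>) at_top"
    by (rule rate_distortion_tendsto[OF \<nu>])
  show "((\<lambda>L. ennreal (log 2 (real (covering_number (bowen_dist T L) \<epsilon>))) / ennreal (L ^ CARD('n)))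
    \<longlongrightarrow> metric_entropy_rate T \<epsilon>) at_top"
    unfolding metric_entropy_rate_def by (rule Fekete_Lim(1)) (rule covering_number_tiling[OF \<epsilon>])
  show "\<forall>\<^sub>F L in at_top. rate_distortion_L T \<nu> L \<epsilon> / ennreal (L ^ CARD('n)) \<le>
    ennreal (log 2 (real (covering_number (bowen_dist T L) \<epsilon>))) / ennreal (L ^ CARD('n))"
    using eventually_gt_at_top[of 0]
  proof eventually_elim
    case (elim L)
    note p = invariant_measuresD(1,2)[OF \<nu>]
    interpret prob_space \<nu> by (rule p)
    obtain \<U> where \<U>: "small_cover (bowen_dist T L) \<epsilon> \<U>" "card \<U> = covering_number (bowen_dist T L) \<epsilon>"
      using covering_number_attained[OF elim \<epsilon>] .
    obtain d where d: "code T L d (\<lambda>_. log 2 (real (card \<U>)))" "\<And>x. d x < \<epsilon>"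
      by (rule cover_code[OF elim \<U>(1)]) blast
    have "(\<integral>x. d x \<partial>\<nu>) < \<epsilon>"
      using expectation_less[OF code_integrable(1)[OF d(1) elim p]] d(2) by simp
    from rate_distortion_L_le_code[OF p d(1) elim this] show ?case
      by (intro divide_right_mono_ennreal) (simp add: \<U>(2) prob_space)
  qed
qed simp

end

section \<open>Mixtures of invariant measures\<close>

locale mixture = compact_action T for T :: "real ^ 'n::finite \<Rightarrow> 'a::polish_space \<Rightarrow> 'a" +
  fixes \<Lambda> :: "'a measure measure" and \<mu> :: "'a measure"
  assumes prob_\<Lambda>: "prob_space \<Lambda>"
    and sets_\<Lambda>: "sets \<Lambda> = sets (borel_of (weak_star_topology T))"
    and \<mu>_inv: "\<mu> \<in> invariant_measures T"
    and \<mu>_eq: "\<And>A. A \<in> sets borel \<Longrightarrow> emeasure \<mu> A = (\<integral>\<^sup>+\<nu>. emeasure \<nu> A \<partial>\<Lambda>)"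
begin

sublocale \<Lambda>: prob_space \<Lambda> by (rule prob_\<Lambda>)

lemma topspace_weak_star: "topspace (weak_star_topology T) = invariant_measures T"
proof -
  have "invariant_measures T = {\<nu> \<in> invariant_measures T. (\<integral>x. (\<lambda>_. 0 :: real) x \<partial>\<nu>) \<in> UNIV}" by simp
  then have "invariant_measures T \<in> {{\<nu> \<in> invariant_measures T. (\<integral>x. f x \<partial>\<nu>) \<in> U} |
        (f :: 'a \<Rightarrow> real) U. continuous_on UNIV f \<and> open U}"
    using continuous_on_const open_UNIV by blast
  then show ?thesis unfolding weak_star_topology_def topology_generated_by_topspace by blast
qed

lemma space_\<Lambda>: "space \<Lambda> = invariant_measures T"
  using sets_eq_imp_space_eq[OF sets_\<Lambda>] by (simp add: borel_of_def space_measure_of_conv topspace_weak_star)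

lemma openin_sets_\<Lambda>:
  assumes "openin (weak_star_topology T) U"
  shows "U \<in> sets \<Lambda>"
proof -
  have *: "{U. openin (weak_star_topology T) U} \<subseteq> Pow (topspace (weak_star_topology T))"
    using openin_subset by blast
  show ?thesis unfolding sets_\<Lambda> borel_of_def sets_measure_of[OF *] using assms by (intro sigma_sets.Basic) simp
qed

lemma integral_continuous_measurable:
  fixes f :: "'a \<Rightarrow> real"
  assumes "continuous_on UNIV f"
  shows "(\<lambda>\<nu>. \<integral>x. f x \<partial>\<nu>) \<in> borel_measurable \<Lambda>"
proof (rule borel_measurableI)
  fix U :: "real set" assume "open U"
  then have "openin (weak_star_topology T) {\<nu> \<in> invariant_measures T. (\<integral>x. f x \<partial>\<nu>) \<in> U}"
    unfolding weak_star_topology_def using assms by (intro topology_generated_by_Basis) blast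
  moreover have "(\<lambda>\<nu>. \<integral>x. f x \<partial>\<nu>) -` U \<inter> space \<Lambda> = {\<nu> \<in> invariant_measures T. (\<integral>x. f x \<partial>\<nu>) \<in> U}"
    by (auto simp: space_\<Lambda>)
  ultimately show "(\<lambda>\<nu>. \<integral>x. f x \<partial>\<nu>) -` U \<inter> space \<Lambda> \<in> sets \<Lambda>" by (simp add: openin_sets_\<Lambda>)
qed

text \<open>The weak-star topology controls integrals of continuous functions only. The indicator of
  a closed set is the limit of tent functions of the distance to it, with 1 as dominating
  function.\<close>

lemma closed_emeasure_measurable:
  assumes A: "closed A"
  shows "(\<lambda>\<nu>. emeasure \<nu> A) \<in> borel_measurable \<Lambda>"
\<comment> \<open>The empty set is separated because \<open>infdist\<close> to it is 0 by
  convention, so the tent functions would all be 1.\<close>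
proof (cases "A = {}")
  case False
  define f where "f n x = max 0 (1 - real n * infdist x A)" for n x
  have cont: "continuous_on UNIV (f n)" for n
    unfolding f_def by (intro continuous_intros)
  have lim: "(\<lambda>n. \<integral>x. f n x \<partial>\<nu>) \<longlonglongrightarrow> measure \<nu> A" if \<nu>: "\<nu> \<in> space \<Lambda>" for \<nu>
  proof -
    have p: "prob_space \<nu>" "sets \<nu> = sets borel" using \<nu> invariant_measuresD by (auto simp: space_\<Lambda>)
    interpret prob_space \<nu> by (rule p)
    have m: "f n \<in> borel_measurable \<nu>" for n
      using borel_measurable_continuous_onI[OF cont] measurable_cong_sets[OF p(2) refl, of "borel :: real measure"] by simp
    have As: "A \<in> sets \<nu>" using A p(2) by simp
    have "(\<lambda>n. \<integral>x. f n x \<partial>\<nu>) \<longlonglongrightarrow> (\<integral>x. indicator A x \<partial>\<nu>)"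
    proof (rule integral_dominated_convergence[where w = "\<lambda>_. 1"])
      show "AE x in \<nu>. (\<lambda>n. f n x) \<longlonglongrightarrow> indicator A x"
      proof (rule AE_I2)
        fix x
        show "(\<lambda>n. f n x) \<longlonglongrightarrow> indicator A x"
        proof (cases "x \<in> A")
          case True
          then show ?thesis using A by (simp add: f_def)
        next
          case outside: False
          then have pos: "0 < infdist x A"
            using A False infdist_nonneg[of x A] by (auto simp: less_le in_closed_iff_infdist_zero)
          obtain N where N: "1 < real N * infdist x A" using reals_Archimedean3[OF pos] by blast
          have "f n x = 0" if "N \<le> n" for n
          proof -
            have "real N * infdist x A \<le> real n * infdist x A" using that pos by (intro mult_right_mono) auto
            then show ?thesis using N by (simp add: f_def)
          qed
          then have "\<forall>\<^sub>F n in sequentially. f n x = 0" by (auto simp: eventually_sequentially)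
          then show ?thesis using outside by (simp add: tendsto_eventually)
        qed
      qed
      show "AE x in \<nu>. norm (f n x) \<le> 1" for n
        by (rule AE_I2) (auto simp: f_def infdist_nonneg)
    qed (use m As in auto)
    then show ?thesis using As by simp
  qed
  have "(\<lambda>\<nu>. measure \<nu> A) \<in> borel_measurable \<Lambda>"
    by (rule borel_measurable_LIMSEQ_real[OF lim integral_continuous_measurable[OF cont]])
  then have "(\<lambda>\<nu>. ennreal (measure \<nu> A)) \<in> borel_measurable \<Lambda>" by simp
  moreover have "emeasure \<nu> A = ennreal (measure \<nu> A)" if "\<nu> \<in> space \<Lambda>" for \<nu>
  proof -
    interpret prob_space \<nu> using that invariant_measuresD by (auto simp: space_\<Lambda>)
    show ?thesis by (rule emeasure_eq_measure)
  qed
  ultimately show ?thesis by (simp cong: measurable_cong)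
qed simp

text \<open>Closed sets form a generator of the Borel sets that is stable under intersection, so
  measurability of their masses suffices. The identity thereby becomes a probability kernel, and
  \<open>\<bind>\<close> can be applied to \<open>\<Lambda>\<close>.\<close>

lemma id_kernel: "(\<lambda>\<nu>. \<nu>) \<in> measurable \<Lambda> (subprob_algebra borel)"
proof (rule measurable_prob_algebraD, rule measurable_prob_algebra_generated)
  show "sets borel = sigma_sets UNIV (Collect (closed :: 'a set \<Rightarrow> bool))"
    by (subst borel_eq_closed) (simp add: sets_measure_of)
  show "Int_stable (Collect (closed :: 'a set \<Rightarrow> bool))" by (auto simp: Int_stable_def)
qed (use invariant_measuresD closed_emeasure_measurable in \<open>auto simp: space_\<Lambda>\<close>)

text \<open>The law of a pair: \<open>\<nu>\<close> is drawn from \<open>\<Lambda>\<close>, then a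
  point from \<open>\<nu>\<close>. The second coordinate has law \<open>\<mu>\<close>, while the
  first remains available for selecting a code.\<close>

definition joint :: "('a measure \<times> 'a) measure" where
  "joint = \<Lambda> \<bind> (\<lambda>\<nu>. distr \<nu> (\<Lambda> \<Otimes>\<^sub>M borel) (Pair \<nu>))"

lemma joint_kernel: "(\<lambda>\<nu>. distr \<nu> (\<Lambda> \<Otimes>\<^sub>M borel) (Pair \<nu>)) \<in> measurable \<Lambda> (subprob_algebra (\<Lambda> \<Otimes>\<^sub>M borel))"
  by (rule measurable_distr2[OF _ id_kernel]) simp

lemma Pair_measurable:
  assumes "\<nu> \<in> space \<Lambda>"
  shows "Pair \<nu> \<in> measurable \<nu> (\<Lambda> \<Otimes>\<^sub>M borel)"
proof -
  have "sets \<nu> = sets borel" using assms invariant_measuresD by (simp add: space_\<Lambda>)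
  then have "measurable \<nu> (\<Lambda> \<Otimes>\<^sub>M (borel :: 'a measure)) = measurable borel (\<Lambda> \<Otimes>\<^sub>M borel)"
    by (intro measurable_cong_sets refl)
  then show ?thesis using measurable_Pair1'[OF assms, of "borel :: 'a measure"] by simp
qed

lemma sets_joint: "sets joint = sets (\<Lambda> \<Otimes>\<^sub>M borel)"
  unfolding joint_def by (rule sets_bind) (auto simp: \<Lambda>.not_empty)

lemma space_joint: "space joint = space \<Lambda> \<times> UNIV"
  using sets_eq_imp_space_eq[OF sets_joint] by (simp add: space_pair_measure)

lemma prob_space_joint: "prob_space joint"
  unfolding joint_def
proof (rule \<Lambda>.prob_space_bind[OF AE_I2 joint_kernel])
  fix \<nu> assume "\<nu> \<in> space \<Lambda>"
  then show "prob_space (distr \<nu> (\<Lambda> \<Otimes>\<^sub>M borel) (Pair \<nu>))"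
    using invariant_measuresD(1) by (intro prob_space.prob_space_distr Pair_measurable) (auto simp: space_\<Lambda>)
qed

lemma integral_joint:
  fixes g :: "'a measure \<times> 'a \<Rightarrow> real"
  assumes g: "g \<in> borel_measurable (\<Lambda> \<Otimes>\<^sub>M borel)" and b: "\<And>p. \<bar>g p\<bar> \<le> c"
  shows "(\<integral>p. g p \<partial>joint) = (\<integral>\<nu>. \<integral>x. g (\<nu>, x) \<partial>\<nu> \<partial>\<Lambda>)"
proof -
  have "(\<integral>p. g p \<partial>joint) = (\<integral>\<nu>. integral\<^sup>L (distr \<nu> (\<Lambda> \<Otimes>\<^sub>M borel) (Pair \<nu>)) g \<partial>\<Lambda>)"
    unfolding joint_def
  proof (rule integral_bind[where K = "\<Lambda> \<Otimes>\<^sub>M borel" and B = c and B' = 1, OF g _ joint_kernel])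
    show "finite_measure \<Lambda>" by unfold_locales
    show "AE \<nu> in \<Lambda>. emeasure (distr \<nu> (\<Lambda> \<Otimes>\<^sub>M borel) (Pair \<nu>)) (space (distr \<nu> (\<Lambda> \<Otimes>\<^sub>M borel) (Pair \<nu>))) \<le> ennreal 1"
    proof (rule AE_I2)
      fix \<nu> assume \<nu>: "\<nu> \<in> space \<Lambda>"
      interpret prob_space "distr \<nu> (\<Lambda> \<Otimes>\<^sub>M borel) (Pair \<nu>)"
        using \<nu> invariant_measuresD(1) by (intro prob_space.prob_space_distr Pair_measurable) (auto simp: space_\<Lambda>)
      show "emeasure (distr \<nu> (\<Lambda> \<Otimes>\<^sub>M borel) (Pair \<nu>)) (space (distr \<nu> (\<Lambda> \<Otimes>\<^sub>M borel) (Pair \<nu>))) \<le> ennreal 1"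
        by (simp add: emeasure_space_1 del: space_distr)
    qed
  qed (use b in auto)
  also have "\<dots> = (\<integral>\<nu>. \<integral>x. g (\<nu>, x) \<partial>\<nu> \<partial>\<Lambda>)"
    by (intro Bochner_Integration.integral_cong refl integral_distr[OF Pair_measurable g])
  finally show ?thesis .
qed

lemma distr_joint_snd: "distr joint borel snd = \<mu>"
proof (rule measure_eqI)
  show "sets (distr joint borel snd) = sets \<mu>" using invariant_measuresD(2)[OF \<mu>_inv] by simp
  fix A assume "A \<in> sets (distr joint borel snd)"
  then have A: "A \<in> sets borel" by simp
  have ms: "snd \<in> measurable joint borel" unfolding measurable_cong_sets[OF sets_joint refl] by simp
  have set: "snd -` A \<inter> space joint \<in> sets (\<Lambda> \<Otimes>\<^sub>M borel)" using measurable_sets[OF ms A] by (simp add: sets_joint)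
  have "emeasure (distr joint borel snd) A = emeasure joint (snd -` A \<inter> space joint)"
    by (rule emeasure_distr[OF ms A])
  also have "\<dots> = (\<integral>\<^sup>+\<nu>. emeasure (distr \<nu> (\<Lambda> \<Otimes>\<^sub>M borel) (Pair \<nu>)) (snd -` A \<inter> space joint) \<partial>\<Lambda>)"
    unfolding joint_def[symmetric] using set
    by (subst (1) joint_def) (rule emeasure_bind[OF \<Lambda>.not_empty joint_kernel])
  also have "\<dots> = (\<integral>\<^sup>+\<nu>. emeasure \<nu> A \<partial>\<Lambda>)"
  proof (rule nn_integral_cong)
    fix \<nu> assume \<nu>: "\<nu> \<in> space \<Lambda>"
    have "space \<nu> = UNIV" using sets_eq_imp_space_eq[OF invariant_measuresD(2)] \<nu> by (auto simp: space_\<Lambda>)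
    then have "Pair \<nu> -` (snd -` A \<inter> space joint) \<inter> space \<nu> = A" using \<nu> by (auto simp: space_joint)
    then show "emeasure (distr \<nu> (\<Lambda> \<Otimes>\<^sub>M borel) (Pair \<nu>)) (snd -` A \<inter> space joint) = emeasure \<nu> A"
      by (simp add: emeasure_distr[OF Pair_measurable[OF \<nu>] set])
  qed
  finally show "emeasure (distr joint borel snd) A = emeasure \<mu> A" by (simp add: \<mu>_eq[OF A])
qed

text \<open>The labels are pairs of a code index and a label of that code, and the kernel on
  \<open>joint\<close> uses the code with index \<open>s \<nu>\<close>. The reference gives each
  index the weight \<open>1 / (N + 1)\<close>, which adds exactly \<open>log 2 (real N + 1)\<close>
  to the information at every point.\<close>

lemma mixture_rate_le:
  assumes s: "s \<in> measurable \<Lambda> (count_space UNIV)" and sN: "\<And>\<nu>. \<nu> \<in> space \<Lambda> \<Longrightarrow> s \<nu> \<le> N"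
    and code: "\<And>i. i \<le> N \<Longrightarrow> code T L (d i) (j i)" and L: "0 < L"
    and less: "(\<integral>\<nu>. \<integral>x. d (s \<nu>) x \<partial>\<nu> \<partial>\<Lambda>) < \<epsilon>"
  shows "rate_distortion_L T \<mu> L \<epsilon> \<le> ennreal ((\<integral>\<nu>. \<integral>x. j (s \<nu>) x \<partial>\<nu> \<partial>\<Lambda>) + log 2 (real N + 1))"
proof -
  define P where "P i t \<longleftrightarrow> (case t of (B :: nat set, f, W, r) \<Rightarrow> kernel_on borel B W r \<and> (\<forall>b\<in>B. f b \<in> borel_measurable borel) \<and>
     d i = (\<lambda>x. \<Sum>b\<in>B. W b x * mean_dist T L x (f b)) \<and> j i = (\<lambda>x. \<Sum>b\<in>B. W b x * log 2 (W b x / r b)))" for i t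
  have "\<forall>i. \<exists>t. i \<le> N \<longrightarrow> P i t"
    using code unfolding code_def P_def by fastforce
  then obtain t where t: "\<And>i. i \<le> N \<Longrightarrow> P i (t i)" by metis
  define B where "B i = fst (t i)" for i
  define f where "f i = fst (snd (t i))" for i
  define W where "W i = fst (snd (snd (t i)))" for i
  define r where "r i = snd (snd (snd (t i)))" for i
  have k: "kernel_on borel (B i) (W i) (r i)"
    and f: "b \<in> B i \<Longrightarrow> f i b \<in> borel_measurable borel"
    and d: "d i = (\<lambda>x. \<Sum>b\<in>B i. W i b x * mean_dist T L x (f i b))"
    and j: "j i = (\<lambda>x. \<Sum>b\<in>B i. W i b x * log 2 (W i b x / r i b))" if "i \<le> N" for i b
    using t[OF that] by (simp_all add: P_def B_def f_def W_def r_def split_beta)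
  let ?B = "Sigma {..N} B"
  define V where "V p q = (if s (fst q) = fst p then W (fst p) (snd p) (snd q) else 0)" for p :: "nat \<times> nat" and q :: "'a measure \<times> 'a"
  define R where "R p = r (fst p) (snd p) / (real N + 1)" for p :: "nat \<times> nat"
  define F where "F p = f (fst p) (snd p)" for p :: "nat \<times> nat"
  note K = kernel_onD[OF k]
  have finB: "finite ?B" using K(1) by (intro finite_SigmaI) auto
  \<comment> \<open>Only labels whose first component is \<open>s (fst q)\<close> carry weight, so
    the sum over all pairs collapses to the sum over the selected code.\<close>
  have select: "(\<Sum>p\<in>?B. V p q * \<phi> p (V p q)) = (\<Sum>b\<in>B (s (fst q)). W (s (fst q)) b (snd q) * \<phi> (s (fst q), b) (W (s (fst q)) b (snd q)))"
    if "q \<in> space joint" for q and \<phi> :: "nat \<times> nat \<Rightarrow> real \<Rightarrow> real"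
  proof -
    have sq: "s (fst q) \<le> N" using that sN by (auto simp: space_joint)
    have "(\<Sum>p\<in>?B. V p q * \<phi> p (V p q)) = (\<Sum>i\<le>N. \<Sum>b\<in>B i. V (i, b) q * \<phi> (i, b) (V (i, b) q))"
      using K(1) by (subst sum.Sigma) (auto simp: split_beta)
    also have "\<dots> = (\<Sum>i\<le>N. if i = s (fst q) then (\<Sum>b\<in>B i. W i b (snd q) * \<phi> (i, b) (W i b (snd q))) else 0)"
      by (intro sum.cong refl) (auto simp: V_def)
    also have "\<dots> = (\<Sum>b\<in>B (s (fst q)). W (s (fst q)) b (snd q) * \<phi> (s (fst q), b) (W (s (fst q)) b (snd q)))"
      using sq by simp
    finally show ?thesis .
  qed
  have sn: "(\<lambda>q. s (fst q)) \<in> measurable joint (count_space UNIV)"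
    unfolding measurable_cong_sets[OF sets_joint refl] by (rule measurable_compose[OF measurable_fst s])
  have snd_m: "snd \<in> measurable joint borel" unfolding measurable_cong_sets[OF sets_joint refl] by simp
  have kernel: "kernel_on joint ?B V R"
    unfolding kernel_on_def
  proof (intro conjI ballI finB)
    fix p assume p: "p \<in> ?B"
    then have p': "fst p \<le> N" "snd p \<in> B (fst p)" by auto
    have [measurable]: "(\<lambda>q. W (fst p) (snd p) (snd q)) \<in> borel_measurable joint"
      by (rule measurable_compose[OF snd_m K(2)[OF p']])
    have [measurable]: "(\<lambda>q. s (fst q)) \<in> measurable joint (count_space UNIV)" by (rule sn)
    show "V p \<in> borel_measurable joint" unfolding V_def[abs_def] by measurable
    show "0 \<le> V p q" for q unfolding V_def using K(3)[OF p'] by simp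
    show "0 < R p" unfolding R_def using K(5)[OF p'] by simp
  next
    fix q assume q: "q \<in> space joint"
    then have "s (fst q) \<le> N" using sN by (auto simp: space_joint)
    then show "(\<Sum>p\<in>?B. V p q) = 1" using select[OF q, of "\<lambda>_ _. 1"] K(4) by simp
  next
    have "(\<Sum>p\<in>?B. R p) = (\<Sum>i\<le>N. \<Sum>b\<in>B i. R (i, b))"
      using K(1) by (subst sum.Sigma) (auto simp: split_beta)
    also have "\<dots> = (\<Sum>i\<le>N. (\<Sum>b\<in>B i. r i b) / (real N + 1))"
      by (simp add: R_def sum_divide_distrib)
    also have "\<dots> \<le> (\<Sum>i\<le>N. 1 / (real N + 1))"
      using K(6) by (intro sum_mono divide_right_mono) auto
    also have "\<dots> = 1" by (simp add: field_simps)
    finally show "(\<Sum>p\<in>?B. R p) \<le> 1" .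
  qed
  have F: "F p \<in> borel_measurable borel" if "p \<in> ?B" for p using f that by (auto simp: F_def)
  note c = codeD[OF code L]
  have dist_eq: "(\<Sum>p\<in>?B. V p q * mean_dist T L (snd q) (F p)) = d (s (fst q)) (snd q)" if "q \<in> space joint" for q
    using select[OF that, of "\<lambda>p _. mean_dist T L (snd q) (F p)"] d sN that by (auto simp: F_def space_joint)
  have info_eq: "(\<Sum>p\<in>?B. V p q * log 2 (V p q / R p)) = j (s (fst q)) (snd q) + log 2 (real N + 1)" if q: "q \<in> space joint" for q
  proof -
    let ?i = "s (fst q)" and ?x = "snd q"
    have i: "?i \<le> N" using sN q by (auto simp: space_joint)
    have "(\<Sum>p\<in>?B. V p q * log 2 (V p q / R p)) = (\<Sum>b\<in>B ?i. W ?i b ?x * log 2 (W ?i b ?x / (r ?i b / (real N + 1))))"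
      using select[OF q, of "\<lambda>p w. log 2 (w / R p)"] by (simp add: R_def)
    also have "\<dots> = (\<Sum>b\<in>B ?i. W ?i b ?x * log 2 (W ?i b ?x / r ?i b) + W ?i b ?x * log 2 (real N + 1))"
    proof (intro sum.cong refl)
      fix b assume b: "b \<in> B ?i"
      show "W ?i b ?x * log 2 (W ?i b ?x / (r ?i b / (real N + 1))) =
        W ?i b ?x * log 2 (W ?i b ?x / r ?i b) + W ?i b ?x * log 2 (real N + 1)"
      proof (cases "W ?i b ?x = 0")
        case False
        then have "0 < W ?i b ?x" using K(3)[OF i b, of ?x] by (auto simp: less_le)
        then have "0 < W ?i b ?x / r ?i b" using K(5)[OF i b] by simp
        then have "log 2 (W ?i b ?x / r ?i b * (real N + 1)) = log 2 (W ?i b ?x / r ?i b) + log 2 (real N + 1)"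
          by (intro log_mult_pos) auto
        then have "W ?i b ?x * log 2 (W ?i b ?x / r ?i b * (real N + 1)) =
            W ?i b ?x * log 2 (W ?i b ?x / r ?i b) + W ?i b ?x * log 2 (real N + 1)"
          by (simp only: distrib_left)
        then show ?thesis by (simp only: divide_divide_eq_right times_divide_eq_left)
      qed simp
    qed
    also have "\<dots> = j ?i ?x + log 2 (real N + 1)"
      using K(4)[OF i, of ?x] by (simp add: j[OF i] sum.distrib sum_distrib_right[symmetric])
    finally show ?thesis .
  qed
  have swap: "(\<integral>q. g (s (fst q)) (snd q) \<partial>joint) = (\<integral>\<nu>. \<integral>x. g (s \<nu>) x \<partial>\<nu> \<partial>\<Lambda>)"
    and swap_int: "integrable joint (\<lambda>q. g (s (fst q)) (snd q))"
    if g: "\<And>i. i \<le> N \<Longrightarrow> g i \<in> borel_measurable borel" "\<And>i x. i \<le> N \<Longrightarrow> 0 \<le> g i x" "\<And>i. i \<le> N \<Longrightarrow> \<exists>c. \<forall>x. g i x \<le> c"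
    for g :: "nat \<Rightarrow> 'a \<Rightarrow> real"
  proof -
    obtain c where c: "\<And>i x. i \<le> N \<Longrightarrow> g i x \<le> c i" using g(3) by metis
    \<comment> \<open>Nothing is assumed about \<open>g i\<close> beyond \<open>N\<close>; cutting
      it off there gives measurability and one bound for all indices.\<close>
    define h where "h i x = (if i \<le> N then g i x else 0)" for i x
    have hb: "\<bar>h i x\<bar> \<le> (\<Sum>i\<le>N. \<bar>c i\<bar>)" for i x
    proof (cases "i \<le> N")
      case True
      have "\<bar>h i x\<bar> \<le> \<bar>c i\<bar>" using True g(2)[OF True, of x] c[OF True, of x] by (simp add: h_def)
      also have "\<dots> \<le> (\<Sum>i\<le>N. \<bar>c i\<bar>)" using True by (intro member_le_sum) auto
      finally show ?thesis .
    qed (auto simp: h_def sum_nonneg)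
    have hm: "(\<lambda>q. h (s (fst q)) (snd q)) \<in> borel_measurable (\<Lambda> \<Otimes>\<^sub>M borel)"
    proof (rule measurable_compose_countable[OF _ measurable_compose[OF measurable_fst s]])
      fix i
      have "h i \<in> borel_measurable borel" using g(1)[of i] by (cases "i \<le> N") (simp_all add: h_def[abs_def])
      then show "(\<lambda>q. h i (snd q)) \<in> borel_measurable (\<Lambda> \<Otimes>\<^sub>M borel)" by (rule measurable_compose[OF measurable_snd])
    qed
    have hg: "h (s \<nu>) x = g (s \<nu>) x" if "\<nu> \<in> space \<Lambda>" for \<nu> x using sN[OF that] by (simp add: h_def)
    have "(\<integral>q. g (s (fst q)) (snd q) \<partial>joint) = (\<integral>q. h (s (fst q)) (snd q) \<partial>joint)"
      by (intro Bochner_Integration.integral_cong refl) (auto simp: space_joint hg)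
    also have "\<dots> = (\<integral>\<nu>. \<integral>x. h (s \<nu>) x \<partial>\<nu> \<partial>\<Lambda>)" using integral_joint[OF hm hb] by simp
    also have "\<dots> = (\<integral>\<nu>. \<integral>x. g (s \<nu>) x \<partial>\<nu> \<partial>\<Lambda>)"
      by (intro Bochner_Integration.integral_cong refl) (simp add: hg)
    finally show "(\<integral>q. g (s (fst q)) (snd q) \<partial>joint) = (\<integral>\<nu>. \<integral>x. g (s \<nu>) x \<partial>\<nu> \<partial>\<Lambda>)" .
    interpret prob_space joint by (rule prob_space_joint)
    have "integrable joint (\<lambda>q. h (s (fst q)) (snd q))"
      using hm hb measurable_cong_sets[OF sets_joint refl, of "borel :: real measure"]
      by (intro integrable_const_bound[where B = "\<Sum>i\<le>N. \<bar>c i\<bar>"] AE_I2) auto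
    then show "integrable joint (\<lambda>q. g (s (fst q)) (snd q))"
      by (rule Bochner_Integration.integrable_cong[THEN iffD1, rotated -1]) (auto simp: space_joint hg)
  qed
  have "(\<integral>q. (\<Sum>p\<in>?B. V p q * mean_dist T L (snd q) (F p)) \<partial>joint) = (\<integral>q. d (s (fst q)) (snd q) \<partial>joint)"
    by (intro Bochner_Integration.integral_cong refl dist_eq)
  also have "\<dots> = (\<integral>\<nu>. \<integral>x. d (s \<nu>) x \<partial>\<nu> \<partial>\<Lambda>)" using c(1-3) by (intro swap) blast+
  finally have dist: "(\<integral>q. (\<Sum>p\<in>?B. V p q * mean_dist T L (snd q) (F p)) \<partial>joint) < \<epsilon>" using less by simp
  interpret J: prob_space joint by (rule prob_space_joint)
  have "rate_distortion_L T \<mu> L \<epsilon> \<le> ennreal (\<integral>q. (\<Sum>p\<in>?B. V p q * log 2 (V p q / R p)) \<partial>joint)"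
    using rate_distortion_L_le[OF prob_space_joint snd_m kernel F L dist] by (simp add: distr_joint_snd)
  also have "(\<integral>q. (\<Sum>p\<in>?B. V p q * log 2 (V p q / R p)) \<partial>joint) = (\<integral>q. j (s (fst q)) (snd q) + log 2 (real N + 1) \<partial>joint)"
    by (intro Bochner_Integration.integral_cong refl info_eq)
  also have "\<dots> = (\<integral>q. j (s (fst q)) (snd q) \<partial>joint) + log 2 (real N + 1)"
    using swap_int[of j] c(4-6) by (subst Bochner_Integration.integral_add) (auto simp: J.prob_space)
  also have "(\<integral>q. j (s (fst q)) (snd q) \<partial>joint) = (\<integral>\<nu>. \<integral>x. j (s \<nu>) x \<partial>\<nu> \<partial>\<Lambda>)" using c(4-6) by (intro swap) blast+
  finally show ?thesis .
qed

end

section \<open>Convexity of the rate distortion function\<close>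

text \<open>The information per volume that the code guarantees for \<open>\<nu>\<close>. A code
  that misses the distortion level gets the value infinity and so drops out of every
  infimum.\<close>

definition code_rate :: "nat \<Rightarrow> 'a measure \<Rightarrow> real \<Rightarrow> real \<Rightarrow> ('a \<Rightarrow> real) \<Rightarrow> ('a \<Rightarrow> real) \<Rightarrow> ennreal" where
  "code_rate D \<nu> \<epsilon> L d j =
     (if (\<integral>x. d x \<partial>\<nu>) < \<epsilon> then ennreal ((\<integral>x. j x \<partial>\<nu>) / L ^ D) else \<infinity>)"

context compact_action
begin

lemma rate_distortion_le_code_rate:
  assumes \<nu>: "\<nu> \<in> invariant_measures T" and L: "0 < L" and code: "code T L d j"
  shows "rate_distortion T \<nu> \<epsilon> \<le> code_rate CARD('n) \<nu> \<epsilon> L d j"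
proof (cases "(\<integral>x. d x \<partial>\<nu>) < \<epsilon>")
  case True
  note p = invariant_measuresD(1,2)[OF \<nu>]
  have "0 \<le> (\<integral>x. j x \<partial>\<nu>)" using codeD(5)[OF code L] by simp
  have "rate_distortion T \<nu> \<epsilon> \<le> rate_distortion_L T \<nu> L \<epsilon> / ennreal (L ^ CARD('n))"
    by (rule rate_distortion_le[OF \<nu> _ _ L])
  also have "\<dots> \<le> ennreal (\<integral>x. j x \<partial>\<nu>) / ennreal (L ^ CARD('n))"
    by (intro divide_right_mono_ennreal rate_distortion_L_le_code[OF p code L True])
  also have "\<dots> = ennreal ((\<integral>x. j x \<partial>\<nu>) / L ^ CARD('n))"
    using L codeD(5)[OF code L] by (simp add: divide_ennreal)
  finally show ?thesis using True by (simp add: code_rate_def)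
qed (simp add: code_rate_def)

text \<open>Every code bounds the rate from above by the infimum form of the limit. Conversely,
  near-optimal values occur at large integer sides, where a countable family of codes comes
  arbitrarily close to them. As a countable infimum the rate is accessible to measurability and
  truncation.\<close>

lemma rate_distortion_eq_INF_codes:
  assumes \<epsilon>: "0 < \<epsilon>"
  obtains L d j c where "\<And>i :: nat. 0 < L i" "\<And>i. code T (L i) (d i) (j i)"
    "\<And>x. d 0 x < \<epsilon>" "j 0 = (\<lambda>_. c)"
    "\<And>\<nu>. \<nu> \<in> invariant_measures T \<Longrightarrow>
       rate_distortion T \<nu> \<epsilon> = (INF i. code_rate CARD('n) \<nu> \<epsilon> (L i) (d i) (j i))"
proof -
  obtain \<U> where \<U>: "small_cover (bowen_dist T 1) \<epsilon> \<U>" using small_cover_exists[of 1 \<epsilon>] \<epsilon> by auto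
  obtain d0 where d0: "code T 1 d0 (\<lambda>_. log 2 (real (card \<U>)))" "\<And>x. d0 x < \<epsilon>"
    by (rule cover_code[OF _ \<U>]) auto
  define net where "net m \<C> \<longleftrightarrow> countable \<C> \<and> (\<forall>(d, j)\<in>\<C>. code T (real (Suc m)) d j) \<and>
     (\<forall>\<nu> c. prob_space \<nu> \<longrightarrow> sets \<nu> = sets borel \<longrightarrow> rate_distortion_L T \<nu> (real (Suc m)) \<epsilon> < ennreal c \<longrightarrow>
      (\<exists>(d, j)\<in>\<C>. (\<integral>x. d x \<partial>\<nu>) < \<epsilon> \<and> (\<integral>x. j x \<partial>\<nu>) < c))" for m \<C>
  have "\<exists>\<C>. net m \<C>" for m
  proof (rule countable_codes[of "real (Suc m)"])
    fix \<C> assume "countable \<C>" "\<And>d j. (d, j) \<in> \<C> \<Longrightarrow> code T (real (Suc m)) d j"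
      "\<And>\<nu> \<epsilon> c. prob_space \<nu> \<Longrightarrow> sets \<nu> = sets borel \<Longrightarrow> rate_distortion_L T \<nu> (real (Suc m)) \<epsilon> < ennreal c \<Longrightarrow>
        \<exists>(d, j)\<in>\<C>. (\<integral>x. d x \<partial>\<nu>) < \<epsilon> \<and> (\<integral>x. j x \<partial>\<nu>) < c"
    then have "net m \<C>" unfolding net_def by (intro conjI allI impI) auto
    then show "\<exists>\<C>. net m \<C>" by (rule exI)
  qed simp
  then obtain \<C> where net: "\<And>m. net m (\<C> m)" by metis
  define \<A> where "\<A> = insert (1 :: real, d0, \<lambda>_. log 2 (real (card \<U>)))
    (\<Union>m. (\<lambda>p. (real (Suc m), p)) ` \<C> m)"
  have "countable \<A>" using net by (auto simp: \<A>_def net_def)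
  have \<A>: "0 < fst p \<and> code T (fst p) (fst (snd p)) (snd (snd p))" if "p \<in> \<A>" for p
    using that d0 net by (fastforce simp: \<A>_def net_def)
  \<comment> \<open>Index 0 is reserved for the cover code, so that it belongs to every initial
    segment of the enumeration.\<close>
  define q where "q i = (case i of 0 \<Rightarrow> (1, d0, \<lambda>_. log 2 (real (card \<U>))) | Suc i \<Rightarrow> from_nat_into \<A> i)" for i
  have "\<A> \<noteq> {}" by (simp add: \<A>_def)
  then have q\<A>: "q i \<in> \<A>" for i by (cases i) (auto simp: q_def \<A>_def[symmetric] intro: from_nat_into, simp add: \<A>_def)
  show thesis
  proof (rule that[of "\<lambda>i. fst (q i)" "\<lambda>i. fst (snd (q i))" "\<lambda>i. snd (snd (q i))"])
    show "0 < fst (q i)" "code T (fst (q i)) (fst (snd (q i))) (snd (snd (q i)))" for i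
      using \<A>[OF q\<A>[of i]] by auto
    show "fst (snd (q 0)) x < \<epsilon>" for x using d0(2) by (simp add: q_def)
    show "snd (snd (q 0)) = (\<lambda>_. log 2 (real (card \<U>)))" by (simp add: q_def)
    fix \<nu> assume \<nu>: "\<nu> \<in> invariant_measures T"
    note p = invariant_measuresD(1,2)[OF \<nu>]
    let ?g = "\<lambda>i. code_rate CARD('n) \<nu> \<epsilon> (fst (q i)) (fst (snd (q i))) (snd (snd (q i)))"
    show "rate_distortion T \<nu> \<epsilon> = (INF i. ?g i)"
    proof (rule antisym)
      show "rate_distortion T \<nu> \<epsilon> \<le> (INF i. ?g i)"
        using \<A>[OF q\<A>] by (intro INF_greatest rate_distortion_le_code_rate \<nu>) auto
      show "(INF i. ?g i) \<le> rate_distortion T \<nu> \<epsilon>"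
      proof (rule ccontr)
        assume "\<not> ?thesis"
        then obtain z where z: "rate_distortion T \<nu> \<epsilon> < z" "z < (INF i. ?g i)" by (auto simp: not_le dest: dense)
        then have "z < top" by (auto intro: less_le_trans)
        then obtain c where c: "z = ennreal c" "0 \<le> c" by (cases z) auto
        have "\<forall>\<^sub>F x in at_top. rate_distortion_L T \<nu> x \<epsilon> / ennreal (x ^ CARD('n)) < ennreal c"
          using order_tendstoD(2)[OF rate_distortion_tendsto[OF \<nu>] z(1)[unfolded c]] by simp
        then obtain x0 where x0: "\<And>x. x0 \<le> x \<Longrightarrow> rate_distortion_L T \<nu> x \<epsilon> / ennreal (x ^ CARD('n)) < ennreal c"
          by (auto simp: eventually_at_top_linorder)
        \<comment> \<open>Codes were collected for integer sides only, so the strict bound is used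
          at an integer side far enough along the limit.\<close>
        obtain m where m: "x0 \<le> real m" using real_arch_simple by blast
        let ?L = "real (Suc m)"
        have "rate_distortion_L T \<nu> ?L \<epsilon> / ennreal (?L ^ CARD('n)) < ennreal c" using m by (intro x0) simp
        then have "rate_distortion_L T \<nu> ?L \<epsilon> < ennreal c * ennreal (?L ^ CARD('n))"
          by (subst (asm) divide_less_ennreal) (auto simp del: of_nat_Suc)
        also have "\<dots> = ennreal (c * ?L ^ CARD('n))" using c by (simp add: ennreal_mult del: of_nat_Suc)
        finally obtain d j where dj: "(d, j) \<in> \<C> m" "(\<integral>x. d x \<partial>\<nu>) < \<epsilon>" "(\<integral>x. j x \<partial>\<nu>) < c * ?L ^ CARD('n)"
          using net[of m] p unfolding net_def by blast
        then have in_\<A>: "(?L, d, j) \<in> \<A>" by (auto simp: \<A>_def)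
        then obtain i where "from_nat_into \<A> i = (?L, d, j)"
          using from_nat_into_surj[OF \<open>countable \<A>\<close>] by blast
        then have qi: "q (Suc i) = (?L, d, j)" by (simp add: q_def)
        have "(INF i. ?g i) \<le> ?g (Suc i)" by (rule INF_lower) simp
        also have "\<dots> = ennreal ((\<integral>x. j x \<partial>\<nu>) / ?L ^ CARD('n))" using dj(2) by (simp add: qi code_rate_def del: of_nat_Suc)
        also have "\<dots> \<le> ennreal c" using dj(3) by (intro ennreal_leI) (simp add: divide_le_eq del: of_nat_Suc)
        finally show False using z(2) c by simp
      qed
    qed
  qed
qed

end

context mixture
begin

lemma integral_measurable_\<Lambda>:
  fixes f :: "'a \<Rightarrow> real"
  assumes "f \<in> borel_measurable borel"
  shows "(\<lambda>\<nu>. \<integral>x. f x \<partial>\<nu>) \<in> borel_measurable \<Lambda>"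
  by (rule measurable_compose[OF id_kernel integral_measurable_subprob_algebra[OF assms]])

text \<open>For each \<open>\<nu>\<close> a best code among the first \<open>N + 1\<close> is
  selected, all of them are tiled to a common side \<open>x\<close>, and the mixture bound is
  applied. Divided by the volume, the cost of the selection tends to zero, and a factor
  \<open>1 + \<delta>\<close> absorbs the overhang of the tiles.\<close>

lemma rate_distortion_le_min_codes:
  assumes L: "\<And>i :: nat. 0 < L i" and code: "\<And>i. code T (L i) (d i) (j i)"
    and d0: "\<And>x. d 0 x < \<epsilon>"
  shows "rate_distortion T \<mu> \<epsilon> \<le>
    (\<integral>\<^sup>+\<nu>. (INF i\<in>{..N}. code_rate CARD('n) \<nu> \<epsilon> (L i) (d i) (j i)) \<partial>\<Lambda>)"
proof -
  let ?D = "CARD('n)"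
  note c = codeD[OF code L]
  define g where "g i \<nu> = code_rate ?D \<nu> \<epsilon> (L i) (d i) (j i)" for i \<nu>
  define G where "G \<nu> = (INF i\<in>{..N}. g i \<nu>)" for \<nu>
  have inv: "\<nu> \<in> invariant_measures T" "prob_space \<nu>" "sets \<nu> = sets borel" if "\<nu> \<in> space \<Lambda>" for \<nu>
    using that invariant_measuresD by (auto simp: space_\<Lambda>)
  have int: "integrable \<nu> (d i)" "integrable \<nu> (j i)" if "\<nu> \<in> space \<Lambda>" for \<nu> i
    using code_integrable[OF code L inv(2,3)[OF that]] by auto
  have g_meas: "g i \<in> borel_measurable \<Lambda>" for i
  proof -
    have [measurable]: "(\<lambda>\<nu>. \<integral>x. d i x \<partial>\<nu>) \<in> borel_measurable \<Lambda>" "(\<lambda>\<nu>. \<integral>x. j i x \<partial>\<nu>) \<in> borel_measurable \<Lambda>"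
      using c by (auto intro: integral_measurable_\<Lambda>)
    show ?thesis unfolding g_def[abs_def] code_rate_def[abs_def] by measurable
  qed
  have G_meas: "G \<in> borel_measurable \<Lambda>"
    unfolding G_def[abs_def] using g_meas by (intro borel_measurable_INF) auto
  \<comment> \<open>Taking the least minimiser makes the selection measurable.\<close>
  define s where "s \<nu> = (LEAST i. g i \<nu> = G \<nu>)" for \<nu>
  have s_meas: "s \<in> measurable \<Lambda> (count_space UNIV)"
    unfolding s_def[abs_def]
  proof (rule measurable_Least)
    fix i
    note g_meas[measurable] G_meas[measurable]
    show "Measurable.pred \<Lambda> (\<lambda>\<nu>. g i \<nu> = G \<nu>)" by measurable
  qed
  have s: "s \<nu> \<le> N" "g (s \<nu>) \<nu> = G \<nu>" for \<nu>
  proof -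
    have "G \<nu> = Min ((\<lambda>i. g i \<nu>) ` {..N})" unfolding G_def by (intro Min_Inf[symmetric]) auto
    also have "\<dots> \<in> (\<lambda>i. g i \<nu>) ` {..N}" by (intro Min_in) auto
    finally obtain i where i: "i \<le> N" "g i \<nu> = G \<nu>" by auto
    show "g (s \<nu>) \<nu> = G \<nu>" unfolding s_def by (rule LeastI[of _ i]) fact
    have "s \<nu> \<le> i" unfolding s_def by (rule Least_le) fact
    then show "s \<nu> \<le> N" using i(1) by simp
  qed
  have G_finite: "G \<nu> < \<infinity>" if "\<nu> \<in> space \<Lambda>" for \<nu>
  proof -
    interpret prob_space \<nu> by (rule inv(2)[OF that])
    have "(\<integral>x. d 0 x \<partial>\<nu>) < \<epsilon>" using expectation_less[OF int(1)[OF that]] d0 by simp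
    then have "g 0 \<nu> < \<infinity>" by (simp add: g_def code_rate_def)
    moreover have "G \<nu> \<le> g 0 \<nu>" unfolding G_def by (rule INF_lower) simp
    ultimately show ?thesis by (rule le_less_trans[rotated])
  qed
  have ds: "(\<integral>x. d (s \<nu>) x \<partial>\<nu>) < \<epsilon>" if "\<nu> \<in> space \<Lambda>" for \<nu>
    using G_finite[OF that] unfolding s(2)[of \<nu>, symmetric] g_def code_rate_def
    by (cases "(\<integral>x. d (s \<nu>) x \<partial>\<nu>) < \<epsilon>") simp_all
  have G_eq: "G \<nu> = ennreal ((\<integral>x. j (s \<nu>) x \<partial>\<nu>) / L (s \<nu>) ^ ?D)" if "\<nu> \<in> space \<Lambda>" for \<nu>
    using ds[OF that] unfolding s(2)[of \<nu>, symmetric] g_def code_rate_def by simp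
  have sel_meas: "(\<lambda>\<nu>. h (s \<nu>) \<nu>) \<in> borel_measurable \<Lambda>" if "\<And>i. h i \<in> borel_measurable \<Lambda>" for h :: "nat \<Rightarrow> 'a measure \<Rightarrow> real"
    by (rule measurable_compose_countable[OF that s_meas])
  have sel_int: "integrable \<Lambda> (\<lambda>\<nu>. h (s \<nu>) \<nu>)"
    if h: "\<And>i. h i \<in> borel_measurable \<Lambda>" "\<And>i \<nu>. \<nu> \<in> space \<Lambda> \<Longrightarrow> 0 \<le> h i \<nu>" "\<And>i. \<exists>b. \<forall>\<nu>\<in>space \<Lambda>. h i \<nu> \<le> b"
    for h :: "nat \<Rightarrow> 'a measure \<Rightarrow> real"
  proof -
    obtain b where b: "\<And>i \<nu>. \<nu> \<in> space \<Lambda> \<Longrightarrow> h i \<nu> \<le> b i" using h(3) by metis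
    show ?thesis
    proof (rule \<Lambda>.integrable_const_bound[where B = "\<Sum>i\<le>N. \<bar>b i\<bar>", OF AE_I2 sel_meas[OF h(1)]])
      fix \<nu> assume \<nu>: "\<nu> \<in> space \<Lambda>"
      have "\<bar>h (s \<nu>) \<nu>\<bar> \<le> \<bar>b (s \<nu>)\<bar>" using h(2)[OF \<nu>, of "s \<nu>"] b[OF \<nu>, of "s \<nu>"] by simp
      also have "\<dots> \<le> (\<Sum>i\<le>N. \<bar>b i\<bar>)" using s(1)[of \<nu>] by (intro member_le_sum) auto
      finally show "norm (h (s \<nu>) \<nu>) \<le> (\<Sum>i\<le>N. \<bar>b i\<bar>)" by simp
    qed
  qed
  have j_bound: "\<exists>b. \<forall>\<nu>\<in>space \<Lambda>. (\<integral>x. j i x \<partial>\<nu>) \<le> b" for i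
  proof -
    obtain b where b: "\<And>x. j i x \<le> b" using c(6) by blast
    have "(\<integral>x. j i x \<partial>\<nu>) \<le> b" if "\<nu> \<in> space \<Lambda>" for \<nu>
    proof -
      interpret prob_space \<nu> by (rule inv(2)[OF that])
      show ?thesis using integral_le_const[OF int(2)[OF that]] b by simp
    qed
    then show ?thesis by blast
  qed
  have d_bound: "(\<integral>x. d i x \<partial>\<nu>) \<le> diameter (UNIV :: 'a set)" if "\<nu> \<in> space \<Lambda>" for i \<nu>
  proof -
    interpret prob_space \<nu> by (rule inv(2)[OF that])
    show ?thesis using integral_le_const[OF int(1)[OF that]] c(3) by simp
  qed
  let ?d = "\<lambda>\<nu>. \<integral>x. d (s \<nu>) x \<partial>\<nu>" and ?j = "\<lambda>\<nu>. (\<integral>x. j (s \<nu>) x \<partial>\<nu>) / L (s \<nu>) ^ ?D"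
  have d_int: "integrable \<Lambda> ?d"
    using c d_bound
    by (intro sel_int[of "\<lambda>i \<nu>. \<integral>x. d i x \<partial>\<nu>"] integral_measurable_\<Lambda> exI[of _ "diameter (UNIV :: 'a set)"]) auto
  have j_int: "integrable \<Lambda> ?j"
  proof (rule sel_int[of "\<lambda>i \<nu>. (\<integral>x. j i x \<partial>\<nu>) / L i ^ ?D"])
    show "(\<lambda>\<nu>. (\<integral>x. j i x \<partial>\<nu>) / L i ^ ?D) \<in> borel_measurable \<Lambda>" for i
      using c by (intro borel_measurable_divide integral_measurable_\<Lambda>) auto
    show "0 \<le> (\<integral>x. j i x \<partial>\<nu>) / L i ^ ?D" for i \<nu> using c L by (simp add: less_imp_le)
    show "\<exists>b. \<forall>\<nu>\<in>space \<Lambda>. (\<integral>x. j i x \<partial>\<nu>) / L i ^ ?D \<le> b" for i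
    proof -
      obtain b where "\<forall>\<nu>\<in>space \<Lambda>. (\<integral>x. j i x \<partial>\<nu>) \<le> b" using j_bound by blast
      then have "\<forall>\<nu>\<in>space \<Lambda>. (\<integral>x. j i x \<partial>\<nu>) / L i ^ ?D \<le> b / L i ^ ?D"
        using L by (intro ballI divide_right_mono) (auto simp: less_imp_le)
      then show ?thesis by blast
    qed
  qed
  have j_nonneg: "0 \<le> ?j \<nu>" for \<nu> using c L by (simp add: less_imp_le)
  define a where "a = (\<integral>\<nu>. ?d \<nu> \<partial>\<Lambda>)"
  define I where "I = (\<integral>\<nu>. ?j \<nu> \<partial>\<Lambda>)"
  \<comment> \<open>Strict, since the selected code meets the strict constraint for every
    \<open>\<nu>\<close> and \<open>\<Lambda>\<close> is a probability measure. This gap leaves room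
    for \<open>1 + \<delta>\<close>.\<close>
  have a: "0 \<le> a" "a < \<epsilon>"
    using c(2) ds \<Lambda>.expectation_less[OF d_int] by (auto simp: a_def)
  have I0: "0 \<le> I" unfolding I_def using j_nonneg by simp
  have G_int: "(\<integral>\<^sup>+\<nu>. G \<nu> \<partial>\<Lambda>) = ennreal I"
    unfolding I_def using j_nonneg
    by (subst nn_integral_eq_integral[OF j_int, symmetric]) (auto intro!: nn_integral_cong simp: G_eq)
  define \<rho> where "\<rho> i x = (real (nat \<lceil>x / L i\<rceil>) * L i / x) ^ ?D" for i x
  have \<rho>_lim: "\<forall>\<^sub>F x in at_top. \<rho> i x < 1 + \<delta>" if "0 < \<delta>" for i \<delta>
    using tile_distortion_eventually[OF L[of i], of 1 "1 + \<delta>"] that by (simp add: \<rho>_def)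
  \<comment> \<open>Only the finitely many ratios \<open>\<rho> i x\<close> with
    \<open>i \<le> N\<close> matter, so one \<open>x\<close> serves them all; this is where the
    truncation is used a second time.\<close>
  have bound: "rate_distortion T \<mu> \<epsilon> \<le> ennreal ((1 + \<delta>) * I)" if \<delta>: "0 < \<delta>" "(1 + \<delta>) * a < \<epsilon>" for \<delta>
  proof (rule tendsto_le)
    show "((\<lambda>x. rate_distortion_L T \<mu> x \<epsilon> / ennreal (x ^ ?D)) \<longlongrightarrow> rate_distortion T \<mu> \<epsilon>) at_top"
      by (rule rate_distortion_tendsto[OF \<mu>_inv])
    have "((\<lambda>x. (1 + \<delta>) * I + log 2 (real N + 1) * inverse x ^ ?D) \<longlongrightarrow> (1 + \<delta>) * I + log 2 (real N + 1) * 0 ^ ?D) at_top"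
      by (intro tendsto_intros tendsto_inverse_0_at_top filterlim_ident)
    then show "((\<lambda>x. ennreal ((1 + \<delta>) * I + log 2 (real N + 1) * inverse x ^ ?D)) \<longlongrightarrow> ennreal ((1 + \<delta>) * I)) at_top"
      by (intro tendsto_ennrealI) (simp add: power_0_left)
    have "\<forall>\<^sub>F x in at_top. \<forall>i\<in>{..N}. \<rho> i x < 1 + \<delta>"
      using \<rho>_lim[OF \<delta>(1)] by (intro eventually_ball_finite) auto
    then show "\<forall>\<^sub>F x in at_top. rate_distortion_L T \<mu> x \<epsilon> / ennreal (x ^ ?D) \<le>
      ennreal ((1 + \<delta>) * I + log 2 (real N + 1) * inverse x ^ ?D)"
      using eventually_gt_at_top[of 0]
    proof eventually_elim
      case (elim x)
      have "\<exists>d' j'. code T x d' j' \<and>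
          (\<forall>\<nu>\<in>invariant_measures T. (\<integral>y. d' y \<partial>\<nu>) \<le> \<rho> i x * (\<integral>y. d i y \<partial>\<nu>)) \<and>
          (\<forall>\<nu>\<in>invariant_measures T. (\<integral>y. j' y \<partial>\<nu>) = real (nat \<lceil>x / L i\<rceil>) ^ ?D * (\<integral>y. j i y \<partial>\<nu>))" for i
        by (rule tile_code_invariant[OF code[of i] L[of i] elim(2) le_nat_ceiling_mult[OF L[of i]]])
          (auto simp: \<rho>_def)
      then obtain d' j' where dj': "\<And>i. code T x (d' i) (j' i)"
        "\<And>i \<nu>. \<nu> \<in> invariant_measures T \<Longrightarrow> (\<integral>y. d' i y \<partial>\<nu>) \<le> \<rho> i x * (\<integral>y. d i y \<partial>\<nu>)"
        "\<And>i \<nu>. \<nu> \<in> invariant_measures T \<Longrightarrow> (\<integral>y. j' i y \<partial>\<nu>) = real (nat \<lceil>x / L i\<rceil>) ^ ?D * (\<integral>y. j i y \<partial>\<nu>)"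
        by metis
      have \<rho>s: "\<rho> (s \<nu>) x \<le> 1 + \<delta>" for \<nu> using elim(1) s(1)[of \<nu>] by (auto intro: less_imp_le)
      \<comment> \<open>\<open>integral_mono_AE'\<close> asks for integrability of the larger,
        nonnegative side only; a function that is not integrable has integral 0 by
        convention.\<close>
      have "(\<integral>\<nu>. \<integral>y. d' (s \<nu>) y \<partial>\<nu> \<partial>\<Lambda>) \<le> (\<integral>\<nu>. (1 + \<delta>) * ?d \<nu> \<partial>\<Lambda>)"
      proof (rule integral_mono_AE'[OF integrable_mult_right[OF d_int]])
        show "AE \<nu> in \<Lambda>. (\<integral>y. d' (s \<nu>) y \<partial>\<nu>) \<le> (1 + \<delta>) * ?d \<nu>"
        proof (rule AE_I2)
          fix \<nu> assume \<nu>: "\<nu> \<in> space \<Lambda>"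
          have "(\<integral>y. d' (s \<nu>) y \<partial>\<nu>) \<le> \<rho> (s \<nu>) x * ?d \<nu>" by (rule dj'(2)[OF inv(1)[OF \<nu>]])
          also have "\<dots> \<le> (1 + \<delta>) * ?d \<nu>" using c(2) by (intro mult_right_mono \<rho>s) simp
          finally show "(\<integral>y. d' (s \<nu>) y \<partial>\<nu>) \<le> (1 + \<delta>) * ?d \<nu>" .
        qed
        show "AE \<nu> in \<Lambda>. 0 \<le> (1 + \<delta>) * ?d \<nu>" using c(2) \<delta> by simp
      qed
      also have "\<dots> = (1 + \<delta>) * a" by (simp add: a_def)
      finally have "(\<integral>\<nu>. \<integral>y. d' (s \<nu>) y \<partial>\<nu> \<partial>\<Lambda>) < \<epsilon>" using \<delta>(2) by simp
      from mixture_rate_le[OF s_meas s(1) dj'(1) elim(2) this]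
      have 1: "rate_distortion_L T \<mu> x \<epsilon> \<le> ennreal ((\<integral>\<nu>. \<integral>y. j' (s \<nu>) y \<partial>\<nu> \<partial>\<Lambda>) + log 2 (real N + 1))" by simp
      have "(\<integral>\<nu>. \<integral>y. j' (s \<nu>) y \<partial>\<nu> \<partial>\<Lambda>) \<le> (\<integral>\<nu>. (1 + \<delta>) * x ^ ?D * ?j \<nu> \<partial>\<Lambda>)"
      proof (rule integral_mono_AE'[OF integrable_mult_right[OF j_int]])
        show "AE \<nu> in \<Lambda>. (\<integral>y. j' (s \<nu>) y \<partial>\<nu>) \<le> (1 + \<delta>) * x ^ ?D * ?j \<nu>"
        proof (rule AE_I2)
          fix \<nu> assume \<nu>: "\<nu> \<in> space \<Lambda>"
          \<comment> \<open>The number of tiles equals \<open>\<rho> (s \<nu>) x\<close> times the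
            volume ratio of the large cube to one tile; the latter turns the integral of
            \<open>j\<close> into a rate per volume.\<close>
          have "(\<integral>y. j' (s \<nu>) y \<partial>\<nu>) = \<rho> (s \<nu>) x * x ^ ?D * ?j \<nu>"
            using elim(2) L[of "s \<nu>"] by (simp add: dj'(3)[OF inv(1)[OF \<nu>]] \<rho>_def power_divide power_mult_distrib)
          also have "\<dots> \<le> (1 + \<delta>) * x ^ ?D * ?j \<nu>"
            using elim(2) by (intro mult_right_mono \<rho>s j_nonneg) auto
          finally show "(\<integral>y. j' (s \<nu>) y \<partial>\<nu>) \<le> (1 + \<delta>) * x ^ ?D * ?j \<nu>" .
        qed
        show "AE \<nu> in \<Lambda>. 0 \<le> (1 + \<delta>) * x ^ ?D * ?j \<nu>"
          using \<delta> elim(2) by (intro AE_I2 mult_nonneg_nonneg j_nonneg) auto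
      qed
      also have "\<dots> = (1 + \<delta>) * x ^ ?D * I" unfolding I_def by (rule integral_mult_right_zero)
      finally have "rate_distortion_L T \<mu> x \<epsilon> \<le> ennreal ((1 + \<delta>) * x ^ ?D * I + log 2 (real N + 1))"
        using 1 by (elim order.trans) (intro ennreal_leI, simp)
      then have "rate_distortion_L T \<mu> x \<epsilon> / ennreal (x ^ ?D) \<le>
          ennreal ((1 + \<delta>) * x ^ ?D * I + log 2 (real N + 1)) / ennreal (x ^ ?D)"
        by (rule divide_right_mono_ennreal)
      also have "\<dots> = ennreal (((1 + \<delta>) * x ^ ?D * I + log 2 (real N + 1)) / x ^ ?D)"
        using elim(2) \<delta> I0 by (intro divide_ennreal) auto
      also have "((1 + \<delta>) * x ^ ?D * I + log 2 (real N + 1)) / x ^ ?D = (1 + \<delta>) * I + log 2 (real N + 1) * inverse x ^ ?D"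
        using elim(2) by (simp add: field_simps)
      finally show ?case .
    qed
  qed simp
  have "rate_distortion T \<mu> \<epsilon> \<le> ennreal I"
  proof (rule tendsto_lowerbound)
    have "((\<lambda>\<delta>. (1 + \<delta>) * I) \<longlongrightarrow> (1 + 0) * I) (at_right 0)" by (intro tendsto_intros)
    then show "((\<lambda>\<delta>. ennreal ((1 + \<delta>) * I)) \<longlongrightarrow> ennreal I) (at_right 0)" by (intro tendsto_ennrealI) simp
    have "((\<lambda>\<delta>. (1 + \<delta>) * a) \<longlongrightarrow> (1 + 0) * a) (at_right 0)" by (intro tendsto_intros)
    then have "\<forall>\<^sub>F \<delta> in at_right 0. (1 + \<delta>) * a < \<epsilon>" using a(2) by (intro order_tendstoD) auto
    moreover have "\<forall>\<^sub>F \<delta> in at_right (0 :: real). 0 < \<delta>" by (simp add: eventually_at_right_less)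
    ultimately show "\<forall>\<^sub>F \<delta> in at_right 0. rate_distortion T \<mu> \<epsilon> \<le> ennreal ((1 + \<delta>) * I)"
      by eventually_elim (rule bound)
  qed simp
  then show ?thesis by (simp add: G_int[unfolded G_def g_def])
qed

text \<open>Measurability holds because the rate is a countable infimum of measurable functions. The
  inequality for each finite set of candidates passes to all of them by decreasing monotone
  convergence; the constant information of the cover code provides the finite integrals this
  requires.\<close>

lemma rate_distortion_convex:
  assumes \<epsilon>: "0 < \<epsilon>"
  shows "(\<lambda>\<nu>. rate_distortion T \<nu> \<epsilon>) \<in> borel_measurable \<Lambda>"
    and "rate_distortion T \<mu> \<epsilon> \<le> (\<integral>\<^sup>+\<nu>. rate_distortion T \<nu> \<epsilon> \<partial>\<Lambda>)"
proof -
  obtain L d j c where L: "\<And>i :: nat. 0 < L i" and code: "\<And>i. code T (L i) (d i) (j i)"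
    and d0: "\<And>x. d 0 x < \<epsilon>" and j0: "j 0 = (\<lambda>_. c)"
    and inf: "\<And>\<nu>. \<nu> \<in> invariant_measures T \<Longrightarrow>
       rate_distortion T \<nu> \<epsilon> = (INF i. code_rate CARD('n) \<nu> \<epsilon> (L i) (d i) (j i))"
    by (rule rate_distortion_eq_INF_codes[OF \<epsilon>]) blast
  let ?g = "\<lambda>i \<nu>. code_rate CARD('n) \<nu> \<epsilon> (L i) (d i) (j i)"
  have g_meas: "?g i \<in> borel_measurable \<Lambda>" for i
  proof -
    have [measurable]: "(\<lambda>\<nu>. \<integral>x. d i x \<partial>\<nu>) \<in> borel_measurable \<Lambda>" "(\<lambda>\<nu>. \<integral>x. j i x \<partial>\<nu>) \<in> borel_measurable \<Lambda>"
      using codeD[OF code L] by (auto intro: integral_measurable_\<Lambda>)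
    show ?thesis unfolding code_rate_def[abs_def] by measurable
  qed
  have rate: "rate_distortion T \<nu> \<epsilon> = (INF i. ?g i \<nu>)" if "\<nu> \<in> space \<Lambda>" for \<nu>
    using inf that by (simp add: space_\<Lambda>)
  have "(\<lambda>\<nu>. INF i. ?g i \<nu>) \<in> borel_measurable \<Lambda>" using g_meas by (intro borel_measurable_INF) auto
  then show "(\<lambda>\<nu>. rate_distortion T \<nu> \<epsilon>) \<in> borel_measurable \<Lambda>" by (simp add: rate cong: measurable_cong)
  let ?G = "\<lambda>N \<nu>. INF i\<in>{..N}. ?g i \<nu>"
  have G_meas: "?G N \<in> borel_measurable \<Lambda>" for N using g_meas by (intro borel_measurable_INF) auto
  have "(\<integral>\<^sup>+\<nu>. ?G N \<nu> \<partial>\<Lambda>) < \<infinity>" for N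
  proof -
    have "?G N \<nu> \<le> ennreal (c / L 0 ^ CARD('n))" if "\<nu> \<in> space \<Lambda>" for \<nu>
    proof -
      have p: "prob_space \<nu>" "sets \<nu> = sets borel" using that invariant_measuresD by (auto simp: space_\<Lambda>)
      interpret prob_space \<nu> by (rule p)
      have "(\<integral>x. d 0 x \<partial>\<nu>) < \<epsilon>" using expectation_less[OF code_integrable(1)[OF code L p]] d0 by simp
      then have "?g 0 \<nu> = ennreal (c / L 0 ^ CARD('n))" by (simp add: code_rate_def j0 prob_space)
      then show ?thesis by (intro INF_lower2[of 0]) auto
    qed
    then have "(\<integral>\<^sup>+\<nu>. ?G N \<nu> \<partial>\<Lambda>) \<le> (\<integral>\<^sup>+\<nu>. ennreal (c / L 0 ^ CARD('n)) \<partial>\<Lambda>)" by (rule nn_integral_mono)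
    also have "\<dots> < \<infinity>" by (simp add: \<Lambda>.emeasure_space_1)
    finally show ?thesis .
  qed
  moreover have "decseq ?G" by (intro decseq_SucI le_funI INF_superset_mono) auto
  ultimately have "(\<integral>\<^sup>+\<nu>. (INF N. ?G N \<nu>) \<partial>\<Lambda>) = (INF N. \<integral>\<^sup>+\<nu>. ?G N \<nu> \<partial>\<Lambda>)"
    using G_meas by (intro nn_integral_monotone_convergence_INF_decseq)
  moreover have "(INF N. ?G N \<nu>) = (INF i. ?g i \<nu>)" for \<nu>
    by (intro antisym INF_greatest) (auto intro!: INF_lower INF_lower2)
  ultimately have "(\<integral>\<^sup>+\<nu>. rate_distortion T \<nu> \<epsilon> \<partial>\<Lambda>) = (INF N. \<integral>\<^sup>+\<nu>. ?G N \<nu> \<partial>\<Lambda>)"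
    by (simp add: rate cong: nn_integral_cong)
  also have "rate_distortion T \<mu> \<epsilon> \<le> \<dots>"
    by (intro INF_greatest rate_distortion_le_min_codes[where L = L and d = d and j = j and \<epsilon> = \<epsilon>] L code d0)
  finally show "rate_distortion T \<mu> \<epsilon> \<le> (\<integral>\<^sup>+\<nu>. rate_distortion T \<nu> \<epsilon> \<partial>\<Lambda>)" .
qed

end

section \<open>From sequences to the upper limit at zero, and the reverse Fatou argument\<close>

lemma Limsup_at_right_le_sequences:
  fixes \<phi> :: "real \<Rightarrow> ennreal"
  assumes "\<And>e. (\<And>k :: nat. 0 < e k) \<Longrightarrow> e \<longlonglongrightarrow> 0 \<Longrightarrow> limsup (\<lambda>k. \<phi> (e k)) \<le> b"
  shows "Limsup (at_right 0) \<phi> \<le> b"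
proof (rule ccontr)
  assume "\<not> ?thesis"
  then obtain z where z: "b < z" "z < Limsup (at_right 0) \<phi>" by (auto simp: not_le dest: dense)
  \<comment> \<open>If the bound fails, values above \<open>z\<close> occur arbitrarily close to
    zero, and picking one per \<open>k\<close> gives a null sequence that contradicts the
    hypothesis.\<close>
  have "\<exists>x. 0 < x \<and> x < inverse (real (Suc k)) \<and> z < \<phi> x" for k
  proof (rule ccontr)
    assume none: "\<not> ?thesis"
    have "\<forall>\<^sub>F x in at_right 0. 0 < x \<and> x < inverse (real (Suc k))"
      by (auto simp: eventually_at_right_field intro!: exI[of _ "inverse (real (Suc k))"])
    then have "\<forall>\<^sub>F x in at_right 0. \<phi> x \<le> z"
      by eventually_elim (use none in \<open>meson not_less\<close>)
    then have "Limsup (at_right 0) \<phi> \<le> z" by (rule Limsup_bounded)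
    then show False using z(2) by simp
  qed
  then obtain e where e: "\<And>k. 0 < e k" "\<And>k. e k < inverse (real (Suc k))" "\<And>k. z < \<phi> (e k)" by metis
  have "e \<longlonglongrightarrow> 0"
    by (rule tendsto_sandwich[OF always_eventually always_eventually tendsto_const LIMSEQ_inverse_real_of_nat])
      (use e in \<open>auto intro: less_imp_le\<close>)
  from assms[OF e(1) this] have "limsup (\<lambda>k. \<phi> (e k)) \<le> b" .
  moreover have "z \<le> limsup (\<lambda>k. \<phi> (e k))"
    using e(3) by (intro le_Limsup always_eventually) (auto intro: less_imp_le)
  ultimately show False using z(1) by simp
qed

lemma eventually_sequence_at_right:
  assumes "\<And>k :: nat. 0 < e k" "e \<longlonglongrightarrow> (0 :: real)" "\<forall>\<^sub>F x in at_right 0. P x"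
  shows "\<forall>\<^sub>F k in sequentially. P (e k)"
proof -
  have "filterlim e (at_right 0) sequentially"
    by (intro tendsto_imp_filterlim_at_right assms(2) always_eventually allI assms(1))
  then show ?thesis using assms(3) unfolding filterlim_iff by blast
qed

lemma limsup_le_Limsup_at_right:
  fixes \<phi> :: "real \<Rightarrow> ennreal"
  assumes "\<And>k :: nat. 0 < e k" "e \<longlonglongrightarrow> 0"
  shows "limsup (\<lambda>k. \<phi> (e k)) \<le> Limsup (at_right 0) \<phi>"
proof (rule dense_ge)
  fix z assume "Limsup (at_right 0) \<phi> < z"
  then have "\<forall>\<^sub>F x in at_right 0. \<phi> x < z" by (rule Limsup_lessD)
  from eventually_sequence_at_right[OF assms this]
  show "limsup (\<lambda>k. \<phi> (e k)) \<le> z" by (intro Limsup_bounded) (auto elim: eventually_mono)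
qed

context mixture
begin

text \<open>The reverse Fatou lemma speaks of sequences, so \<open>\<epsilon>\<close> runs along an
  arbitrary null sequence. Its dominating function is a constant, by comparison with the metric
  entropy rate.\<close>

theorem upper_rdim_convex:
  assumes "upper_mdim T < \<infinity>"
  shows "upper_rdim T \<mu> \<le> (\<integral>\<^sup>+\<nu>. upper_rdim T \<nu> \<partial>\<Lambda>)"
  unfolding upper_rdim_def[of T \<mu>]
proof (rule Limsup_at_right_le_sequences)
  fix e :: "nat \<Rightarrow> real" assume e: "\<And>k. 0 < e k" "e \<longlonglongrightarrow> 0"
  \<comment> \<open>Any finite number strictly above the upper metric mean dimension eventually
    dominates the quotients; strictness is what turns the upper limit into an eventual
    bound.\<close>
  obtain C where C: "upper_mdim T < C" "C < \<infinity>" using dense[OF assms] by blast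
  have "\<forall>\<^sub>F \<epsilon> in at_right 0. metric_entropy_rate T \<epsilon> / ennreal (log 2 (1 / \<epsilon>)) < C"
    using C(1) unfolding upper_mdim_def by (rule Limsup_lessD)
  from eventually_sequence_at_right[OF e this]
  have "\<forall>\<^sub>F k in sequentially. metric_entropy_rate T (e k) / ennreal (log 2 (1 / e k)) < C" .
  then obtain k0 where k0: "\<And>k. k0 \<le> k \<Longrightarrow> metric_entropy_rate T (e k) / ennreal (log 2 (1 / e k)) < C"
    by (auto simp: eventually_sequentially)
  let ?q = "\<lambda>\<nu> k. rate_distortion T \<nu> (e k) / ennreal (log 2 (1 / e k))"
  have meas: "(\<lambda>\<nu>. ?q \<nu> k) \<in> borel_measurable \<Lambda>" for k
    using rate_distortion_convex(1)[OF e(1)[of k]] by (intro borel_measurable_divide_ennreal) auto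
  \<comment> \<open>Shifting by \<open>k0\<close> makes the domination hold for all indices and
    leaves the upper limit unchanged.\<close>
  have "limsup (\<lambda>k. ?q \<mu> k) = limsup (\<lambda>k. ?q \<mu> (k + k0))" by (rule limsup_shift_k[symmetric])
  also have "\<dots> \<le> limsup (\<lambda>k. \<integral>\<^sup>+\<nu>. ?q \<nu> (k + k0) \<partial>\<Lambda>)"
  proof (intro Limsup_mono always_eventually allI)
    fix k
    have "?q \<mu> (k + k0) \<le> (\<integral>\<^sup>+\<nu>. rate_distortion T \<nu> (e (k + k0)) \<partial>\<Lambda>) / ennreal (log 2 (1 / e (k + k0)))"
      by (intro divide_right_mono_ennreal rate_distortion_convex(2) e)
    also have "\<dots> = (\<integral>\<^sup>+\<nu>. ?q \<nu> (k + k0) \<partial>\<Lambda>)"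
      by (intro nn_integral_divide[symmetric] rate_distortion_convex(1) e)
    finally show "?q \<mu> (k + k0) \<le> (\<integral>\<^sup>+\<nu>. ?q \<nu> (k + k0) \<partial>\<Lambda>)" .
  qed
  also have "\<dots> \<le> (\<integral>\<^sup>+\<nu>. limsup (\<lambda>k. ?q \<nu> (k + k0)) \<partial>\<Lambda>)"
  proof (rule nn_integral_limsup[where w = "\<lambda>_. C"])
    show "AE \<nu> in \<Lambda>. ?q \<nu> (k + k0) \<le> C" for k
    proof (rule AE_I2)
      fix \<nu> assume "\<nu> \<in> space \<Lambda>"
      then have "?q \<nu> (k + k0) \<le> metric_entropy_rate T (e (k + k0)) / ennreal (log 2 (1 / e (k + k0)))"
        by (intro divide_right_mono_ennreal rate_distortion_le_metric_entropy_rate e) (simp add: space_\<Lambda>)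
      also have "\<dots> \<le> C" using k0[of "k + k0"] by simp
      finally show "?q \<nu> (k + k0) \<le> C" .
    qed
  qed (use meas C in \<open>auto simp: \<Lambda>.emeasure_space_1\<close>)
  also have "\<dots> = (\<integral>\<^sup>+\<nu>. limsup (\<lambda>k. ?q \<nu> k) \<partial>\<Lambda>)"
    by (intro nn_integral_cong limsup_shift_k)
  \<comment> \<open>The upper limit along the sequence is at most the one over all small
    \<open>\<epsilon>\<close>. The comparison is pointwise in \<open>\<nu>\<close>, and
    \<open>nn_integral_mono\<close> carries it over to the integrals.\<close>
  also have "\<dots> \<le> (\<integral>\<^sup>+\<nu>. upper_rdim T \<nu> \<partial>\<Lambda>)"
    unfolding upper_rdim_def
    by (intro nn_integral_mono limsup_le_Limsup_at_right[where \<phi> = "\<lambda>\<epsilon>. rate_distortion T _ \<epsilon> / ennreal (log 2 (1 / \<epsilon>))"] e)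
  finally show "limsup (\<lambda>k. ?q \<mu> k) \<le> (\<integral>\<^sup>+\<nu>. upper_rdim T \<nu> \<partial>\<Lambda>)" .
qed

end

theorem theorem1p1:
  fixes T :: "real ^ 'n::finite \<Rightarrow> 'a::polish_space \<Rightarrow> 'a"
    and \<Lambda> :: "'a measure measure"
    and \<mu> :: "'a measure"
  assumes "compact (UNIV :: 'a set)"
    and "continuous_action T"
    and "upper_mdim T < \<infinity>"
    and "prob_space \<Lambda>"
    and "sets \<Lambda> = sets (borel_of (weak_star_topology T))"
    and "\<mu> \<in> invariant_measures T"
    and "\<And>A. A \<in> sets borel \<Longrightarrow> emeasure \<mu> A = (\<integral>\<^sup>+\<nu>. emeasure \<nu> A \<partial>\<Lambda>)"
  shows "upper_rdim T \<mu> \<le> (\<integral>\<^sup>+\<nu>. upper_rdim T \<nu> \<partial>\<Lambda>)"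
proof -
  interpret mixture T \<Lambda> \<mu>
    by (intro mixture.intro compact_action.intro mixture_axioms.intro assms)
  show ?thesis by (rule upper_rdim_convex[OF assms(3)])
qed

end
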